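(* Consider the LCQ queueing system of size $n$ described in the context, and let $(\mathbf{v}(\cdot),\chi)$ be the limit in distribution of $(\mathbf{u}(\cdot),\xi)$ along a convergent subsequence of $\{n\}$. Then: (a) the limit measure $\chi$ satisfies $\chi([0,t)\times A)=\int_0^t\pi_{\mathbf{v}(s)}(A)\,ds$ for all $t>0$ and Borel $A\subseteq\Omega$, where for each $s>0$, $\pi_{\mathbf{v}(s)}$ is an equilibrium (stationary) distribution of the process $\omega^{\mathbf{v}(s)}(\cdot)$ such that $\pi_{\mathbf{v}(s)}(\omega_k=\infty)=1$ whenever $v_k(s)>0$; (b) the limit trajectory $\mathbf{v}(\cdot)$ satisfies, for $k=1,2,\dots$, \[\frac{d}{dt}v_k(t)=\lambda(v_{k-1}(t)-v_k(t))-E_{\pi_{\mathbf{v}(t)}}\big[(1-q)^{\omega_{k+1}}-(1-q)^{\omega_k}\big],\] where $E_{\pi_{\mathbf{v}(t)}}$ denotes expectation with respect to $\pi_{\mathbf{v}(t)}$.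
   Context: System model: $n$ queues; packets arrive to each queue by independent Poisson processes of rate $\lambda<1$; transmission times are i.i.d. exponential with mean $n^{-1}$; at most one queue transmits at a time; at each scheduling instant each queue is independently connected with probability $q\in(0,1]$, independently of queue lengths and the past. The LCQ policy transmits from a longest connected queue (idling an exponential time of mean $n^{-1}$ if none is nonempty and connected). Let $m_k(t)$ be the number of queues with at least $k$ packets, $u_k(t)=m_k(t)/n$, $\mathbf{m}(t)=\{m_k(t)\}$, $\mathbf{u}(t)=\{u_k(t)\}$. Then $\mathbf{u}(\cdot)$ is a Markov process on $U=\{\mathbf{u}:1=u_0\ge u_1\ge\cdots\ge0\}$ (metric $\rho(\mathbf{u},\mathbf{u}')=\sup_{k>0}|u_k-u'_k|/k$) with jumps $\mathbf{u}\to\mathbf{u}+n^{-1}\mathbf{e}_k$ at rate $n\lambda(u_{k-1}-u_k)$ and $\mathbf{u}\to\mathbf{u}-n^{-1}\mathbf{e}_k$ at rate $n((1-q)^{nu_{k+1}}-(1-q)^{nu_k})$, $k\ge1$, where $\mathbf{e}_k$ has $1$ in coordinate $k$ and $0$ elsewhere. Let $\Omega$ be the set of sequences $\omega=\{\omega_k\}_{k\ge0}$ with $\omega_k\in\mathbb{Z}_+\cup\{\infty\}$, $\omega_0=\infty$, $\omega_k\ge\omega_{k+1}$, with metric $\rho_o(\omega,\omega')=\rho(h(\omega),h(\omega'))$ where $h(\omega)=\{(1+\omega_k)^{-1}\}_{k\ge0}$ (conventions $1+\infty=\infty$, $1/\infty=0$); $\Omega$ is compact. Let $\mathcal{L}$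 be the set of measures $\mu$ on $[0,\infty)\times\Omega$ with $\mu([0,t)\times\Omega)=t$ for all $t>0$, topologized by weak convergence of restrictions to $[0,t)\times\Omega$ for each $t$. The random element $\xi\in\mathcal{L}$ is $\xi([0,t)\times A)=\int_0^t1\{\mathbf{m}(s)\in A\}ds$ ($\mathbf{m}(s)$ regarded as an element of $\Omega$). For fixed $\mathbf{u}\in U$, $\omega^{\mathbf{u}}(\cdot)$ is the Markov process on $\Omega$ with transitions $\omega\to\omega+\mathbf{e}_k$ at rate $\lambda(u_{k-1}-u_k)$ and $\omega\to\omega-\mathbf{e}_k$ at rate $(1-q)^{\omega_{k+1}}-(1-q)^{\omega_k}$, $k\ge1$ (with $\infty\pm1=\infty$, $(1-q)^\infty=0$).
   Formalization: In (b) the differential equation is proved in integral form for all t ≥ 0 and as a derivative for almost every t > 0, since v_k can have kinks (e.g. when v_1 hits 0) where it is not differentiable; conclusions hold almost surely and λ > 0 is assumed. *)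

theory Defs
  imports "HOL-Probability.Probability"
begin

definition Uset :: "(nat \<Rightarrow> real) set" where
  "Uset = {u. u 0 = 1 \<and> (\<forall>k. u (Suc k) \<le> u k) \<and> (\<forall>k. 0 \<le> u k)}"

definition rhoU :: "(nat \<Rightarrow> real) \<Rightarrow> (nat \<Rightarrow> real) \<Rightarrow> real" where
  "rhoU u u' = (SUP k\<in>{1..}. \<bar>u k - u' k\<bar> / real k)"

definition OmegaS :: "(nat \<Rightarrow> enat) set" where
  "OmegaS = {w. w 0 = \<infinity> \<and> (\<forall>k. w (Suc k) \<le> w k)}"

definition hO :: "enat \<Rightarrow> real" where
  "hO e = (case e of enat j \<Rightarrow> 1 / (1 + real j) | \<infinity> \<Rightarrow> 0)"

definition rhoO :: "(nat \<Rightarrow> enat) \<Rightarrow> (nat \<Rightarrow> enat) \<Rightarrow> real" where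
  "rhoO w w' = (SUP k\<in>{1..}. \<bar>hO (w k) - hO (w' k)\<bar> / real k)"

definition pw :: "real \<Rightarrow> enat \<Rightarrow> real" where
  "pw q e = (case e of enat j \<Rightarrow> (1 - q) ^ j | \<infinity> \<Rightarrow> 0)"

text \<open>Generator of omega^u: omega -> omega + e_k at rate lam (u_{k-1} - u_k), omega -> omega - e_k
  at rate (1-q)^{omega_{k+1}} - (1-q)^{omega_k}, k >= 1 (infinity +- 1 = infinity).\<close>
definition genO :: "real \<Rightarrow> real \<Rightarrow> (nat \<Rightarrow> real) \<Rightarrow> ((nat \<Rightarrow> enat) \<Rightarrow> real) \<Rightarrow> (nat \<Rightarrow> enat) \<Rightarrow> real" where
  "genO lam q u f w =
     (\<Sum>j. lam * (u j - u (Suc j)) * (f (w(Suc j := w (Suc j) + 1)) - f w)) +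
     (\<Sum>j. (pw q (w (Suc (Suc j))) - pw q (w (Suc j))) * (f (w(Suc j := w (Suc j) - 1)) - f w))"

text \<open>pi is an equilibrium (stationary) distribution of the bounded-rate chain omega^u:
  the integral of the generator applied to any bounded function vanishes.\<close>
definition stationaryO :: "real \<Rightarrow> real \<Rightarrow> (nat \<Rightarrow> real) \<Rightarrow> (nat \<Rightarrow> enat) pmf \<Rightarrow> bool" where
  "stationaryO lam q u \<pi> \<longleftrightarrow>
     (\<forall>f. bounded (range f) \<longrightarrow> measure_pmf.expectation \<pi> (genO lam q u f) = 0)"

section \<open>The LCQ system of size n (via the counts m_k = n u_k)\<close>

definition Sn :: "nat \<Rightarrow> (nat \<Rightarrow> nat) set" where
  "Sn n = {m. m 0 = n \<and> (\<forall>k. m (Suc k) \<le> m k)}"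

text \<open>Generator: m -> m + e_k at rate n lam (u_{k-1}-u_k) = lam (m_{k-1}-m_k),
  m -> m - e_k at rate n ((1-q)^{m_{k+1}} - (1-q)^{m_k}), k >= 1.\<close>
definition genN :: "real \<Rightarrow> real \<Rightarrow> nat \<Rightarrow> ((nat \<Rightarrow> nat) \<Rightarrow> real) \<Rightarrow> (nat \<Rightarrow> nat) \<Rightarrow> real" where
  "genN lam q n f m =
     (\<Sum>j. lam * (real (m j) - real (m (Suc j))) * (f (m(Suc j := Suc (m (Suc j)))) - f m)) +
     (\<Sum>j. real n * ((1 - q) ^ (m (Suc (Suc j))) - (1 - q) ^ (m (Suc j)))
            * (f (m(Suc j := m (Suc j) - 1)) - f m))"

definition uOf :: "nat \<Rightarrow> (nat \<Rightarrow> nat) \<Rightarrow> (nat \<Rightarrow> real)" where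
  "uOf n m = (\<lambda>k. real (m k) / real n)"

definition toO :: "(nat \<Rightarrow> nat) \<Rightarrow> (nat \<Rightarrow> enat)" where
  "toO m = (\<lambda>k. if k = 0 then \<infinity> else enat (m k))"

text \<open>X is (a cadlag version of) the Markov process with generator genN on Sn n, with arbitrary
  initial law, characterised by the martingale problem w.r.t. its natural filtration.\<close>
definition lcq_chain :: "real \<Rightarrow> real \<Rightarrow> nat \<Rightarrow> 'a measure \<Rightarrow> ('a \<Rightarrow> real \<Rightarrow> nat \<Rightarrow> nat) \<Rightarrow> bool" where
  "lcq_chain lam q n M X \<longleftrightarrow>
     prob_space M \<and>
     (\<forall>x t. 0 \<le> t \<longrightarrow> X x t \<in> Sn n) \<and>
     (\<forall>t. 0 \<le> t \<longrightarrow> (\<lambda>x. X x t) \<in> measurable M (count_space UNIV)) \<and>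
     (\<forall>x. (\<forall>t. 0 \<le> t \<longrightarrow> (\<exists>\<delta>>0. \<forall>s. t \<le> s \<and> s < t + \<delta> \<longrightarrow> X x s = X x t)) \<and>
          (\<forall>t. 0 < t \<longrightarrow> (\<exists>\<delta>>0. \<forall>s s'. t - \<delta> < s \<and> s < t \<and> t - \<delta> < s' \<and> s' < t
                                     \<longrightarrow> X x s = X x s'))) \<and>
     (\<forall>f. bounded (range f) \<longrightarrow>
        (\<forall>s t rs gs. 0 \<le> s \<longrightarrow> s \<le> t \<longrightarrow>
           (\<forall>i<length rs. 0 \<le> rs ! i \<and> rs ! i \<le> s) \<longrightarrow>
           (\<forall>i<length rs. bounded (range (gs i :: (nat \<Rightarrow> nat) \<Rightarrow> real))) \<longrightarrow>
           (\<integral>x. (f (X x t) - f (X x s) - (LINT r:{s..t}|lborel. genN lam q n f (X x r)))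
                  * (\<Prod>i<length rs. gs i (X x (rs ! i))) \<partial>M) = 0))"

definition SpaceL :: "(real \<times> (nat \<Rightarrow> enat)) measure" where
  "SpaceL = borel \<Otimes>\<^sub>M count_space UNIV"

text \<open>xi([0,t) x A) = int_0^t 1{m(s) in A} ds.\<close>
definition occ :: "(real \<Rightarrow> nat \<Rightarrow> nat) \<Rightarrow> (real \<times> (nat \<Rightarrow> enat)) measure" where
  "occ x = distr (restrict_space lborel {0..}) SpaceL (\<lambda>s. (s, toO (x s)))"

definition Lset :: "(real \<times> (nat \<Rightarrow> enat)) measure set" where
  "Lset = {\<mu>. sets \<mu> = sets SpaceL \<and> emeasure \<mu> (UNIV - {0..} \<times> OmegaS) = 0 \<and>
               (\<forall>t>0. emeasure \<mu> ({0..<t} \<times> OmegaS) = ennreal t)}"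

definition cont_on_strip :: "real \<Rightarrow> (real \<times> (nat \<Rightarrow> enat) \<Rightarrow> real) \<Rightarrow> bool" where
  "cont_on_strip t f \<longleftrightarrow>
     (\<forall>ss ws s w. (\<forall>j. ss j \<in> {0..<t} \<and> ws j \<in> OmegaS) \<longrightarrow> s \<in> {0..<t} \<longrightarrow> w \<in> OmegaS \<longrightarrow>
        ss \<longlonglongrightarrow> s \<longrightarrow> (\<lambda>j. rhoO (ws j) w) \<longlonglongrightarrow> 0 \<longrightarrow>
        (\<lambda>j. f (ss j, ws j)) \<longlonglongrightarrow> f (s, w))"

definition Lconv :: "(nat \<Rightarrow> (real \<times> (nat \<Rightarrow> enat)) measure) \<Rightarrow> (real \<times> (nat \<Rightarrow> enat)) measure \<Rightarrow> bool" where
  "Lconv \<mu>s \<mu> \<longleftrightarrow>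
     (\<forall>t>0. \<forall>f. f \<in> borel_measurable SpaceL \<longrightarrow> bounded (f ` ({0..<t} \<times> OmegaS)) \<longrightarrow>
        cont_on_strip t f \<longrightarrow>
        (\<lambda>j. LINT z:({0..<t} \<times> OmegaS)|\<mu>s j. f z) \<longlonglongrightarrow> (LINT z:({0..<t} \<times> OmegaS)|\<mu>. f z))"

definition Dsp :: "(real \<Rightarrow> nat \<Rightarrow> real) set" where
  "Dsp = {x. (\<forall>t. 0 \<le> t \<longrightarrow> x t \<in> Uset) \<and>
             (\<forall>t. 0 \<le> t \<longrightarrow> ((\<lambda>s. rhoU (x s) (x t)) \<longlongrightarrow> 0) (at_right t)) \<and>
             (\<forall>t. 0 < t \<longrightarrow> (\<exists>y\<in>Uset. ((\<lambda>s. rhoU (x s) y) \<longlongrightarrow> 0) (at_left t)))}"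

definition gammaJ :: "(real \<Rightarrow> real) \<Rightarrow> real" where
  "gammaJ l = Sup {\<bar>ln ((l s - l t) / (s - t))\<bar> | s t. 0 \<le> t \<and> t < s}"

text \<open>Time changes (Ethier-Kurtz): strictly increasing maps of [0,infinity) onto itself with gamma finite.\<close>
definition LambdaJ :: "(real \<Rightarrow> real) set" where
  "LambdaJ = {l. strict_mono_on {0..} l \<and> l ` {0..} = {0..} \<and>
                 bdd_above {\<bar>ln ((l s - l t) / (s - t))\<bar> | s t. 0 \<le> t \<and> t < s}}"

text \<open>J1 convergence, as characterised in Ethier-Kurtz, Prop. 3.5.3.\<close>
definition J1conv :: "(nat \<Rightarrow> real \<Rightarrow> nat \<Rightarrow> real) \<Rightarrow> (real \<Rightarrow> nat \<Rightarrow> real) \<Rightarrow> bool" where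
  "J1conv xs x \<longleftrightarrow>
     (\<exists>ls. (\<forall>m. ls m \<in> LambdaJ) \<and> (\<lambda>m. gammaJ (ls m)) \<longlonglongrightarrow> 0 \<and>
           (\<forall>T>0. (\<lambda>m. SUP t\<in>{0..T}. rhoU (xs m t) (x (ls m t))) \<longlonglongrightarrow> 0))"

type_synonym DL = "(real \<Rightarrow> nat \<Rightarrow> real) \<times> (real \<times> (nat \<Rightarrow> enat)) measure"

text \<open>Bounded continuous functionals on D x L (functionals only see paths on [0,infinity)).\<close>
definition Ftest :: "(DL \<Rightarrow> real) \<Rightarrow> bool" where
  "Ftest F \<longleftrightarrow>
     bounded (F ` (Dsp \<times> Lset)) \<and>
     (\<forall>x \<mu>. F (x, \<mu>) = F (\<lambda>t. x (max 0 t), \<mu>)) \<and>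
     (\<forall>xs x \<mu>s \<mu>. (\<forall>m. xs m \<in> Dsp \<and> \<mu>s m \<in> Lset) \<longrightarrow> x \<in> Dsp \<longrightarrow> \<mu> \<in> Lset \<longrightarrow>
        J1conv xs x \<longrightarrow> Lconv \<mu>s \<mu> \<longrightarrow> (\<lambda>m. F (xs m, \<mu>s m)) \<longlonglongrightarrow> F (x, \<mu>))"

definition conv_dist :: "(nat \<Rightarrow> 'a measure) \<Rightarrow> (nat \<Rightarrow> 'a \<Rightarrow> DL) \<Rightarrow> 'b measure \<Rightarrow> ('b \<Rightarrow> DL) \<Rightarrow> bool" where
  "conv_dist M Y P Z \<longleftrightarrow>
     (\<forall>F. Ftest F \<longrightarrow>
        (\<forall>j. (\<lambda>x. F (Y j x)) \<in> borel_measurable (M j)) \<and>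
        (\<lambda>x. F (Z x)) \<in> borel_measurable P \<and>
        (\<lambda>j. \<integral>x. F (Y j x) \<partial>M j) \<longlonglongrightarrow> (\<integral>x. F (Z x) \<partial>P))"

end

theory Submission
  imports Defs
begin

text \<open>
  In the system of size n the total jump rate is at most n(lam + 1), so the martingale of a function of
  the counts with bounded jumps has second moment of order n; divided by n it vanishes in the limit. For
  a coordinate this gives the integral equation of the fluid limit (smoothed in time, because evaluation
  at a fixed time is not continuous for the J1 topology). For a cylinder function of the counts, which
  move n times faster than their proportions, it says that the limiting occupation measure annihilates
  the generator with frozen rates. Finally, where a proportion stays positive the corresponding
  count tends to infinity.

  All three statements are zero sets of continuous functionals on D x L, so they pass to the limit.
  A nonincreasing sequence of extended naturals is eventually constant, hence the space of fast
  variables is countable, and the limiting occupation measure disintegrates through Radon-Nikodym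
  densities into a family of probability mass functions. For almost every time these are
  stationary. On the exceptional null set the point mass at the constant infinite sequence is chosen: it
  is absorbing, so it is stationary for every choice of frozen rates. Lebesgue's differentiation theorem
  turns the integral equation into the differential one.
\<close>

section \<open>Measurability and Fubini on the half-line\<close>

text \<open>The functionals that pass to the limit are built from one shape, the integral of
  \<open>\<psi> s * x s k * g w\<close> against the occupation measure, together with the initial
  value of a path. Two obstacles govern its continuity. The path factor may jump in time, so weak
  convergence of measures does not apply to the integrand as it stands; but all admissible measures
  have Lebesgue time marginal, so the path may be exchanged for a continuous function at an
  \<open>L^1\<close> cost that is uniform over the measures. The factor \<open>g\<close> must be
  continuous on the fast variables, where infinity is a limit of integers; hence the generator is
  first tested on cylinder functions truncated at a level \<open>N\<close>, and other bounded
  functions are reached after the limit by bounded convergence. Each limit identity is almost sure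
  for fixed parameters. Rational times, integer levels and an enumeration of the fast states keep
  the number of null events countable. Countability of \<open>OmegaS\<close> also makes each of its
  subsets Borel, so the discrete sigma-algebra in \<open>SpaceL\<close> loses nothing.\<close>

lemma right_continuous_measurable_pair:
  fixes Y :: "'a \<Rightarrow> real \<Rightarrow> real"
  assumes Y: "\<And>t. 0 \<le> t \<Longrightarrow> (\<lambda>x. Y x t) \<in> borel_measurable M"
    and rc: "\<And>x t. x \<in> space M \<Longrightarrow> 0 \<le> t \<Longrightarrow> (Y x \<longlongrightarrow> Y x t) (at_right t)"
  shows "(\<lambda>z. Y (fst z) (max 0 (snd z))) \<in> borel_measurable (M \<Otimes>\<^sub>M (lborel :: real measure))"
proof (rule borel_measurable_LIMSEQ_real)
  fix i :: nat
  \<comment> \<open>Time is rounded to the next point of the grid of mesh \<open>1 / Suc i\<close>.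
    Countably many grid values keep the composition measurable, and the \<open>+ 1\<close> puts the
    grid point strictly to the right, so that right limits suffice.\<close>
  have "(\<lambda>z. Y (fst z) (max 0 (real_of_int (j + 1) / real (Suc i)))) \<in> borel_measurable (M \<Otimes>\<^sub>M (lborel :: real measure))" for j :: int
    by (rule measurable_compose[OF measurable_fst Y]) simp
  then have "(\<lambda>z. (\<lambda>j z. Y (fst z) (max 0 (real_of_int (j + 1) / real (Suc i)))) \<lfloor>real (Suc i) * max 0 (snd z)\<rfloor> z)
      \<in> borel_measurable (M \<Otimes>\<^sub>M (lborel :: real measure))"
    by (rule measurable_compose_countable) measurable
  then show "(\<lambda>z. Y (fst z) (max 0 (real_of_int (\<lfloor>real (Suc i) * max 0 (snd z)\<rfloor> + 1) / real (Suc i))))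
      \<in> borel_measurable (M \<Otimes>\<^sub>M (lborel :: real measure))" by simp
next
  fix z assume z: "z \<in> space (M \<Otimes>\<^sub>M (lborel :: real measure))"
  define s where "s = max 0 (snd z)"
  define \<tau> where "\<tau> i = real_of_int (\<lfloor>real (Suc i) * s\<rfloor> + 1) / real (Suc i)" for i
  have s0: "0 \<le> s" by (simp add: s_def)
  have gt: "s < \<tau> i" for i
  proof -
    have "real (Suc i) * s < real_of_int (\<lfloor>real (Suc i) * s\<rfloor> + 1)" by linarith
    then show ?thesis unfolding \<tau>_def by (simp add: field_simps del: of_nat_Suc)
  qed
  have le: "\<tau> i \<le> s + 1 / real (Suc i)" for i
  proof -
    have "real_of_int (\<lfloor>real (Suc i) * s\<rfloor> + 1) \<le> real (Suc i) * s + 1" by linarith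
    then show ?thesis unfolding \<tau>_def by (simp add: field_simps del: of_nat_Suc)
  qed
  have "\<tau> \<longlonglongrightarrow> s"
  proof (rule real_tendsto_sandwich)
    show "\<forall>\<^sub>F i in sequentially. s \<le> \<tau> i" using gt by (simp add: less_imp_le)
    show "\<forall>\<^sub>F i in sequentially. \<tau> i \<le> s + 1 / real (Suc i)" using le by simp
    show "(\<lambda>i. s + 1 / real (Suc i)) \<longlonglongrightarrow> s"
      using tendsto_add[OF tendsto_const[of s] LIMSEQ_Suc[OF lim_1_over_n]] by simp
  qed simp
  then have fl: "filterlim \<tau> (at_right s) sequentially"
    using gt by (auto simp: filterlim_at less_imp_neq[symmetric] intro!: always_eventually less_imp_neq[THEN not_sym])
  have "fst z \<in> space M" using z by (auto simp: space_pair_measure)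
  from filterlim_compose[OF rc[OF this s0] fl]
  have "(\<lambda>i. Y (fst z) (\<tau> i)) \<longlonglongrightarrow> Y (fst z) s" .
  moreover have "max 0 (\<tau> i) = \<tau> i" for i using gt[of i] s0 by simp
  ultimately show "(\<lambda>i. Y (fst z) (max 0 (real_of_int (\<lfloor>real (Suc i) * max 0 (snd z)\<rfloor> + 1) / real (Suc i))))
       \<longlonglongrightarrow> Y (fst z) (max 0 (snd z))"
    unfolding s_def \<tau>_def by simp
qed

lemma right_continuous_measurable:
  fixes y :: "real \<Rightarrow> real"
  assumes "\<And>t. 0 \<le> t \<Longrightarrow> (y \<longlongrightarrow> y t) (at_right t)"
  shows "(\<lambda>s. y (max 0 s)) \<in> borel_measurable borel"
proof -
  \<comment> \<open>The joint statement over a one-point space; freezing the path at its value in 0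
    covers negative times.\<close>
  have m: "(\<lambda>z. y (max 0 (snd z))) \<in> borel_measurable (count_space (UNIV :: unit set) \<Otimes>\<^sub>M lborel)"
    by (rule right_continuous_measurable_pair[of "\<lambda>_. y"]) (use assms in auto)
  have "(\<lambda>s. ((), s)) \<in> lborel \<rightarrow>\<^sub>M count_space (UNIV :: unit set) \<Otimes>\<^sub>M lborel" by measurable
  from measurable_compose[OF this m] show ?thesis by simp
qed

section \<open>Integrals of bounded functions over compact intervals\<close>

lemma bounded_set_integrable:
  fixes f :: "real \<Rightarrow> real"
  assumes [measurable]: "f \<in> borel_measurable borel" and "\<And>s. s \<in> {a..b} \<Longrightarrow> \<bar>f s\<bar> \<le> B"
  shows "set_integrable lborel {a..b} f"
  unfolding set_integrable_def
  by (rule integrableI_bounded_set_indicator[where B=B]) (use assms(2) in \<open>auto simp: emeasure_lborel_Icc_eq\<close>)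

lemma set_integral_Icc_split:
  fixes f :: "real \<Rightarrow> real"
  assumes f: "set_integrable lborel {a..c} f" and "a \<le> b" "b \<le> c"
  shows "(LINT s:{a..c}|lborel. f s) = (LINT s:{a..b}|lborel. f s) + (LINT s:{b..c}|lborel. f s)"
proof -
  have eq: "{a..c} = {a..b} \<union> {b..c}" using assms by auto
  show ?thesis unfolding eq
  proof (rule set_integral_Un_AE)
    show "AE x in lborel. \<not> (x \<in> {a..b} \<and> x \<in> {b..c})"
      using AE_lborel_singleton[of b] by eventually_elim auto
  qed (use f assms in \<open>auto intro: set_integrable_subset\<close>)
qed

lemma set_integral_bound:
  fixes f :: "real \<Rightarrow> real"
  assumes [measurable]: "f \<in> borel_measurable borel" and B: "\<And>s. s \<in> {a..b} \<Longrightarrow> \<bar>f s\<bar> \<le> B" and "a \<le> b"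
  shows "\<bar>LINT s:{a..b}|lborel. f s\<bar> \<le> B * (b - a)"
proof -
  have "\<bar>LINT s:{a..b}|lborel. f s\<bar> \<le> (LINT s:{a..b}|lborel. \<bar>f s\<bar>)"
    using set_integral_norm_bound[OF bounded_set_integrable[OF assms(1) B]] by simp
  also have "\<dots> \<le> (LINT s:{a..b}|lborel. B)"
  proof (rule set_integral_mono)
    show "set_integrable lborel {a..b} (\<lambda>s. \<bar>f s\<bar>)"
      by (rule set_integrable_abs[OF bounded_set_integrable[OF assms(1) B]])
    show "set_integrable lborel {a..b} (\<lambda>s. B)"
      by (rule bounded_set_integrable[where B="\<bar>B\<bar>"]) auto
  qed (use B in auto)
  also have "\<dots> = B * (b - a)" using \<open>a \<le> b\<close> by (subst set_integral_const) auto
  finally show ?thesis .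
qed

lemma integral_from_measurable:
  fixes a :: "real \<Rightarrow> real"
  assumes [measurable]: "a \<in> borel_measurable borel"
  shows "(\<lambda>r. LINT s:{r..t}|lborel. a s) \<in> borel_measurable borel"
proof -
  have "(\<lambda>(r, s). if r \<le> s \<and> s \<le> t then a s else 0) \<in> borel_measurable (lborel \<Otimes>\<^sub>M lborel)" by measurable
  then have "(\<lambda>(r, s). indicator {r..t} s *\<^sub>R a s) \<in> borel_measurable (lborel \<Otimes>\<^sub>M lborel)"
    by (rule measurable_cong[THEN iffD1, rotated]) (auto simp: indicator_def)
  from lborel.borel_measurable_lebesgue_integral[OF this]
  show ?thesis by (simp add: set_lebesgue_integral_def)
qed

lemma integral_upto_measurable:
  fixes a :: "real \<Rightarrow> real"
  assumes [measurable]: "a \<in> borel_measurable borel"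
  shows "(\<lambda>s. LINT r:{0..s}|lborel. a r) \<in> borel_measurable borel"
proof -
  have "(\<lambda>(s, r). if 0 \<le> r \<and> r \<le> s then a r else 0) \<in> borel_measurable (lborel \<Otimes>\<^sub>M lborel)" by measurable
  then have "(\<lambda>(s, r). indicator {0..s} r *\<^sub>R a r) \<in> borel_measurable (lborel \<Otimes>\<^sub>M lborel)"
    by (rule measurable_cong[THEN iffD1, rotated]) (auto simp: indicator_def)
  from lborel.borel_measurable_lebesgue_integral[OF this]
  show ?thesis by (simp add: set_lebesgue_integral_def)
qed

text \<open>A measurable function is an almost everywhere limit of continuous ones; truncating these
  at the bound of \<open>h\<close> makes dominated convergence applicable. It serves twice: in the
  differentiation theorem, and to replace a discontinuous path by a continuous weight under weak
  convergence of measures.\<close>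

lemma continuous_L1_approx:
  fixes h :: "real \<Rightarrow> real"
  assumes [measurable]: "h \<in> borel_measurable borel" and B: "\<And>s. \<bar>h s\<bar> \<le> B"
  obtains \<phi> :: "nat \<Rightarrow> real \<Rightarrow> real" where "\<And>n. continuous_on UNIV (\<phi> n)" "\<And>n s. \<bar>\<phi> n s\<bar> \<le> B"
    "(\<lambda>n. LINT s:{a..b}|lborel. \<bar>h s - \<phi> n s\<bar>) \<longlonglongrightarrow> 0"
proof -
  have "h \<in> borel_measurable lebesgue" using assms(1) by (simp add: measurable_completion)
  then have "h measurable_on UNIV"
    by (intro lebesgue_measurable_imp_measurable_on_real) auto
  then obtain N g where N: "negligible N" and g: "\<And>n. continuous_on UNIV (g n)"
    and lim: "\<And>x. x \<notin> N \<Longrightarrow> (\<lambda>n. g n x) \<longlonglongrightarrow> h x"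
    unfolding measurable_on_def by auto
  define \<phi> where "\<phi> n s = max (- B) (min B (g n s))" for n :: nat and s :: real
  have B0: "0 \<le> B" using B[of 0] by linarith
  have c: "continuous_on UNIV (\<phi> n)" for n unfolding \<phi>_def by (intro continuous_intros g)
  have b: "\<bar>\<phi> n s\<bar> \<le> B" for n s unfolding \<phi>_def using B0 by auto
  have [measurable]: "\<phi> n \<in> borel_measurable borel" for n
    by (rule borel_measurable_continuous_onI[OF c])
  have "AE s in lebesgue. s \<notin> N"
    using N by (intro AE_not_in) (simp add: negligible_iff_null_sets)
  then have "AE s in lborel. s \<notin> N" by (simp add: AE_completion_iff)
  then have ae: "AE s in lborel. (\<lambda>n. indicator {a..b} s *\<^sub>R \<bar>h s - \<phi> n s\<bar>) \<longlonglongrightarrow> 0"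
  proof eventually_elim
    case (elim s)
    have "(\<lambda>n. max (- B) (min B (g n s))) \<longlonglongrightarrow> max (- B) (min B (h s))"
      by (intro tendsto_intros lim elim)
    moreover have "max (- B) (min B (h s)) = h s" using B[of s] by auto
    ultimately have "(\<lambda>n. \<phi> n s) \<longlonglongrightarrow> h s" unfolding \<phi>_def by simp
    then have "(\<lambda>n. indicator {a..b} s *\<^sub>R \<bar>h s - \<phi> n s\<bar>) \<longlonglongrightarrow> indicator {a..b} s *\<^sub>R \<bar>h s - h s\<bar>"
      by (intro tendsto_intros)
    then show ?case by simp
  qed
  have "(\<lambda>n. LINT s|lborel. indicator {a..b} s *\<^sub>R \<bar>h s - \<phi> n s\<bar>) \<longlonglongrightarrow> (LINT s|(lborel :: real measure). 0)"
  proof (rule integral_dominated_convergence[where w="\<lambda>s. indicator {a..b} s *\<^sub>R (2 * B)"])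
    show "integrable lborel (\<lambda>s. indicator {a..b} s *\<^sub>R (2 * B))"
      using bounded_set_integrable[of "\<lambda>_. 2 * B" a b "\<bar>2 * B\<bar>"] by (simp add: set_integrable_def)
    show "AE s in lborel. norm (indicator {a..b} s *\<^sub>R \<bar>h s - \<phi> n s\<bar>) \<le> indicator {a..b} s *\<^sub>R (2 * B)" for n
    proof (rule AE_I2)
      fix s
      have "\<bar>h s - \<phi> n s\<bar> \<le> 2 * B" using B[of s] b[of n s] by linarith
      then show "norm (indicator {a..b} s *\<^sub>R \<bar>h s - \<phi> n s\<bar>) \<le> indicator {a..b} s *\<^sub>R (2 * B)"
        by (auto simp: indicator_def)
    qed
  qed (use ae in auto)
  then have "(\<lambda>n. LINT s:{a..b}|lborel. \<bar>h s - \<phi> n s\<bar>) \<longlonglongrightarrow> 0"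
    by (simp add: set_lebesgue_integral_def)
  then show thesis using that c b by blast
qed

text \<open>Both sides integrate \<open>f r * g s\<close> over the triangle
  \<open>0 \<le> r \<le> s \<le> t\<close>. With a constant factor it trades a weight
  \<open>t - s\<close> for an iterated integral; with \<open>f = g\<close> it leads to the square of
  an integral.\<close>

lemma bounded_triangle_Fubini:
  fixes f g :: "real \<Rightarrow> real"
  assumes [measurable]: "f \<in> borel_measurable borel" "g \<in> borel_measurable borel"
    and f: "\<And>s. s \<in> {0..t} \<Longrightarrow> \<bar>f s\<bar> \<le> B" and g: "\<And>s. s \<in> {0..t} \<Longrightarrow> \<bar>g s\<bar> \<le> C"
  shows "(LINT r:{0..t}|lborel. f r * (LINT s:{r..t}|lborel. g s)) =
         (LINT s:{0..t}|lborel. g s * (LINT r:{0..s}|lborel. f r))"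
proof -
  define h where "h r s = indicator {0..t} r * indicator {0..t} s * (if r \<le> s then f r * g s else 0)" for r s :: real
  have [measurable]: "(\<lambda>(r, s). h r s) \<in> borel_measurable (lborel \<Otimes>\<^sub>M lborel)"
    unfolding h_def by measurable
  have "integrable (lborel \<Otimes>\<^sub>M lborel) (\<lambda>z. indicator ({0..t} \<times> {0..t}) z *\<^sub>R (\<lambda>(r, s). h r s) z)"
  proof (rule integrableI_bounded_set_indicator[where B="\<bar>B\<bar> * \<bar>C\<bar>"])
    show "emeasure (lborel \<Otimes>\<^sub>M lborel) ({0..t} \<times> {0..t}) < \<infinity>"
      by (subst lborel.emeasure_pair_measure_Times) (auto simp: emeasure_lborel_Icc_eq ennreal_mult_less_top)
    have "\<bar>f r * g s\<bar> \<le> \<bar>B\<bar> * \<bar>C\<bar>" if "r \<in> {0..t}" "s \<in> {0..t}" for r s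
      using f[OF that(1)] g[OF that(2)] unfolding abs_mult by (intro mult_mono) auto
    then show "AE z in lborel \<Otimes>\<^sub>M lborel. z \<in> {0..t} \<times> {0..t} \<longrightarrow> norm ((\<lambda>(r, s). h r s) z) \<le> \<bar>B\<bar> * \<bar>C\<bar>"
      by (intro AE_I2) (auto simp: h_def)
  qed auto
  moreover have "(\<lambda>z. indicator ({0..t} \<times> {0..t}) z *\<^sub>R (\<lambda>(r, s). h r s) z) = (\<lambda>(r, s). h r s)"
    by (auto simp: h_def fun_eq_iff indicator_def)
  ultimately have "integrable (lborel \<Otimes>\<^sub>M lborel) (\<lambda>(r, s). h r s)" by simp
  from lborel_pair.Fubini_integral[OF this]
  have eq: "(LINT s|lborel. LINT r|lborel. h r s) = (LINT r|lborel. LINT s|lborel. h r s)" by simp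
  have l: "(LINT s|lborel. h r s) = indicator {0..t} r *\<^sub>R (f r * (LINT s:{r..t}|lborel. g s))" for r
  proof -
    have "(LINT s|lborel. h r s) = (LINT s|lborel. (indicator {0..t} r * f r) * (indicator {r..t} s *\<^sub>R g s))"
      by (rule Bochner_Integration.integral_cong) (auto simp: h_def indicator_def)
    then show ?thesis by (simp add: set_lebesgue_integral_def)
  qed
  have r: "(LINT r|lborel. h r s) = indicator {0..t} s *\<^sub>R (g s * (LINT r:{0..s}|lborel. f r))" for s
  proof -
    have "(LINT r|lborel. h r s) = (LINT r|lborel. (indicator {0..t} s * g s) * (indicator {0..s} r *\<^sub>R f r))"
      by (rule Bochner_Integration.integral_cong) (auto simp: h_def indicator_def)
    then show ?thesis by (simp add: set_lebesgue_integral_def)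
  qed
  show ?thesis using eq unfolding l r by (simp add: set_lebesgue_integral_def)
qed

text \<open>A rational level between the left limit and the value, and a rational left end of an interval on which
  the function stays on the other side of that level, determine the discontinuity.\<close>

lemma countable_left_discontinuities:
  fixes y :: "real \<Rightarrow> real"
  assumes "\<And>t. 0 < t \<Longrightarrow> \<exists>l. (y \<longlongrightarrow> l) (at_left t)"
  shows "countable {t. 0 < t \<and> \<not> (y \<longlongrightarrow> y t) (at_left t)}" (is "countable ?D")
proof -
  have "\<exists>p a :: rat. real_of_rat a < t \<and>
      ((\<forall>s. real_of_rat a < s \<and> s < t \<longrightarrow> y s < real_of_rat p) \<and> real_of_rat p < y t \<or>
       (\<forall>s. real_of_rat a < s \<and> s < t \<longrightarrow> real_of_rat p < y s) \<and> y t < real_of_rat p)" if t: "t \<in> ?D" for t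
  proof -
    obtain l where l: "(y \<longlongrightarrow> l) (at_left t)" using assms t by blast
    then have "l \<noteq> y t" using t by auto
    then consider "l < y t" | "y t < l" by linarith
    then show ?thesis
    proof cases
      case 1
      then obtain p where p: "l < real_of_rat p" "real_of_rat p < y t" using of_rat_dense by blast
      from order_tendstoD(2)[OF l p(1)] obtain b where b: "b < t" "\<And>s. b < s \<Longrightarrow> s < t \<Longrightarrow> y s < real_of_rat p"
        unfolding eventually_at_left_field by blast
      obtain a where "b < real_of_rat a" "real_of_rat a < t" using of_rat_dense b(1) by blast
      then show ?thesis using p b by (intro exI[of _ p] exI[of _ a]) auto
    next
      case 2
      then obtain p where p: "y t < real_of_rat p" "real_of_rat p < l" using of_rat_dense by blast
      from order_tendstoD(1)[OF l p(2)] obtain b where b: "b < t" "\<And>s. b < s \<Longrightarrow> s < t \<Longrightarrow> real_of_rat p < y s"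
        unfolding eventually_at_left_field by blast
      obtain a where "b < real_of_rat a" "real_of_rat a < t" using of_rat_dense b(1) by blast
      then show ?thesis using p b by (intro exI[of _ p] exI[of _ a]) auto
    qed
  qed
  then have "\<forall>t\<in>?D. \<exists>pa. real_of_rat (snd pa) < t \<and>
      ((\<forall>s. real_of_rat (snd pa) < s \<and> s < t \<longrightarrow> y s < real_of_rat (fst pa)) \<and> real_of_rat (fst pa) < y t \<or>
       (\<forall>s. real_of_rat (snd pa) < s \<and> s < t \<longrightarrow> real_of_rat (fst pa) < y s) \<and> y t < real_of_rat (fst pa))"
    (is "\<forall>t\<in>?D. \<exists>pa. ?Q t pa") by simp
  from bchoice[OF this] obtain f where f: "\<And>t. t \<in> ?D \<Longrightarrow> ?Q t (f t)" by blast
  \<comment> \<open>For two discontinuities \<open>t < t'\<close> with the same rational pair,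
    \<open>t\<close> lies in the interval before \<open>t'\<close>, so \<open>y t\<close> and
    \<open>y t'\<close> are on opposite sides of the level; the flag recording the side tells them
    apart.\<close>
  define \<iota> where "\<iota> t = (f t, y t < real_of_rat (fst (f t)))" for t
  have key: "\<not> t < t'" if "t \<in> ?D" "t' \<in> ?D" "\<iota> t = \<iota> t'" for t t'
  proof
    assume "t < t'"
    have eq: "f t' = f t" "y t' < real_of_rat (fst (f t)) \<longleftrightarrow> y t < real_of_rat (fst (f t))"
      using that(3) by (auto simp: \<iota>_def)
    have "real_of_rat (snd (f t)) < t" using f[OF that(1)] by blast
    then show False using f[OF that(2)] f[OF that(1)] \<open>t < t'\<close> unfolding eq(1) using eq(2)
      by (metis not_less_iff_gr_or_eq)
  qed
  have "inj_on \<iota> ?D"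
  proof (rule inj_onI)
    fix t t' assume *: "t \<in> ?D" "t' \<in> ?D" "\<iota> t = \<iota> t'"
    from key[OF *] key[OF *(2) *(1) *(3)[symmetric]] show "t = t'" by linarith
  qed
  then show ?thesis by (rule countable_image_inj_on[rotated]) simp
qed

section \<open>Lebesgue differentiation\<close>

text \<open>The Hardy-Littlewood argument: on \<open>{0..T}\<close>, \<open>h\<close> differs from a
  continuous \<open>\<phi>\<close> by an error \<open>g\<close> of small \<open>L^1\<close> norm.
  Where neither \<open>g\<close> nor its averages over small balls are large, averages of
  \<open>h\<close> are close to \<open>h t\<close>; the remaining points are few, by Vitali covering
  for the averages and by Markov for \<open>g\<close> itself. Intervals with \<open>t\<close> as an
  end point are those of the difference quotients of the integral.\<close>

lemma lebesgue_differentiation_aux: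
  fixes h :: "real \<Rightarrow> real"
  assumes h[measurable]: "h \<in> borel_measurable borel" and B: "\<And>s. \<bar>h s\<bar> \<le> B" and "0 < \<epsilon>"
  shows "negligible {t. 0 < t \<and> t < T \<and> \<not> (\<exists>\<delta>>0. \<forall>a b. a \<le> t \<and> t \<le> b \<and> t - \<delta> < a \<and> b < t + \<delta> \<and> (a = t \<or> b = t) \<longrightarrow>
      \<bar>(LINT s:{a..b}|lborel. h s) - h t * (b - a)\<bar> \<le> \<epsilon> * (b - a))}" (is "negligible ?Bad")
  unfolding negligible_outer_le
proof (intro allI impI)
  fix e :: real assume "0 < e"
  \<comment> \<open>Three errors of size \<open>c\<close> arise below: the average of
    \<open>g\<close>, the distance of \<open>h\<close> from \<open>\<phi>\<close> at
    \<open>t\<close>, and the oscillation of \<open>\<phi>\<close> near \<open>t\<close>.\<close>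
  define c where "c = \<epsilon> / 4"
  have c: "0 < c" using \<open>0 < \<epsilon>\<close> by (simp add: c_def)
  obtain \<phi>' :: "nat \<Rightarrow> real \<Rightarrow> real" where \<phi>': "\<And>n. continuous_on UNIV (\<phi>' n)" "\<And>n s. \<bar>\<phi>' n s\<bar> \<le> B"
    "(\<lambda>n. LINT s:{0..T}|lborel. \<bar>h s - \<phi>' n s\<bar>) \<longlonglongrightarrow> 0"
    by (rule continuous_L1_approx[OF h B, where a=0 and b=T]) (rule that)
  have "\<forall>\<^sub>F n in sequentially. (LINT s:{0..T}|lborel. \<bar>h s - \<phi>' n s\<bar>) < e * c / 11"
    by (rule order_tendstoD(2)[OF \<phi>'(3)]) (use \<open>0 < e\<close> c in simp)
  then obtain n0 where n0: "(LINT s:{0..T}|lborel. \<bar>h s - \<phi>' n0 s\<bar>) < e * c / 11"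
    by (auto simp: eventually_sequentially)
  define \<phi> where "\<phi> = \<phi>' n0"
  have \<phi>c: "continuous_on UNIV \<phi>" and \<phi>B: "\<And>s. \<bar>\<phi> s\<bar> \<le> B" unfolding \<phi>_def using \<phi>' by auto
  have [measurable]: "\<phi> \<in> borel_measurable borel" by (rule borel_measurable_continuous_onI[OF \<phi>c])
  define g where "g s = indicator {0..T} s * \<bar>h s - \<phi> s\<bar>" for s
  have [measurable]: "g \<in> borel_measurable borel" unfolding g_def by measurable
  have g0: "0 \<le> g s" for s by (simp add: g_def)
  have hp: "\<bar>h s - \<phi> s\<bar> \<le> 2 * B" for s using B[of s] \<phi>B[of s] by linarith
  have gint: "integrable lborel g"
    using bounded_set_integrable[of "\<lambda>s. \<bar>h s - \<phi> s\<bar>" 0 T "2 * B"] hp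
    unfolding set_integrable_def g_def by simp
  have g\<eta>: "(LINT s|lborel. g s) < e * c / 11"
    using n0 unfolding g_def set_lebesgue_integral_def \<phi>_def by simp
  \<comment> \<open>Points where some ball of radius at most 1 carries more than \<open>c\<close>
    times its radius of \<open>g\<close>, a level set of the maximal function; the covering lemma
    needs the radii bounded.\<close>
  define S where "S = {t. \<exists>r. 0 < r \<and> r \<le> 1 \<and> c * r < (LINT s:cball t r|lborel. g s)}"
  obtain \<rho> where \<rho>: "\<And>t. t \<in> S \<Longrightarrow> 0 < \<rho> t \<and> \<rho> t \<le> 1 \<and> c * \<rho> t < (LINT s:cball t (\<rho> t)|lborel. g s)"
    using bchoice[of S "\<lambda>t r. 0 < r \<and> r \<le> 1 \<and> c * r < (LINT s:cball t r|lborel. g s)"]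
    unfolding S_def by blast
  have cov: "S \<subseteq> (\<Union>i\<in>S. cball i (\<rho> i))" using \<rho> by force
  obtain C where C: "countable C" "C \<subseteq> S"
     "pairwise (\<lambda>i j. disjnt (cball i (\<rho> i)) (cball j (\<rho> j))) C"
     "S \<subseteq> (\<Union>i\<in>C. cball i (5 * \<rho> i))"
    by (rule Vitali_covering_lemma_cballs[OF cov, of 1]) (use \<rho> in auto)
  \<comment> \<open>A ball of radius \<open>5 * \<rho> i\<close> has length
    \<open>10 * \<rho> i\<close>, which leads to ten elevenths of \<open>e\<close>; the set where
    \<open>g\<close> itself is large takes the last one. Hence the 11 in the choice of
    \<open>n0\<close>.\<close>
  have fin: "measure lebesgue (\<Union>i\<in>I. cball i (5 * \<rho> i)) \<le> 10 * (e / 11)" if I: "I \<subseteq> C" "finite I" for I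
  proof -
    have "measure lebesgue (\<Union>i\<in>I. cball i (5 * \<rho> i)) \<le> (\<Sum>i\<in>I. measure lebesgue (cball i (5 * \<rho> i)))"
      by (rule measure_UNION_le[OF I(2)]) auto
    also have "\<dots> = (\<Sum>i\<in>I. 10 * \<rho> i)"
    proof (rule sum.cong)
      fix i assume "i \<in> I"
      then have "0 < \<rho> i" using \<rho> I C by blast
      then show "measure lebesgue (cball i (5 * \<rho> i)) = 10 * \<rho> i"
        by (simp add: cball_eq_atLeastAtMost)
    qed simp
    also have "\<dots> \<le> (\<Sum>i\<in>I. 10 / c * (LINT s:cball i (\<rho> i)|lborel. g s))"
    proof (rule sum_mono)
      fix i assume "i \<in> I"
      then have "c * \<rho> i \<le> (LINT s:cball i (\<rho> i)|lborel. g s)" using \<rho> I C by (meson less_imp_le subsetD)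
      then show "10 * \<rho> i \<le> 10 / c * (LINT s:cball i (\<rho> i)|lborel. g s)"
        using c by (simp add: field_simps)
    qed
    also have "\<dots> = 10 / c * (LINT s:(\<Union>i\<in>I. cball i (\<rho> i))|lborel. g s)"
    proof -
      have "(LINT s:(\<Union>i\<in>I. cball i (\<rho> i))|lborel. g s) = (\<Sum>i\<in>I. LINT s:cball i (\<rho> i)|lborel. g s)"
      proof (rule set_integral_finite_Union[OF I(2)])
        show "disjoint_family_on (\<lambda>i. cball i (\<rho> i)) I"
          using C(3) I(1) unfolding disjoint_family_on_def pairwise_def disjnt_def by blast
        show "set_integrable lborel (cball i (\<rho> i)) g" for i
          unfolding set_integrable_def by (rule integrable_mult_indicator[OF _ gint]) simp
      qed simp
      then show ?thesis by (simp add: sum_distrib_left)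
    qed
    also have "\<dots> \<le> 10 / c * (LINT s|lborel. g s)"
    proof (rule mult_left_mono)
      show "(LINT s:(\<Union>i\<in>I. cball i (\<rho> i))|lborel. g s) \<le> (LINT s|lborel. g s)"
        unfolding set_lebesgue_integral_def
        by (rule integral_mono[OF integrable_mult_indicator[OF _ gint] gint])
           (use I g0 in \<open>auto simp: indicator_def intro!: sets.finite_UN\<close>)
    qed (use c in simp)
    also have "\<dots> \<le> 10 / c * (e * c / 11)" using g\<eta> c by (intro mult_left_mono) auto
    also have "\<dots> = 10 * (e / 11)" using c by simp
    finally show ?thesis .
  qed
  define T1 where "T1 = (\<Union>i\<in>C. cball i (5 * \<rho> i))"
  define T2 where "T2 = {s. c \<le> g s}"
  have T1: "T1 \<in> lmeasurable" "measure lebesgue T1 \<le> 10 * (e / 11)"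
    unfolding T1_def using fmeasurable_UN_bound[OF C(1) _ fin] measure_UN_bound[OF C(1) _ fin] by auto
  have [measurable]: "T2 \<in> sets borel" unfolding T2_def by measurable
  have em: "emeasure lborel T2 \<le> ennreal (e / 11)"
  proof -
    have "emeasure lborel T2 = (\<integral>\<^sup>+s. indicator T2 s \<partial>lborel)" by simp
    also have "\<dots> \<le> (\<integral>\<^sup>+s. ennreal (g s / c) \<partial>lborel)"
      using c g0 by (intro nn_integral_mono) (auto simp: T2_def indicator_def)
    also have "\<dots> = ennreal (LINT s|lborel. g s / c)"
      by (rule nn_integral_eq_integral) (use gint g0 c in auto)
    also have "\<dots> \<le> ennreal (e / 11)"
      using g\<eta> c by (intro ennreal_leI) (simp add: field_simps)
    finally show ?thesis .
  qed
  then have T2: "T2 \<in> lmeasurable" "measure lebesgue T2 \<le> e / 11"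
  proof -
    have "emeasure lebesgue T2 \<le> ennreal (e / 11)" using em by (simp add: emeasure_completion)
    then show "T2 \<in> lmeasurable"
      by (auto simp: fmeasurable_def intro: le_less_trans sets_completionI_sets)
    show "measure lebesgue T2 \<le> e / 11"
      unfolding measure_def
      by (rule enn2real_leI) (use \<open>emeasure lebesgue T2 \<le> ennreal (e / 11)\<close> \<open>0 < e\<close> in auto)
  qed
  have "?Bad \<subseteq> T1 \<union> T2"
  proof (rule ccontr)
    assume "\<not> ?thesis"
    then obtain t where t: "t \<in> ?Bad" "t \<notin> T1" "t \<notin> T2" by blast
    have t0: "0 < t" "t < T" using t by auto
    have tS: "t \<notin> S" using t(2) C(4) unfolding T1_def by blast
    have gt: "\<bar>h t - \<phi> t\<bar> < c" using t(3) t0 unfolding T2_def g_def by (auto simp: indicator_def)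
    obtain \<delta>1 where \<delta>1: "0 < \<delta>1" "\<And>s. \<bar>s - t\<bar> < \<delta>1 \<Longrightarrow> \<bar>\<phi> s - \<phi> t\<bar> < c"
      using \<phi>c c unfolding continuous_on_iff dist_real_def by blast
    \<comment> \<open>Besides continuity of \<open>\<phi>\<close>, this keeps the interval inside
      \<open>{0..T}\<close>, where \<open>g\<close> is not cut off, and its length at most 1, as in
      the definition of \<open>S\<close>.\<close>
    define \<delta> where "\<delta> = min (min \<delta>1 1) (min t (T - t))"
    have \<delta>: "0 < \<delta>" "\<delta> \<le> \<delta>1" "\<delta> \<le> 1" "\<delta> \<le> t" "\<delta> \<le> T - t" unfolding \<delta>_def using \<delta>1 t0 by auto
    have "\<bar>(LINT s:{a..b}|lborel. h s) - h t * (b - a)\<bar> \<le> \<epsilon> * (b - a)"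
      if ab: "a \<le> t" "t \<le> b" "t - \<delta> < a" "b < t + \<delta>" "a = t \<or> b = t" for a b
    proof (cases "a = b")
      case True
      have "(LINT s:{a..b}|lborel. h s) = 0" using True
        by (simp add: set_lebesgue_integral_def) (rule integral_eq_zero_AE, rule AE_mp[OF AE_lborel_singleton[of b]], auto)
      then show ?thesis using True by simp
    next
      case False
      define r where "r = b - a"
      have r: "0 < r" "r < \<delta>" using False ab by (auto simp: r_def)
      \<comment> \<open>The radius is the whole length of the interval, so the ball contains it on
        whichever side of \<open>t\<close> it lies.\<close>
      have sub: "{a..b} \<subseteq> cball t r" unfolding cball_eq_atLeastAtMost r_def using ab by auto
      have i1: "set_integrable lborel {a..b} (\<lambda>s. \<bar>h s - \<phi> s\<bar>)"
        by (rule bounded_set_integrable[where B="2 * B"]) (use hp in auto)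
      have "(LINT s:{a..b}|lborel. h s) - h t * (b - a) = (LINT s:{a..b}|lborel. h s - h t)"
      proof -
        have "(LINT s:{a..b}|lborel. h s - h t) = (LINT s:{a..b}|lborel. h s) - (LINT s:{a..b}|lborel. h t)"
          by (rule set_integral_diff(2)) (auto intro!: bounded_set_integrable[where B=B] B)
        moreover have "(LINT s:{a..b}|lborel. h t) = h t * (b - a)"
          using ab by (subst set_integral_const) auto
        ultimately show ?thesis by simp
      qed
      also have "\<bar>\<dots>\<bar> \<le> (LINT s:{a..b}|lborel. \<bar>h s - h t\<bar>)"
      proof -
        have "\<bar>h s - h t\<bar> \<le> 2 * B" for s using B[of s] B[of t] by linarith
        then have "set_integrable lborel {a..b} (\<lambda>s. h s - h t)" by (intro bounded_set_integrable) auto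
        then show ?thesis using set_integral_norm_bound by fastforce
      qed
      also have "\<dots> \<le> (LINT s:{a..b}|lborel. \<bar>h s - \<phi> s\<bar> + 2 * c)"
      proof (rule set_integral_mono)
        show "set_integrable lborel {a..b} (\<lambda>s. \<bar>h s - h t\<bar>)"
        proof (rule bounded_set_integrable[where B="2 * B"])
          show "\<bar>\<bar>h s - h t\<bar>\<bar> \<le> 2 * B" for s using B[of s] B[of t] by linarith
        qed simp
        show "set_integrable lborel {a..b} (\<lambda>s. \<bar>h s - \<phi> s\<bar> + 2 * c)"
          by (rule set_integral_add(1)[OF i1]) (rule bounded_set_integrable[where B="2 * c"], use c in auto)
        fix s assume "s \<in> {a..b}"
        then have "\<bar>s - t\<bar> < \<delta>1" using ab \<delta> by auto
        then show "\<bar>h s - h t\<bar> \<le> \<bar>h s - \<phi> s\<bar> + 2 * c" using \<delta>1(2)[of s] gt by linarith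
      qed
      also have "\<dots> = (LINT s:{a..b}|lborel. \<bar>h s - \<phi> s\<bar>) + 2 * c * (b - a)"
      proof -
        have "(LINT s:{a..b}|lborel. \<bar>h s - \<phi> s\<bar> + 2 * c) =
            (LINT s:{a..b}|lborel. \<bar>h s - \<phi> s\<bar>) + (LINT s:{a..b}|lborel. 2 * c)"
          by (rule set_integral_add(2)[OF i1]) (rule bounded_set_integrable[where B="2 * c"], use c in auto)
        moreover have "(LINT s:{a..b}|lborel. 2 * c) = 2 * c * (b - a)"
          using ab by (subst set_integral_const) auto
        ultimately show ?thesis by simp
      qed
      also have "(LINT s:{a..b}|lborel. \<bar>h s - \<phi> s\<bar>) \<le> (LINT s:cball t r|lborel. g s)"
        unfolding set_lebesgue_integral_def
      proof (rule integral_mono)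
        show "integrable lborel (\<lambda>s. indicator {a..b} s *\<^sub>R \<bar>h s - \<phi> s\<bar>)" using i1 by (simp add: set_integrable_def)
        show "integrable lborel (\<lambda>s. indicator (cball t r) s *\<^sub>R g s)"
          by (rule integrable_mult_indicator[OF _ gint]) simp
        fix s
        show "indicator {a..b} s *\<^sub>R \<bar>h s - \<phi> s\<bar> \<le> indicator (cball t r) s *\<^sub>R g s"
        proof (cases "s \<in> {a..b}")
          case True
          then have "s \<in> cball t r" "s \<in> {0..T}" using sub ab \<delta> t0 by auto
          then show ?thesis using True by (simp add: g_def)
        qed (simp add: g0)
      qed
      also have "(LINT s:cball t r|lborel. g s) \<le> c * r"
        using tS r \<delta> unfolding S_def by force
      finally have "\<bar>(LINT s:{a..b}|lborel. h s) - h t * (b - a)\<bar> \<le> c * r + 2 * c * (b - a)" by simp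
      also have "\<dots> = 3 / 4 * (\<epsilon> * (b - a))" by (simp add: r_def c_def field_simps)
      also have "\<dots> \<le> \<epsilon> * (b - a)" using r(1) \<open>0 < \<epsilon>\<close> by (simp add: r_def)
      finally show ?thesis .
    qed
    then show False using t(1) \<delta>(1) by blast
  qed
  moreover have "T1 \<union> T2 \<in> lmeasurable" using T1(1) T2(1) by (rule fmeasurable.Un)
  moreover have "measure lebesgue (T1 \<union> T2) \<le> e"
    using measure_Un_le[of T1 lebesgue T2] T1 T2 by (auto simp: fmeasurable_def)
  ultimately show "\<exists>U. ?Bad \<subseteq> U \<and> U \<in> lmeasurable \<and> measure lebesgue U \<le> e" by blast
qed

text \<open>Accuracies \<open>1 / (k + 1)\<close> and horizons \<open>N\<close> are countable, so
  one null set serves all of them.\<close>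

theorem lebesgue_differentiation:
  fixes h :: "real \<Rightarrow> real"
  assumes h[measurable]: "h \<in> borel_measurable borel" and B: "\<And>s. \<bar>h s\<bar> \<le> B"
  shows "AE t in lborel. 0 < t \<longrightarrow> ((\<lambda>\<tau>. LINT s:{0..\<tau>}|lborel. h s) has_real_derivative h t) (at t)"
proof -
  define good where "good t \<epsilon> \<longleftrightarrow> (\<exists>\<delta>>0. \<forall>a b. a \<le> t \<and> t \<le> b \<and> t - \<delta> < a \<and> b < t + \<delta> \<and> (a = t \<or> b = t) \<longrightarrow>
      \<bar>(LINT s:{a..b}|lborel. h s) - h t * (b - a)\<bar> \<le> \<epsilon> * (b - a))" for t \<epsilon>
  have "AE t in lborel. \<forall>N k. 0 < t \<and> t < real N \<longrightarrow> good t (inverse (real (Suc k)))"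
    unfolding AE_all_countable
  proof (intro allI)
    fix N k :: nat
    have "negligible {t. 0 < t \<and> t < real N \<and> \<not> good t (inverse (real (Suc k)))}"
      unfolding good_def by (rule lebesgue_differentiation_aux[OF h B]) simp
    then have "AE t in lebesgue. t \<notin> {t. 0 < t \<and> t < real N \<and> \<not> good t (inverse (real (Suc k)))}"
      by (intro AE_not_in) (simp add: negligible_iff_null_sets)
    then show "AE t in lborel. 0 < t \<and> t < real N \<longrightarrow> good t (inverse (real (Suc k)))"
      unfolding AE_completion_iff by eventually_elim auto
  qed
  then show ?thesis
  proof (eventually_elim, intro impI)
    fix t :: real assume *: "\<forall>N k. 0 < t \<and> t < real N \<longrightarrow> good t (inverse (real (Suc k)))" and t: "0 < t"
    obtain N where N: "t < real N" using reals_Archimedean2 by blast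
    have spl: "(LINT s:{0..b}|lborel. h s) - (LINT s:{0..a}|lborel. h s) = (LINT s:{a..b}|lborel. h s)" if "0 \<le> a" "a \<le> b" for a b
      using set_integral_Icc_split[OF bounded_set_integrable[OF h, of 0 b B] that] B by auto
    show "((\<lambda>\<tau>. LINT s:{0..\<tau>}|lborel. h s) has_real_derivative h t) (at t)"
      unfolding DERIV_def LIM_eq
    proof (intro allI impI)
      fix \<epsilon> :: real assume "0 < \<epsilon>"
      obtain k where k: "inverse (real (Suc k)) < \<epsilon>" using reals_Archimedean \<open>0 < \<epsilon>\<close> by blast
      obtain \<delta> where \<delta>: "\<delta> > 0" "\<And>a b. a \<le> t \<Longrightarrow> t \<le> b \<Longrightarrow> t - \<delta> < a \<Longrightarrow> b < t + \<delta> \<Longrightarrow> a = t \<or> b = t \<Longrightarrow>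
        \<bar>(LINT s:{a..b}|lborel. h s) - h t * (b - a)\<bar> \<le> inverse (real (Suc k)) * (b - a)"
        using *[rule_format, of N k] t N unfolding good_def by blast
      show "\<exists>s>0. \<forall>x. x \<noteq> 0 \<and> norm (x - 0) < s \<longrightarrow>
         norm (((LINT s:{0..t + x}|lborel. h s) - (LINT s:{0..t}|lborel. h s)) / x - h t) < \<epsilon>"
      proof (intro exI[of _ "min \<delta> t"] conjI allI impI)
        show "0 < min \<delta> t" using \<delta> t by simp
        fix x :: real assume x: "x \<noteq> 0 \<and> norm (x - 0) < min \<delta> t"
        have "\<bar>((LINT s:{0..t + x}|lborel. h s) - (LINT s:{0..t}|lborel. h s)) - h t * x\<bar> \<le> inverse (real (Suc k)) * \<bar>x\<bar>"
        proof (cases "0 < x")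
          case True
          then show ?thesis using \<delta>(2)[of t "t + x"] spl[of t "t + x"] x t by auto
        next
          case False
          then show ?thesis using \<delta>(2)[of "t + x" t] spl[of "t + x" t] x t by auto
        qed
        also have "\<dots> < \<epsilon> * \<bar>x\<bar>" using k x by (intro mult_strict_right_mono) auto
        finally have "\<bar>((LINT s:{0..t + x}|lborel. h s) - (LINT s:{0..t}|lborel. h s)) - h t * x\<bar> / \<bar>x\<bar> < \<epsilon>"
          using x by (simp add: divide_less_eq)
        moreover have "((LINT s:{0..t + x}|lborel. h s) - (LINT s:{0..t}|lborel. h s)) / x - h t =
           (((LINT s:{0..t + x}|lborel. h s) - (LINT s:{0..t}|lborel. h s)) - h t * x) / x"
          using x by (simp add: field_simps)
        ultimately show "norm (((LINT s:{0..t + x}|lborel. h s) - (LINT s:{0..t}|lborel. h s)) / x - h t) < \<epsilon>"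
          by (simp add: abs_divide)
      qed
    qed
  qed
qed

text \<open>The integral is Lipschitz in its upper end, so vanishing at rational ends extends to all
  ends; differentiating the zero function then gives the claim. Rational ends are what countably
  many almost sure statements can provide.\<close>

lemma AE_zero_if_integrals_zero:
  fixes h :: "real \<Rightarrow> real"
  assumes h[measurable]: "h \<in> borel_measurable borel" and B: "\<And>s. \<bar>h s\<bar> \<le> B"
    and z: "\<And>t. t \<in> \<rat> \<Longrightarrow> 0 < t \<Longrightarrow> (LINT s:{0..t}|lborel. h s) = 0"
  shows "AE t in lborel. 0 < t \<longrightarrow> h t = 0"
proof -
  have F0: "(LINT s:{0..t}|lborel. h s) = 0" if t: "0 < t" for t
  proof (rule ccontr)
    assume ne: "(LINT s:{0..t}|lborel. h s) \<noteq> 0"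
    have B0: "0 \<le> B" using B[of 0] by linarith
    \<comment> \<open>This distance makes the Lipschitz bound \<open>B * d\<close> smaller than the
      supposed nonzero value.\<close>
    define d where "d = \<bar>LINT s:{0..t}|lborel. h s\<bar> / (B + 1)"
    have "0 < d" using ne B0 by (simp add: d_def)
    then obtain q where q: "q \<in> \<rat>" "t < q" "q < t + d" using Rats_dense_in_real[of t "t + d"] by auto
    have "(LINT s:{0..q}|lborel. h s) = (LINT s:{0..t}|lborel. h s) + (LINT s:{t..q}|lborel. h s)"
      by (rule set_integral_Icc_split[OF bounded_set_integrable[OF h B]]) (use q t in auto)
    then have "\<bar>LINT s:{0..t}|lborel. h s\<bar> = \<bar>LINT s:{t..q}|lborel. h s\<bar>" using z q t by simp
    also have "\<dots> \<le> B * (q - t)" by (rule set_integral_bound[OF h B]) (use q in auto)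
    also have "\<dots> \<le> B * d" using q B0 by (intro mult_left_mono) auto
    also have "\<dots> < \<bar>LINT s:{0..t}|lborel. h s\<bar>"
      using ne B0 by (simp add: d_def field_simps)
    finally show False by simp
  qed
  from lebesgue_differentiation[OF h B] show ?thesis
  proof (eventually_elim, intro impI)
    fix t :: real assume *: "0 < t \<longrightarrow> ((\<lambda>\<tau>. LINT s:{0..\<tau>}|lborel. h s) has_real_derivative h t) (at t)" and t: "0 < t"
    have "((\<lambda>\<tau>. 0) has_real_derivative h t) (at t)"
      by (rule has_field_derivative_transform_within_open[of "\<lambda>\<tau>. LINT s:{0..\<tau>}|lborel. h s" _ _ "{0<..}"])
         (use * t F0 in auto)
    then show "h t = 0" using DERIV_unique DERIV_const by blast
  qed
qed

text \<open>For integrands such as the defect of the integral equation, whose bound grows with the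
  horizon; cutting at \<open>Suc T\<close> reduces to the bounded case.\<close>

lemma AE_zero_if_integrals_zero_local:
  fixes h :: "real \<Rightarrow> real"
  assumes h[measurable]: "h \<in> borel_measurable borel" and B: "\<And>T. \<exists>B. \<forall>s\<in>{0..T}. \<bar>h s\<bar> \<le> B"
    and z: "\<And>t. t \<in> \<rat> \<Longrightarrow> 0 < t \<Longrightarrow> (LINT s:{0..t}|lborel. h s) = 0"
  shows "AE t in lborel. 0 < t \<longrightarrow> h t = 0"
proof -
  have "AE t in lborel. \<forall>T. 0 < t \<longrightarrow> indicator {0..real (Suc T)} t * h t = 0"
    unfolding AE_all_countable
  proof
    fix T
    obtain C where C: "\<forall>s\<in>{0..real (Suc T)}. \<bar>h s\<bar> \<le> C" using B by blast
    then have "\<bar>h 0\<bar> \<le> C" by auto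
    then have C0: "0 \<le> C" by linarith
    show "AE t in lborel. 0 < t \<longrightarrow> indicator {0..real (Suc T)} t * h t = 0"
    proof (rule AE_zero_if_integrals_zero[where B=C])
      show "\<bar>indicator {0..real (Suc T)} s * h s\<bar> \<le> C" for s using C C0 by (auto simp: indicator_def simp del: of_nat_Suc)
      fix t :: real assume t: "t \<in> \<rat>" "0 < t"
      have "(LINT s:{0..t}|lborel. indicator {0..real (Suc T)} s * h s) = (LINT s:{0..min t (real (Suc T))}|lborel. h s)"
        unfolding set_lebesgue_integral_def
        by (rule Bochner_Integration.integral_cong) (auto simp: indicator_def)
      also have "\<dots> = 0" by (rule z) (use t in \<open>auto simp: min_def\<close>)
      finally show "(LINT s:{0..t}|lborel. indicator {0..real (Suc T)} s * h s) = 0" .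
    qed measurable
  qed
  then show ?thesis
  proof (eventually_elim, intro impI)
    fix t assume *: "\<forall>T. 0 < t \<longrightarrow> indicator {0..real (Suc T)} t * h t = 0" and t: "0 < t"
    obtain T where "t < real T" using reals_Archimedean2 by blast
    then have "t \<in> {0..real (Suc T)}" using t by auto
    then show "h t = 0" using *[rule_format, of T] t by simp
  qed
qed

text \<open>A set of times of full measure accumulates at \<open>s\<close> from the right.\<close>

lemma zero_if_AE_zero_right_continuous:
  fixes h :: "real \<Rightarrow> real"
  assumes ae: "AE t in lborel. 0 < t \<longrightarrow> h t = 0" and rc: "(h \<longlongrightarrow> h s) (at_right s)" and s: "0 \<le> s"
  shows "h s = 0"
proof (rule ccontr)
  assume "h s \<noteq> 0"
  then have "\<forall>\<^sub>F \<tau> in at_right s. h \<tau> \<noteq> 0" by (rule tendsto_imp_eventually_ne[OF rc])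
  then obtain b where b: "s < b" "\<And>\<tau>. s < \<tau> \<Longrightarrow> \<tau> < b \<Longrightarrow> h \<tau> \<noteq> 0" unfolding eventually_at_right_field by blast
  have "AE \<tau> in lborel. \<tau> \<notin> {s<..<b}" using ae by eventually_elim (use b s in auto)
  then have "{s<..<b} \<in> null_sets lborel" by (subst AE_iff_null_sets) auto
  then have "emeasure lborel {s<..<b} = 0" by auto
  then show False using b(1) by simp
qed

section \<open>The martingale problem of the finite system\<close>

text \<open>The infinitely many levels enter the generators through such series: summable rates
  \<open>a\<close> against bounded increments \<open>d\<close>.\<close>

lemma weighted_suminf_bound:
  fixes a d :: "nat \<Rightarrow> real"
  assumes "summable a" "suminf a \<le> A" "\<And>j. 0 \<le> a j" "\<And>j. \<bar>d j\<bar> \<le> C"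
  shows "summable (\<lambda>j. a j * d j)" "\<bar>\<Sum>j. a j * d j\<bar> \<le> A * C"
proof -
  have C: "0 \<le> C" using assms(4)[of 0] by linarith
  have le: "norm (a j * d j) \<le> a j * C" for j
    using assms(3)[of j] assms(4)[of j] by (simp add: abs_mult mult_left_mono)
  have s: "summable (\<lambda>j. a j * C)" using assms(1) by (rule summable_mult2)
  show "summable (\<lambda>j. a j * d j)" by (rule summable_comparison_test'[OF s]) (rule le)
  have "summable (\<lambda>j. norm (a j * d j))" by (rule summable_comparison_test'[OF s]) (use le in simp)
  then have "\<bar>\<Sum>j. a j * d j\<bar> \<le> (\<Sum>j. norm (a j * d j))" by (metis real_norm_def summable_norm)
  also have "\<dots> \<le> (\<Sum>j. a j * C)" by (rule suminf_le[OF le]) fact+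
  also have "\<dots> = suminf a * C" by (rule suminf_mult2[OF assms(1), symmetric])
  also have "\<dots> \<le> A * C" using assms(2) C by (rule mult_right_mono)
  finally show "\<bar>\<Sum>j. a j * d j\<bar> \<le> A * C" .
qed

text \<open>Both kinds of jump rate are increments of a monotone bounded sequence. Hence infinitely
  many levels have a finite total rate, bounded by the first term.\<close>

lemma telescoping_weights:
  fixes c :: "nat \<Rightarrow> real"
  assumes "\<And>j. c (Suc j) \<le> c j" "\<And>j. 0 \<le> c j"
  shows "summable (\<lambda>j. c j - c (Suc j))" "(\<Sum>j. c j - c (Suc j)) \<le> c 0"
proof -
  have "decseq c" using assms(1) by (simp add: decseq_SucI)
  then obtain L where L: "c \<longlonglongrightarrow> L" using decseq_convergent[of c 0] assms(2) by blast
  have "(\<lambda>j. c j - c (Suc j)) sums (c 0 - L)" by (rule telescope_sums'[OF L])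
  moreover have "0 \<le> L" by (rule LIMSEQ_le_const[OF L]) (use assms(2) in auto)
  ultimately show "summable (\<lambda>j. c j - c (Suc j))" "(\<Sum>j. c j - c (Suc j)) \<le> c 0"
    by (auto simp: sums_iff)
qed

section \<open>Jump rates and generator of the finite system\<close>

definition upN :: "real \<Rightarrow> (nat \<Rightarrow> nat) \<Rightarrow> nat \<Rightarrow> real" where
  "upN lam m j = lam * (real (m j) - real (m (Suc j)))"

definition dnN :: "real \<Rightarrow> nat \<Rightarrow> (nat \<Rightarrow> nat) \<Rightarrow> nat \<Rightarrow> real" where
  "dnN q n m j = real n * ((1 - q) ^ (m (Suc (Suc j))) - (1 - q) ^ (m (Suc j)))"

lemma genN_rates:
  "genN lam q n f m = (\<Sum>j. upN lam m j * (f (m(Suc j := Suc (m (Suc j)))) - f m)) +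
     (\<Sum>j. dnN q n m j * (f (m(Suc j := m (Suc j) - 1)) - f m))"
  by (simp add: genN_def upN_def dnN_def)

lemma rates_Sn:
  assumes "m \<in> Sn n" "0 < lam" "0 < q" "q \<le> 1"
  shows "\<And>j. 0 \<le> upN lam m j" "summable (upN lam m)" "suminf (upN lam m) \<le> lam * real n"
    "\<And>j. 0 \<le> dnN q n m j" "summable (dnN q n m)" "suminf (dnN q n m) \<le> real n"
proof -
  have m: "m 0 = n" "\<And>j. m (Suc j) \<le> m j" using assms(1) by (auto simp: Sn_def)
  have w: "summable (\<lambda>j. lam * real (m j) - lam * real (m (Suc j)))"
    "(\<Sum>j. lam * real (m j) - lam * real (m (Suc j))) \<le> lam * real (m 0)"
    by (rule telescoping_weights[of "\<lambda>j. lam * real (m j)"]; use m(2) assms(2) in simp)+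
  have e: "upN lam m = (\<lambda>j. lam * real (m j) - lam * real (m (Suc j)))"
    by (simp add: upN_def fun_eq_iff algebra_simps)
  show "0 \<le> upN lam m j" for j using m(2)[of j] assms(2) by (simp add: upN_def)
  show "summable (upN lam m)" "suminf (upN lam m) \<le> lam * real n" unfolding e using w m(1) by simp_all
  have p: "(1 - q) ^ m (Suc j) \<le> (1 - q) ^ m (Suc (Suc j))" for j
    using m(2)[of "Suc j"] assms by (intro power_decreasing) auto
  have p1: "(1 - q) ^ m (Suc j) \<le> 1" for j using assms by (intro power_le_one) auto
  \<comment> \<open>The powers \<open>(1 - q) ^ m\<close> increase with the level, so their
    complements are what telescopes.\<close>
  have w: "summable (\<lambda>j. real n * (1 - (1 - q) ^ m (Suc j)) - real n * (1 - (1 - q) ^ m (Suc (Suc j))))"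
    "(\<Sum>j. real n * (1 - (1 - q) ^ m (Suc j)) - real n * (1 - (1 - q) ^ m (Suc (Suc j)))) \<le> real n * (1 - (1 - q) ^ m (Suc 0))"
    by (rule telescoping_weights[of "\<lambda>j. real n * (1 - (1 - q) ^ m (Suc j))"]; use p p1 in \<open>simp add: mult_left_mono\<close>)+
  have e: "dnN q n m = (\<lambda>j. real n * (1 - (1 - q) ^ m (Suc j)) - real n * (1 - (1 - q) ^ m (Suc (Suc j))))"
    by (simp add: dnN_def fun_eq_iff algebra_simps)
  show "0 \<le> dnN q n m j" for j using p[of j] by (simp add: dnN_def)
  have "real n * (1 - (1 - q) ^ m (Suc 0)) \<le> real n * 1"
    using assms by (intro mult_left_mono) auto
  then show "summable (dnN q n m)" "suminf (dnN q n m) \<le> real n" unfolding e using w by simp_all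
qed

lemma genN_bound:
  assumes "m \<in> Sn n" "0 < lam" "0 < q" "q \<le> 1" "\<And>m m'. \<bar>f m' - f m\<bar> \<le> C"
  shows "\<bar>genN lam q n f m\<bar> \<le> real n * (lam + 1) * C"
proof -
  note r = rates_Sn[OF assms(1-4)]
  have "\<bar>\<Sum>j. upN lam m j * (f (m(Suc j := Suc (m (Suc j)))) - f m)\<bar> \<le> lam * real n * C"
    by (rule weighted_suminf_bound(2)[OF r(2,3,1)]) (rule assms(5))
  moreover have "\<bar>\<Sum>j. dnN q n m j * (f (m(Suc j := m (Suc j) - 1)) - f m)\<bar> \<le> real n * C"
    by (rule weighted_suminf_bound(2)[OF r(5,6,4)]) (rule assms(5))
  ultimately show ?thesis unfolding genN_rates by (simp add: algebra_simps)
qed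

text \<open>Termwise, \<open>f(m')^2 - f(m)^2 - 2 f(m) (f(m') - f(m))\<close> is the square of the
  jump \<open>f(m') - f(m)\<close>. So the left side, the carre du champ, is at most the total rate
  \<open>n (lam + 1)\<close> times \<open>C^2\<close>; the bound \<open>B\<close> makes the series
  for the square of \<open>f\<close> converge.\<close>

lemma genN_carre_du_champ:
  assumes "m \<in> Sn n" "0 < lam" "0 < q" "q \<le> 1" and B: "\<And>m. \<bar>f m\<bar> \<le> B"
    and up: "\<And>m j. \<bar>f (m(Suc j := Suc (m (Suc j)))) - f m\<bar> \<le> C"
    and dn: "\<And>m j. \<bar>f (m(Suc j := m (Suc j) - 1)) - f m\<bar> \<le> C"
  shows "genN lam q n (\<lambda>m. (f m)\<^sup>2) m - 2 * f m * genN lam q n f m \<le> real n * (lam + 1) * C\<^sup>2"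
proof -
  note r = rates_Sn[OF assms(1-4)]
  have sq: "\<bar>(f m')\<^sup>2 - (f m)\<^sup>2\<bar> \<le> 2 * B\<^sup>2" for m' m
  proof -
    have "(f m)\<^sup>2 \<le> B\<^sup>2" for m using power_mono[OF B abs_ge_zero, of m 2] by simp
    from this[of m] this[of m'] show ?thesis
      using zero_le_power2[of "f m"] zero_le_power2[of "f m'"] unfolding abs_le_iff by linarith
  qed
  have lin: "(\<Sum>j. a j * ((f (g j))\<^sup>2 - (f m)\<^sup>2)) - 2 * f m * (\<Sum>j. a j * (f (g j) - f m)) \<le> A * C\<^sup>2"
    if a: "summable a" "suminf a \<le> A" "\<And>j. 0 \<le> a j" and g: "\<And>j. \<bar>f (g j) - f m\<bar> \<le> C" for a A g
  proof -
    have s1: "summable (\<lambda>j. a j * ((f (g j))\<^sup>2 - (f m)\<^sup>2))"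
      by (rule weighted_suminf_bound(1)[OF a]) (rule sq)
    have s2: "summable (\<lambda>j. a j * (f (g j) - f m))"
      by (rule weighted_suminf_bound(1)[OF a]) (rule g)
    have "(\<Sum>j. a j * ((f (g j))\<^sup>2 - (f m)\<^sup>2)) - 2 * f m * (\<Sum>j. a j * (f (g j) - f m))
       = (\<Sum>j. a j * ((f (g j))\<^sup>2 - (f m)\<^sup>2) - 2 * f m * (a j * (f (g j) - f m)))"
      using suminf_diff[OF s1 summable_mult[OF s2, of "2 * f m"]] suminf_mult[OF s2, of "2 * f m"] by simp
    also have "\<dots> = (\<Sum>j. a j * (f (g j) - f m)\<^sup>2)"
      by (rule arg_cong[of _ _ suminf]) (simp add: fun_eq_iff power2_eq_square algebra_simps)
    also have "\<dots> \<le> \<bar>\<dots>\<bar>" by simp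
    also have "\<dots> \<le> A * C\<^sup>2"
    proof (rule weighted_suminf_bound(2)[OF a])
      show "\<bar>(f (g j) - f m)\<^sup>2\<bar> \<le> C\<^sup>2" for j using power_mono[OF g abs_ge_zero, of j 2] by simp
    qed
    finally show ?thesis .
  qed
  have "(\<Sum>j. upN lam m j * ((f (m(Suc j := Suc (m (Suc j)))))\<^sup>2 - (f m)\<^sup>2))
      - 2 * f m * (\<Sum>j. upN lam m j * (f (m(Suc j := Suc (m (Suc j)))) - f m)) \<le> lam * real n * C\<^sup>2"
    by (rule lin[OF r(2,3,1)]) (rule up)
  moreover have "(\<Sum>j. dnN q n m j * ((f (m(Suc j := m (Suc j) - 1)))\<^sup>2 - (f m)\<^sup>2))
      - 2 * f m * (\<Sum>j. dnN q n m j * (f (m(Suc j := m (Suc j) - 1)) - f m)) \<le> real n * C\<^sup>2"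
    by (rule lin[OF r(5,6,4)]) (rule dn)
  ultimately show ?thesis unfolding genN_rates by (simp add: algebra_simps)
qed

locale lcq =
  fixes lam q :: real and n :: nat and M :: "'a measure" and X :: "'a \<Rightarrow> real \<Rightarrow> nat \<Rightarrow> nat"
  assumes chain: "lcq_chain lam q n M X" and lam: "0 < lam" and q: "0 < q" "q \<le> 1" and n: "0 < n"
begin

sublocale prob_space M using chain by (simp add: lcq_chain_def)

text \<open>The chain is constrained at nonnegative times only; freezing it before 0 lets membership
  in \<open>Sn n\<close> and measurability hold on the whole line.\<close>

definition Z :: "'a \<Rightarrow> real \<Rightarrow> nat \<Rightarrow> nat" where "Z x t = X x (max 0 t)"

lemma Z_eq: "0 \<le> t \<Longrightarrow> Z x t = X x t" by (simp add: Z_def)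

lemma Z_Sn: "Z x t \<in> Sn n"
  using chain unfolding lcq_chain_def Z_def by simp

lemma Z_measurable: "(\<lambda>x. g (Z x t)) \<in> borel_measurable M" for g :: "_ \<Rightarrow> real"
proof -
  have "(\<lambda>x. X x (max 0 t)) \<in> M \<rightarrow>\<^sub>M count_space UNIV"
    using chain unfolding lcq_chain_def by auto
  from measurable_compose[OF this, of g borel] show ?thesis by (simp add: Z_def)
qed

text \<open>Paths are right-constant, not just right-continuous, so arbitrary functions of the state
  inherit right-continuity and with it joint measurability.\<close>

lemma X_right_constant: "0 \<le> t \<Longrightarrow> ((\<lambda>s. g (X x s)) \<longlongrightarrow> g (X x t)) (at_right t)" for g :: "_ \<Rightarrow> real"
proof -
  assume "0 \<le> t"
  then obtain \<delta> where \<delta>: "\<delta> > 0" "\<forall>s. t \<le> s \<and> s < t + \<delta> \<longrightarrow> X x s = X x t"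
    using chain[unfolded lcq_chain_def, THEN conjunct2, THEN conjunct2, THEN conjunct2, THEN conjunct1,
        rule_format, of x, THEN conjunct1, rule_format, of t] by blast
  have "\<forall>\<^sub>F s in at_right t. g (X x s) = g (X x t)"
    unfolding eventually_at_right_field
  proof (intro exI[of _ "t + \<delta>"] conjI allI impI)
    show "t < t + \<delta>" using \<delta>(1) by simp
    fix s assume "t < s" "s < t + \<delta>"
    then have "X x s = X x t" by (intro \<delta>(2)[rule_format] conjI less_imp_le)
    then show "g (X x s) = g (X x t)" by (rule arg_cong)
  qed
  then show ?thesis by (rule tendsto_eventually)
qed

lemma Z_pair_measurable: "(\<lambda>z. g (Z (fst z) (snd z))) \<in> borel_measurable (M \<Otimes>\<^sub>M (lborel :: real measure))"
  for g :: "_ \<Rightarrow> real"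
  unfolding Z_def
proof (rule right_continuous_measurable_pair[of "\<lambda>x t. g (X x t)"])
  show "(\<lambda>x. g (X x t)) \<in> borel_measurable M" if "0 \<le> t" for t
    using Z_measurable[of g t] that by (simp add: Z_def)
  show "((\<lambda>t. g (X x t)) \<longlongrightarrow> g (X x t)) (at_right t)" if "0 \<le> t" for x t
    by (rule X_right_constant[OF that, of g x])
qed

lemma Z_path_measurable: "(\<lambda>s. g (Z x s)) \<in> borel_measurable borel" for g :: "_ \<Rightarrow> real"
  unfolding Z_def by (rule right_continuous_measurable[of "\<lambda>t. g (X x t)", OF X_right_constant[of _ g x]])

text \<open>The case of one past time, taken to be \<open>s\<close> itself. It is enough for second
  moments, where increments only have to be orthogonal to functions of \<open>Z x s\<close>.\<close>

lemma martingale: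
  fixes f g :: "(nat \<Rightarrow> nat) \<Rightarrow> real"
  assumes f: "\<And>m. \<bar>f m\<bar> \<le> B" and g: "\<And>m. \<bar>g m\<bar> \<le> C" and "0 \<le> s" "s \<le> t"
  shows "(\<integral>x. (f (Z x t) - f (Z x s) - (LINT r:{s..t}|lborel. genN lam q n f (Z x r))) * g (Z x s) \<partial>M) = 0"
proof -
  have bf: "bounded (range f)" unfolding bounded_iff using f by auto
  have bg: "bounded (range g)" unfolding bounded_iff using g by auto
  have "\<forall>f. bounded (range f) \<longrightarrow>
        (\<forall>s t rs gs. 0 \<le> s \<longrightarrow> s \<le> t \<longrightarrow>
           (\<forall>i<length rs. 0 \<le> rs ! i \<and> rs ! i \<le> s) \<longrightarrow>
           (\<forall>i<length rs. bounded (range (gs i :: (nat \<Rightarrow> nat) \<Rightarrow> real))) \<longrightarrow>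
           (\<integral>x. (f (X x t) - f (X x s) - (LINT r:{s..t}|lborel. genN lam q n f (X x r)))
                  * (\<Prod>i<length rs. gs i (X x (rs ! i))) \<partial>M) = 0)"
    using chain[unfolded lcq_chain_def, THEN conjunct2, THEN conjunct2, THEN conjunct2, THEN conjunct2] .
  from this[rule_format, OF bf \<open>0 \<le> s\<close> \<open>s \<le> t\<close>, of "[s]" "\<lambda>_. g"]
  have "(\<integral>x. (f (X x t) - f (X x s) - (LINT r:{s..t}|lborel. genN lam q n f (X x r))) * g (X x s) \<partial>M) = 0"
    using bg \<open>0 \<le> s\<close> by simp
  moreover have "(LINT r:{s..t}|lborel. genN lam q n f (X x r)) = (LINT r:{s..t}|lborel. genN lam q n f (Z x r))" for x
    by (rule set_lebesgue_integral_cong) (use \<open>0 \<le> s\<close> in \<open>auto simp: Z_eq\<close>)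
  ultimately show ?thesis using assms by (simp add: Z_eq)
qed

text \<open>The martingale problem only admits test functions that are bounded on all of the type, and the generator
  is bounded on the state space only.\<close>

definition genS :: "((nat \<Rightarrow> nat) \<Rightarrow> real) \<Rightarrow> (nat \<Rightarrow> nat) \<Rightarrow> real" where
  "genS f m = (if m \<in> Sn n then genN lam q n f m else 0)"

lemma genS_Z: "genN lam q n f (Z x r) = genS f (Z x r)"
  by (simp add: genS_def Z_Sn)

lemma genS_bound:
  assumes "\<And>m. \<bar>f m\<bar> \<le> B"
  shows "\<bar>genS f m\<bar> \<le> real n * (lam + 1) * (2 * B)"
proof (cases "m \<in> Sn n")
  case True
  have "\<bar>f m' - f m\<bar> \<le> 2 * B" for m m' using assms[of m] assms[of m'] by linarith
  from genN_bound[OF True lam q this] show ?thesis using True by (simp add: genS_def)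
next
  case False
  have "0 \<le> B" using assms[of undefined] by linarith
  then show ?thesis using False lam by (simp add: genS_def)
qed

lemma integral_Z_measurable: "(\<lambda>x. LINT r:{s..t}|lborel. g (Z x r)) \<in> borel_measurable M" for g :: "_ \<Rightarrow> real"
proof -
  have [measurable]: "(\<lambda>z. g (Z (fst z) (snd z))) \<in> borel_measurable (M \<Otimes>\<^sub>M lborel)" by (rule Z_pair_measurable)
  have "(\<lambda>(x, r). indicator {s..t} r *\<^sub>R g (Z x r)) \<in> borel_measurable (M \<Otimes>\<^sub>M lborel)"
    unfolding split_beta by measurable
  then show ?thesis unfolding set_lebesgue_integral_def by (rule lborel.borel_measurable_lebesgue_integral)
qed

lemma integral_Z_integrable:
  fixes g :: "_ \<Rightarrow> real"
  assumes "\<And>m. \<bar>g m\<bar> \<le> K" 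
  shows "set_integrable lborel {s..t} (\<lambda>r. g (Z x r))"
  by (rule bounded_set_integrable[OF Z_path_measurable assms])

lemma integral_Z_bound:
  fixes g :: "_ \<Rightarrow> real"
  assumes "\<And>m. \<bar>g m\<bar> \<le> K" "s \<le> t"
  shows "\<bar>LINT r:{s..t}|lborel. g (Z x r)\<bar> \<le> K * (t - s)"
  by (rule set_integral_bound[OF Z_path_measurable assms])

text \<open>For fixed \<open>r\<close> the integrand is the martingale increment from
  \<open>r\<close> to \<open>t\<close> times a bounded function of the state at \<open>r\<close>, so
  its expectation vanishes; Fubini exchanges expectation and time. This is the cross term in the
  squared martingale.\<close>

lemma correction_term_zero:
  fixes f :: "_ \<Rightarrow> real"
  assumes f: "\<And>m. \<bar>f m\<bar> \<le> B" and t: "0 \<le> t"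
  shows "(\<integral>x. (LINT r:{0..t}|lborel. (f (Z x t) - f (Z x r) - (LINT s:{r..t}|lborel. genS f (Z x s))) * genS f (Z x r)) \<partial>M) = 0"
proof -
  interpret ps: pair_sigma_finite M lborel ..
  define K where "K = real n * (lam + 1) * (2 * B)"
  have K: "\<bar>genS f m\<bar> \<le> K" for m unfolding K_def by (rule genS_bound[OF f])
  have K0: "0 \<le> K" using K[of undefined] by linarith
  define W where "W x r = (f (Z x t) - f (Z x r) - (LINT s:{r..t}|lborel. genS f (Z x s))) * genS f (Z x r)" for x r
  have Wb: "\<bar>W x r\<bar> \<le> (2 * B + K * t) * K" if "r \<in> {0..t}" for x r
  proof -
    have "\<bar>LINT s:{r..t}|lborel. genS f (Z x s)\<bar> \<le> K * (t - r)"
      by (rule integral_Z_bound[OF K]) (use that in auto)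
    also have "\<dots> \<le> K * t" using that K0 by (intro mult_left_mono) auto
    finally have "\<bar>f (Z x t) - f (Z x r) - (LINT s:{r..t}|lborel. genS f (Z x s))\<bar> \<le> 2 * B + K * t"
      using f[of "Z x t"] f[of "Z x r"] by linarith
    then show ?thesis unfolding W_def abs_mult using K K0 t f[of undefined]
      by (intro mult_mono) auto
  qed
  have m1: "(\<lambda>z. g (Z (fst z) (snd z))) \<in> borel_measurable (M \<Otimes>\<^sub>M lborel)" for g :: "_ \<Rightarrow> real"
    by (rule Z_pair_measurable)
  have m2: "(\<lambda>z. f (Z (fst z) t)) \<in> borel_measurable (M \<Otimes>\<^sub>M lborel)"
    by (rule measurable_compose[OF measurable_fst Z_measurable])
  have m3: "(\<lambda>z. LINT s:{snd z..t}|lborel. genS f (Z (fst z) s)) \<in> borel_measurable (M \<Otimes>\<^sub>M lborel)"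
    unfolding set_lebesgue_integral_def
  proof (rule lborel.borel_measurable_lebesgue_integral)
    have p: "(\<lambda>w. (fst (fst w), snd w)) \<in> (M \<Otimes>\<^sub>M lborel) \<Otimes>\<^sub>M lborel \<rightarrow>\<^sub>M M \<Otimes>\<^sub>M (lborel :: real measure)" by measurable
    have [measurable]: "(\<lambda>w. genS f (Z (fst (fst w)) (snd w))) \<in> borel_measurable ((M \<Otimes>\<^sub>M (lborel :: real measure)) \<Otimes>\<^sub>M lborel)"
      using measurable_compose[OF p m1[of "genS f"]] by simp
    have "(\<lambda>w. if snd (fst w) \<le> snd w \<and> snd w \<le> t then genS f (Z (fst (fst w)) (snd w)) else 0)
       \<in> borel_measurable ((M \<Otimes>\<^sub>M (lborel :: real measure)) \<Otimes>\<^sub>M lborel)" by measurable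
    then show "(\<lambda>(z, s). indicator {snd z..t} s *\<^sub>R genS f (Z (fst z) s)) \<in> borel_measurable ((M \<Otimes>\<^sub>M lborel) \<Otimes>\<^sub>M lborel)"
      by (rule measurable_cong[THEN iffD1, rotated]) (auto simp: indicator_def)
  qed
  have Wm[measurable]: "(\<lambda>z. W (fst z) (snd z)) \<in> borel_measurable (M \<Otimes>\<^sub>M lborel)"
    unfolding W_def using m1[of f] m1[of "genS f"] m2 m3 by (intro borel_measurable_times borel_measurable_diff)
  have "integrable (M \<Otimes>\<^sub>M lborel) (\<lambda>z. indicator (space M \<times> {0..t}) z *\<^sub>R W (fst z) (snd z))"
  proof (rule integrableI_bounded_set_indicator)
    show "emeasure (M \<Otimes>\<^sub>M lborel) (space M \<times> {0..t}) < \<infinity>"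
      by (subst lborel.emeasure_pair_measure_Times) (auto simp: emeasure_space_1 emeasure_lborel_Icc_eq)
    show "AE z in M \<Otimes>\<^sub>M lborel. z \<in> space M \<times> {0..t} \<longrightarrow> norm (W (fst z) (snd z)) \<le> (2 * B + K * t) * K"
      using Wb by (intro AE_I2) auto
  qed auto
  moreover have "(\<integral>z. indicator (space M \<times> {0..t}) z *\<^sub>R W (fst z) (snd z) \<partial>(M \<Otimes>\<^sub>M lborel)) = c \<longleftrightarrow>
      (\<integral>z. indicator {0..t} (snd z) *\<^sub>R W (fst z) (snd z) \<partial>(M \<Otimes>\<^sub>M lborel)) = c" for c
    by (intro arg_cong2[where f="(=)"] Bochner_Integration.integral_cong refl)
       (auto simp: space_pair_measure indicator_def)
  moreover have "integrable (M \<Otimes>\<^sub>M lborel) (\<lambda>z. indicator (space M \<times> {0..t}) z *\<^sub>R W (fst z) (snd z)) \<longleftrightarrow>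
     integrable (M \<Otimes>\<^sub>M lborel) (\<lambda>(x, r). indicator {0..t} r *\<^sub>R W x r)"
    by (rule Bochner_Integration.integrable_cong) (auto simp: space_pair_measure indicator_def)
  ultimately have "integrable (M \<Otimes>\<^sub>M lborel) (\<lambda>(x, r). indicator {0..t} r *\<^sub>R W x r)" by blast
  from ps.Fubini_integral[OF this]
  have "(\<integral>x. (LINT r|lborel. indicator {0..t} r *\<^sub>R W x r) \<partial>M) = (LINT r|lborel. (\<integral>x. indicator {0..t} r *\<^sub>R W x r \<partial>M))" by simp
  also have "\<dots> = (LINT r|(lborel :: real measure). 0)"
  proof (rule Bochner_Integration.integral_cong)
    fix r :: real
    show "(\<integral>x. indicator {0..t} r *\<^sub>R W x r \<partial>M) = 0"
    proof (cases "r \<in> {0..t}")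
      case True
      have "(\<integral>x. W x r \<partial>M) = 0"
        using martingale[OF f K, of r t] True unfolding W_def genS_Z by auto
      then show ?thesis by simp
    qed simp
  qed simp
  finally show ?thesis unfolding W_def set_lebesgue_integral_def by simp
qed

text \<open>The square \<open>{0..t} \<times> {0..t}\<close> consists of two triangles with equal
  integrals.\<close>

lemma triangle_square:
  fixes g :: "_ \<Rightarrow> real"
  assumes K: "\<And>m. \<bar>g m\<bar> \<le> K" and t: "0 \<le> t"
  shows "2 * (LINT r:{0..t}|lborel. g (Z x r) * (LINT s:{r..t}|lborel. g (Z x s))) = (LINT r:{0..t}|lborel. g (Z x r))\<^sup>2"
proof -
  define a where "a s = g (Z x s)" for s
  have [measurable]: "a \<in> borel_measurable borel" unfolding a_def by (rule Z_path_measurable)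
  have ab: "\<bar>a s\<bar> \<le> K" for s unfolding a_def by (rule K)
  have K0: "0 \<le> K" using ab[of 0] by linarith
  let ?A = "LINT r:{0..t}|lborel. a r"
  have ib: "\<bar>LINT s:{u..v}|lborel. a s\<bar> \<le> K * t" if "0 \<le> u" "u \<le> v" "v \<le> t" for u v
  proof -
    have "\<bar>LINT s:{u..v}|lborel. a s\<bar> \<le> K * (v - u)"
      by (rule set_integral_bound[OF _ ab]) (use that in auto)
    also have "\<dots> \<le> K * t" using that K0 by (intro mult_left_mono) auto
    finally show ?thesis .
  qed
  have mI[measurable]: "(\<lambda>r. LINT s:{r..t}|lborel. a s) \<in> borel_measurable borel" "(\<lambda>s. LINT r:{0..s}|lborel. a r) \<in> borel_measurable borel"
    by (rule integral_from_measurable integral_upto_measurable; measurable)+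
  have i1: "set_integrable lborel {0..t} (\<lambda>r. a r * (LINT s:{r..t}|lborel. a s))"
    by (rule bounded_set_integrable[where B="K * (K * t)"])
       (auto simp: abs_mult intro!: mult_mono ab ib K0)
  have i2: "set_integrable lborel {0..t} (\<lambda>r. a r * (LINT s:{0..r}|lborel. a s))"
    by (rule bounded_set_integrable[where B="K * (K * t)"])
       (auto simp: abs_mult intro!: mult_mono ab ib K0)
  have "2 * (LINT r:{0..t}|lborel. a r * (LINT s:{r..t}|lborel. a s)) =
     (LINT r:{0..t}|lborel. a r * (LINT s:{r..t}|lborel. a s)) + (LINT r:{0..t}|lborel. a r * (LINT s:{0..r}|lborel. a s))"
    using bounded_triangle_Fubini[of a a t K K] ab by simp
  also have "\<dots> = (LINT r:{0..t}|lborel. a r * (LINT s:{r..t}|lborel. a s) + a r * (LINT s:{0..r}|lborel. a s))"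
    by (rule set_integral_add(2)[OF i1 i2, symmetric])
  also have "\<dots> = (LINT r:{0..t}|lborel. a r * ?A)"
  proof (rule set_lebesgue_integral_cong)
    show "\<forall>r. r \<in> {0..t} \<longrightarrow> a r * (LINT s:{r..t}|lborel. a s) + a r * (LINT s:{0..r}|lborel. a s) = a r * ?A"
      using set_integral_Icc_split[OF bounded_set_integrable[of a 0 t K]] ab
      by (auto simp: distrib_left[symmetric] add.commute)
  qed simp
  also have "\<dots> = ?A\<^sup>2" by (simp add: power2_eq_square)
  finally show ?thesis unfolding a_def .
qed

text \<open>The square of the martingale is expanded path by path with the correction term
  \<open>V\<close>, so that the martingale identities for \<open>f\<close> and for its square
  suffice in place of a quadratic variation. What remains is the time integral of the carre du
  champ, at most \<open>n (lam + 1) C^2\<close> per unit of time.\<close>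

lemma second_moment:
  fixes f :: "_ \<Rightarrow> real"
  assumes f: "\<And>m. \<bar>f m\<bar> \<le> B" and t: "0 \<le> t"
    and up: "\<And>m j. \<bar>f (m(Suc j := Suc (m (Suc j)))) - f m\<bar> \<le> C"
    and dn: "\<And>m j. \<bar>f (m(Suc j := m (Suc j) - 1)) - f m\<bar> \<le> C"
  shows "(\<integral>x. (f (Z x t) - f (Z x 0) - (LINT r:{0..t}|lborel. genN lam q n f (Z x r)))\<^sup>2 \<partial>M) \<le> real n * (lam + 1) * C\<^sup>2 * t"
proof -
  have B0: "0 \<le> B" using f[of undefined] by linarith
  define f2 where "f2 m = (f m)\<^sup>2" for m
  have f2: "\<bar>f2 m\<bar> \<le> B\<^sup>2" for m using power_mono[OF f abs_ge_zero, of m 2] by (simp add: f2_def)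
  define K where "K = real n * (lam + 1) * (2 * B)"
  have K: "\<bar>genS f m\<bar> \<le> K" for m unfolding K_def by (rule genS_bound[OF f])
  define K2 where "K2 = real n * (lam + 1) * (2 * B\<^sup>2)"
  have K2: "\<bar>genS f2 m\<bar> \<le> K2" for m unfolding K2_def by (rule genS_bound[OF f2])
  have K0: "0 \<le> K" using K[of undefined] by linarith
  define A where "A x = (LINT r:{0..t}|lborel. genS f (Z x r))" for x
  define A2 where "A2 x = (LINT r:{0..t}|lborel. genS f2 (Z x r))" for x
  define fa where "fa m = f m * genS f m" for m
  have fab: "\<bar>fa m\<bar> \<le> B * K" for m unfolding fa_def abs_mult by (intro mult_mono f K B0) simp
  define FA where "FA x = (LINT r:{0..t}|lborel. fa (Z x r))" for x
  define V where "V x = (LINT r:{0..t}|lborel. (f (Z x t) - f (Z x r) - (LINT s:{r..t}|lborel. genS f (Z x s))) * genS f (Z x r))" for x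
  have [measurable]: "A \<in> borel_measurable M" "A2 \<in> borel_measurable M" "FA \<in> borel_measurable M"
    unfolding A_def[abs_def] A2_def[abs_def] FA_def[abs_def] by (rule integral_Z_measurable)+
  have [measurable]: "(\<lambda>x. f (Z x s)) \<in> borel_measurable M" "(\<lambda>x. f2 (Z x s)) \<in> borel_measurable M" for s
    by (rule Z_measurable)+
  have Ab: "\<bar>A x\<bar> \<le> K * t" "\<bar>A2 x\<bar> \<le> K2 * t" "\<bar>FA x\<bar> \<le> (B * K) * t" for x
    unfolding A_def A2_def FA_def
    using integral_Z_bound[of "genS f" K 0 t x, OF K t] integral_Z_bound[of "genS f2" K2 0 t x, OF K2 t]
      integral_Z_bound[of fa "B * K" 0 t x, OF fab t] by auto
  \<comment> \<open>By symmetry the integral over the triangle is half the square of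
    \<open>A x\<close>.\<close>
  have Veq: "V x = f (Z x t) * A x - FA x - (A x)\<^sup>2 / 2" for x
  proof -
    have s1: "set_integrable lborel {0..t} (\<lambda>r. f (Z x t) * genS f (Z x r))"
      by (rule set_integrable_mult_right) (rule integral_Z_integrable[OF K])
    have s2: "set_integrable lborel {0..t} (\<lambda>r. fa (Z x r))" by (rule integral_Z_integrable[OF fab])
    have mI: "(\<lambda>r. LINT s:{r..t}|lborel. genS f (Z x s)) \<in> borel_measurable borel"
      by (rule integral_from_measurable[OF Z_path_measurable])
    have s3: "set_integrable lborel {0..t} (\<lambda>r. genS f (Z x r) * (LINT s:{r..t}|lborel. genS f (Z x s)))"
    proof (rule bounded_set_integrable[where B="K * (K * t)"])
      show "(\<lambda>r. genS f (Z x r) * (LINT s:{r..t}|lborel. genS f (Z x s))) \<in> borel_measurable borel"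
        by (intro borel_measurable_times Z_path_measurable mI)
      fix r assume r: "r \<in> {0..t}"
      have "\<bar>LINT s:{r..t}|lborel. genS f (Z x s)\<bar> \<le> K * (t - r)" by (rule integral_Z_bound[OF K]) (use r in auto)
      also have "\<dots> \<le> K * t" using r K0 by (intro mult_left_mono) auto
      finally show "\<bar>genS f (Z x r) * (LINT s:{r..t}|lborel. genS f (Z x s))\<bar> \<le> K * (K * t)"
        unfolding abs_mult by (intro mult_mono K K0) auto
    qed
    have "V x = (LINT r:{0..t}|lborel. (f (Z x t) * genS f (Z x r) - fa (Z x r)) - genS f (Z x r) * (LINT s:{r..t}|lborel. genS f (Z x s)))"
      unfolding V_def fa_def by (rule set_lebesgue_integral_cong) (auto simp: algebra_simps)
    also have "\<dots> = (LINT r:{0..t}|lborel. f (Z x t) * genS f (Z x r) - fa (Z x r)) - (LINT r:{0..t}|lborel. genS f (Z x r) * (LINT s:{r..t}|lborel. genS f (Z x s)))"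
      by (rule set_integral_diff(2)[OF set_integral_diff(1)[OF s1 s2] s3])
    also have "\<dots> = f (Z x t) * A x - FA x - (A x)\<^sup>2 / 2"
      unfolding set_integral_diff(2)[OF s1 s2] A_def FA_def
      using triangle_square[of "genS f" K t x, OF K t] by simp
    finally show ?thesis .
  qed
  have [measurable]: "V \<in> borel_measurable M" unfolding Veq[abs_def] by measurable
  have bI: "integrable M g" if "g \<in> borel_measurable M" "\<And>x. \<bar>g x\<bar> \<le> c" for g :: "'a \<Rightarrow> real" and c
    by (rule integrable_const_bound[of _ c]) (use that in auto)
  have Vb: "\<bar>V x\<bar> \<le> B * (K * t) + (B * K) * t + (K * t)\<^sup>2" for x
  proof -
    have "\<bar>f (Z x t) * A x\<bar> \<le> B * (K * t)" unfolding abs_mult by (intro mult_mono f Ab B0) simp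
    moreover have "(A x)\<^sup>2 \<le> (K * t)\<^sup>2" using power_mono[OF Ab(1) abs_ge_zero, of x 2] by simp
    ultimately show ?thesis unfolding Veq using Ab(3)[of x] zero_le_power2[of "A x"] by linarith
  qed
  \<comment> \<open>The first, third and fourth terms have expectation zero; the second is the integrated carre du champ.\<close>
  have path: "(f (Z x t) - f (Z x 0) - A x)\<^sup>2 = (f2 (Z x t) - f2 (Z x 0) - A2 x) + (A2 x - 2 * FA x)
      - 2 * ((f (Z x t) - f (Z x 0) - A x) * f (Z x 0)) - 2 * V x" for x
    unfolding Veq f2_def by (simp add: power2_eq_square algebra_simps)
  have i1: "integrable M (\<lambda>x. f2 (Z x t) - f2 (Z x 0) - A2 x)"
  proof (rule bI[of _ "2 * B\<^sup>2 + K2 * t"])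
    show "\<bar>f2 (Z x t) - f2 (Z x 0) - A2 x\<bar> \<le> 2 * B\<^sup>2 + K2 * t" for x
      using f2[of "Z x t"] f2[of "Z x 0"] Ab(2)[of x] by linarith
  qed measurable
  have i2: "integrable M (\<lambda>x. A2 x - 2 * FA x)"
  proof (rule bI[of _ "K2 * t + 2 * ((B * K) * t)"])
    show "\<bar>A2 x - 2 * FA x\<bar> \<le> K2 * t + 2 * ((B * K) * t)" for x using Ab(2,3)[of x] by linarith
  qed measurable
  have i3: "integrable M (\<lambda>x. (f (Z x t) - f (Z x 0) - A x) * f (Z x 0))"
  proof (rule bI[of _ "(2 * B + K * t) * B"])
    show "\<bar>(f (Z x t) - f (Z x 0) - A x) * f (Z x 0)\<bar> \<le> (2 * B + K * t) * B" for x
      unfolding abs_mult using f[of "Z x t"] f[of "Z x 0"] Ab(1)[of x] B0 by (intro mult_mono) linarith+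
  qed measurable
  have i4: "integrable M V" by (rule bI[OF _ Vb]) measurable
  have lin: "(\<integral>x. g1 x + g2 x - 2 * g3 x - 2 * g4 x \<partial>M) = (\<integral>x. g1 x \<partial>M) + (\<integral>x. g2 x \<partial>M) - 2 * (\<integral>x. g3 x \<partial>M) - 2 * (\<integral>x. g4 x \<partial>M)"
    if "integrable M g1" "integrable M g2" "integrable M g3" "integrable M g4" for g1 g2 g3 g4 :: "'a \<Rightarrow> real"
    using that by simp
  have e1: "(\<integral>x. f2 (Z x t) - f2 (Z x 0) - A2 x \<partial>M) = 0"
    using martingale[of f2 "B\<^sup>2" "\<lambda>_. 1" 1 0 t] f2 t unfolding A2_def genS_Z by simp
  have e3: "(\<integral>x. (f (Z x t) - f (Z x 0) - A x) * f (Z x 0) \<partial>M) = 0"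
    using martingale[OF f f, of 0 t] t unfolding A_def genS_Z by simp
  have e4: "(\<integral>x. V x \<partial>M) = 0" unfolding V_def by (rule correction_term_zero[OF f t])
  have "(\<integral>x. (f (Z x t) - f (Z x 0) - A x)\<^sup>2 \<partial>M) = (\<integral>x. A2 x - 2 * FA x \<partial>M)"
    unfolding path lin[OF i1 i2 i3 i4] e1 e3 e4 by simp
  also have "\<dots> \<le> (\<integral>x. real n * (lam + 1) * C\<^sup>2 * t \<partial>M)"
  proof (rule integral_mono[OF i2])
    fix x
    have s1: "set_integrable lborel {0..t} (\<lambda>r. genS f2 (Z x r))" by (rule integral_Z_integrable[OF K2])
    have s2: "set_integrable lborel {0..t} (\<lambda>r. 2 * fa (Z x r))"
      by (rule set_integrable_mult_right) (rule integral_Z_integrable[OF fab])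
    have "A2 x - 2 * FA x = (LINT r:{0..t}|lborel. genS f2 (Z x r) - 2 * fa (Z x r))"
      unfolding A2_def FA_def set_integral_diff(2)[OF s1 s2] by simp
    also have "\<dots> \<le> (LINT r:{0..t}|lborel. real n * (lam + 1) * C\<^sup>2)"
    proof (rule set_integral_mono[OF set_integral_diff(1)[OF s1 s2]])
      show "set_integrable lborel {0..t} (\<lambda>r. real n * (lam + 1) * C\<^sup>2)"
        by (rule bounded_set_integrable[where B="\<bar>real n * (lam + 1) * C\<^sup>2\<bar>"]) auto
      show "genS f2 (Z x r) - 2 * fa (Z x r) \<le> real n * (lam + 1) * C\<^sup>2" for r
        using genN_carre_du_champ[OF Z_Sn lam q f up dn, of x r]
        unfolding fa_def f2_def genS_Z by (simp add: mult.assoc)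
    qed
    also have "\<dots> = real n * (lam + 1) * C\<^sup>2 * t" using t by (subst set_integral_const) auto
    finally show "A2 x - 2 * FA x \<le> real n * (lam + 1) * C\<^sup>2 * t" .
  qed simp
  finally show ?thesis unfolding A_def genS_Z by (simp add: prob_space)
qed

text \<open>The inequality \<open>|D| / c \<le> D^2 / n + 1\<close> with \<open>c = sqrt n\<close>
  takes the place of Cauchy-Schwarz: as the second moment is of order \<open>n\<close>, dividing
  once more by \<open>c\<close> leaves both terms of order \<open>1 / sqrt n\<close>.\<close>

lemma scaled_martingale_L1:
  fixes f :: "_ \<Rightarrow> real"
  assumes f: "\<And>m. \<bar>f m\<bar> \<le> B" and t: "0 \<le> t"
    and up: "\<And>m j. \<bar>f (m(Suc j := Suc (m (Suc j)))) - f m\<bar> \<le> C"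
    and dn: "\<And>m j. \<bar>f (m(Suc j := m (Suc j) - 1)) - f m\<bar> \<le> C"
  shows "integrable M (\<lambda>x. \<bar>(f (Z x t) - f (Z x 0) - (LINT r:{0..t}|lborel. genN lam q n f (Z x r))) / real n\<bar>)"
    "(\<integral>x. \<bar>(f (Z x t) - f (Z x 0) - (LINT r:{0..t}|lborel. genN lam q n f (Z x r))) / real n\<bar> \<partial>M)
       \<le> (1 + (lam + 1) * C\<^sup>2 * t) / sqrt (real n)"
proof -
  define K where "K = real n * (lam + 1) * (2 * B)"
  have K: "\<bar>genS f m\<bar> \<le> K" for m unfolding K_def by (rule genS_bound[OF f])
  define D where "D x = f (Z x t) - f (Z x 0) - (LINT r:{0..t}|lborel. genN lam q n f (Z x r))" for x
  have [measurable]: "D \<in> borel_measurable M"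
    unfolding D_def genS_Z by (intro borel_measurable_diff Z_measurable integral_Z_measurable)
  have Db: "\<bar>D x\<bar> \<le> 2 * B + K * t" for x
    using f[of "Z x t"] f[of "Z x 0"] integral_Z_bound[of "genS f" K 0 t x, OF K t] unfolding D_def genS_Z diff_zero by linarith
  have iD: "integrable M D" by (rule integrable_const_bound[of _ "2 * B + K * t"]) (use Db in auto)
  have iD2: "integrable M (\<lambda>x. (D x)\<^sup>2)"
  proof (rule integrable_const_bound[of _ "(2 * B + K * t)\<^sup>2"])
    show "AE x in M. norm ((D x)\<^sup>2) \<le> (2 * B + K * t)\<^sup>2"
      using power_mono[OF Db abs_ge_zero, of _ 2] by simp
  qed measurable
  show i: "integrable M (\<lambda>x. \<bar>D x / real n\<bar>)" using iD by simp
  define c where "c = sqrt (real n)"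
  have c: "0 < c" "c * c = real n" using n by (auto simp: c_def)
  have amgm: "\<bar>D x / real n\<bar> \<le> 1 / c + (D x)\<^sup>2 / (real n * c)" for x
  proof -
    have "0 \<le> (\<bar>D x\<bar> / c - 1)\<^sup>2" by simp
    also have "\<dots> = (D x)\<^sup>2 / (c * c) - 2 * (\<bar>D x\<bar> / c) + 1"
      by (simp add: power2_eq_square algebra_simps)
    finally have "2 * (\<bar>D x\<bar> / c) \<le> (D x)\<^sup>2 / real n + 1" using c by simp
    moreover have "0 \<le> \<bar>D x\<bar> / c" using c by simp
    ultimately have "\<bar>D x\<bar> / c \<le> (D x)\<^sup>2 / real n + 1" by linarith
    then have "\<bar>D x\<bar> / c / c \<le> ((D x)\<^sup>2 / real n + 1) / c" using c by (intro divide_right_mono) auto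
    then show ?thesis using c n by (simp add: add_divide_distrib abs_divide divide_divide_eq_left)
  qed
  have "(\<integral>x. \<bar>D x / real n\<bar> \<partial>M) \<le> (\<integral>x. 1 / c + (D x)\<^sup>2 / (real n * c) \<partial>M)"
    by (rule integral_mono[OF i _ amgm]) (use iD2 in simp)
  also have "\<dots> = 1 / c + (\<integral>x. (D x)\<^sup>2 \<partial>M) / (real n * c)"
    using iD2 by (simp add: prob_space)
  also have "\<dots> \<le> 1 / c + (real n * (lam + 1) * C\<^sup>2 * t) / (real n * c)"
    using second_moment[OF f t up dn] c n unfolding D_def by (intro add_left_mono divide_right_mono) auto
  also have "\<dots> = (1 + (lam + 1) * C\<^sup>2 * t) / c" using n c by (simp add: add_divide_distrib)
  finally show "(\<integral>x. \<bar>D x / real n\<bar> \<partial>M) \<le> (1 + (lam + 1) * C\<^sup>2 * t) / sqrt (real n)" unfolding c_def .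
qed

end

section \<open>Continuous functionals of paths and occupation measures\<close>

lemma Uset_range: "u \<in> Uset \<Longrightarrow> 0 \<le> u k \<and> u k \<le> 1"
proof -
  assume u: "u \<in> Uset"
  have "u k \<le> u 0" by (rule lift_Suc_antimono_le[of u]) (use u in \<open>auto simp: Uset_def\<close>)
  then show ?thesis using u by (auto simp: Uset_def)
qed

lemma Uset_diff_le: "u \<in> Uset \<Longrightarrow> u' \<in> Uset \<Longrightarrow> \<bar>u k - u' k\<bar> \<le> 1"
  using Uset_range[of u k] Uset_range[of u' k] by linarith

lemma Uset_ratio_le:
  assumes "u \<in> Uset" "u' \<in> Uset" "1 \<le> k"
  shows "\<bar>u k - u' k\<bar> / real k \<le> 1"
proof -
  have "\<bar>u k - u' k\<bar> \<le> real k" using Uset_diff_le[OF assms(1,2), of k] assms(3) by linarith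
  then show ?thesis using assms(3) by (simp add: divide_le_eq)
qed

lemma rhoU_coordinate:
  assumes "u \<in> Uset" "u' \<in> Uset"
  shows "\<bar>u k - u' k\<bar> \<le> real k * rhoU u u'"
proof (cases "k = 0")
  case True
  then show ?thesis using assms by (simp add: Uset_def)
next
  case False
  have "\<bar>u k - u' k\<bar> / real k \<le> rhoU u u'"
    unfolding rhoU_def
    by (rule cSUP_upper) (use False Uset_ratio_le[OF assms] in \<open>auto intro!: bdd_aboveI[of _ 1]\<close>)
  then show ?thesis using False by (simp add: divide_le_eq mult.commute)
qed

lemma rhoU_le_1:
  assumes "u \<in> Uset" "u' \<in> Uset"
  shows "rhoU u u' \<le> 1"
  unfolding rhoU_def by (rule cSUP_least) (use Uset_ratio_le[OF assms] in auto)

lemma Dsp_Uset: "x \<in> Dsp \<Longrightarrow> 0 \<le> t \<Longrightarrow> x t \<in> Uset"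
  by (simp add: Dsp_def)

lemma Dsp_range: "x \<in> Dsp \<Longrightarrow> 0 \<le> t \<Longrightarrow> 0 \<le> x t k \<and> x t k \<le> 1"
  by (rule Uset_range[OF Dsp_Uset])

lemma rhoU_tendsto_coordinate:
  assumes "((\<lambda>s. rhoU (x s) y) \<longlongrightarrow> 0) F" "\<forall>\<^sub>F s in F. x s \<in> Uset" "y \<in> Uset"
  shows "((\<lambda>s. x s k) \<longlongrightarrow> y k) F"
proof (rule Lim_transform)
  show "((\<lambda>s. y k) \<longlongrightarrow> y k) F" by simp
  have "((\<lambda>s. real k * rhoU (x s) y) \<longlongrightarrow> real k * 0) F" by (intro tendsto_intros assms)
  then have l: "((\<lambda>s. real k * rhoU (x s) y) \<longlongrightarrow> 0) F" by simp
  show "((\<lambda>s. x s k - y k) \<longlongrightarrow> 0) F"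
  proof (rule Lim_null_comparison[OF _ l])
    show "\<forall>\<^sub>F s in F. norm (x s k - y k) \<le> real k * rhoU (x s) y"
      using assms(2)
    proof eventually_elim
      case (elim s)
      from rhoU_coordinate[OF this assms(3), of k] show ?case by simp
    qed
  qed
qed

lemma Dsp_right_continuous:
  assumes "x \<in> Dsp" "0 \<le> t"
  shows "((\<lambda>s. x s k) \<longlongrightarrow> x t k) (at_right t)"
proof (rule rhoU_tendsto_coordinate)
  show "((\<lambda>s. rhoU (x s) (x t)) \<longlongrightarrow> 0) (at_right t)" using assms by (simp add: Dsp_def)
  show "\<forall>\<^sub>F s in at_right t. x s \<in> Uset"
    unfolding eventually_at_right_field using assms Dsp_Uset[OF assms(1)] by (intro exI[of _ "t + 1"]) auto
qed (rule Dsp_Uset[OF assms])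

lemma Dsp_left_limit:
  assumes "x \<in> Dsp" "0 < t"
  shows "\<exists>l. ((\<lambda>s. x s k) \<longlongrightarrow> l) (at_left t)"
proof -
  obtain y where y: "y \<in> Uset" "((\<lambda>s. rhoU (x s) y) \<longlongrightarrow> 0) (at_left t)"
    using assms by (auto simp: Dsp_def)
  have "((\<lambda>s. x s k) \<longlongrightarrow> y k) (at_left t)"
  proof (rule rhoU_tendsto_coordinate[OF y(2) _ y(1)])
    show "\<forall>\<^sub>F s in at_left t. x s \<in> Uset"
      unfolding eventually_at_left_field using assms Dsp_Uset[OF assms(1)] by (intro exI[of _ 0]) auto
  qed
  then show ?thesis by blast
qed

lemma Dsp_measurable:
  assumes "x \<in> Dsp"
  shows "(\<lambda>s. x (max 0 s) k) \<in> borel_measurable borel"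
  by (rule right_continuous_measurable[of "\<lambda>s. x s k"]) (rule Dsp_right_continuous[OF assms])

section \<open>Time changes and J1 convergence\<close>

lemma LambdaJ_zero: "l \<in> LambdaJ \<Longrightarrow> l 0 = 0"
proof -
  assume l: "l \<in> LambdaJ"
  then have im: "l ` {0..} = {0..}" and sm: "strict_mono_on {0..} l" by (auto simp: LambdaJ_def)
  have "0 \<in> l ` {0..}" using im by simp
  then obtain s where s: "0 \<le> s" "l s = 0" by auto
  have "0 \<le> l 0" using im by auto
  moreover have "l 0 < l s" if "0 < s" using sm that by (auto simp: strict_mono_on_def)
  ultimately show "l 0 = 0" using s by (cases "s = 0") auto
qed

text \<open>The chord from \<open>0\<close> to \<open>s\<close> is one of the slopes in the supremum
  \<open>gammaJ l\<close>, so \<open>l s / s\<close> lies between \<open>exp (- gammaJ l)\<close>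
  and \<open>exp (gammaJ l)\<close>. Time changes with \<open>gammaJ\<close> tending to 0 therefore
  converge to the identity at each time.\<close>

lemma LambdaJ_bounds:
  assumes l: "l \<in> LambdaJ" and s: "0 \<le> s"
  shows "0 \<le> l s" "s * exp (- gammaJ l) \<le> l s" "l s \<le> s * exp (gammaJ l)"
proof -
  have sm: "strict_mono_on {0..} l" and bd: "bdd_above {\<bar>ln ((l s - l t) / (s - t))\<bar> | s t. 0 \<le> t \<and> t < s}"
    using l by (auto simp: LambdaJ_def)
  show "0 \<le> l s" using l s by (auto simp: LambdaJ_def)
  have "s * exp (- gammaJ l) \<le> l s \<and> l s \<le> s * exp (gammaJ l)"
  proof (cases "s = 0")
    case True
    then show ?thesis using LambdaJ_zero[OF l] by simp
  next
    case False
    then have s0: "0 < s" using s by simp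
    then have "l 0 < l s" using sm by (auto simp: strict_mono_on_def)
    then have ls: "0 < l s" using LambdaJ_zero[OF l] by simp
    have "\<bar>ln ((l s - l 0) / (s - 0))\<bar> \<le> gammaJ l"
      unfolding gammaJ_def by (rule cSup_upper[OF _ bd]) (use s0 in blast)
    then have "- gammaJ l \<le> ln (l s / s)" "ln (l s / s) \<le> gammaJ l" using LambdaJ_zero[OF l] by (auto simp: abs_le_iff)
    then have "exp (- gammaJ l) \<le> l s / s" "l s / s \<le> exp (gammaJ l)"
      using ls s0 by (simp_all add: ln_ge_iff[symmetric] ln_le_cancel_iff[symmetric] del: ln_le_cancel_iff)
    then show ?thesis using s0 by (simp add: field_simps)
  qed
  then show "s * exp (- gammaJ l) \<le> l s" "l s \<le> s * exp (gammaJ l)" by auto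
qed

text \<open>Uniform closeness compares \<open>xs m s\<close> with \<open>x (ls m s)\<close>, and
  continuity of the limit at \<open>s\<close> compares this with \<open>x s\<close>. At
  \<open>s = 0\<close> no continuity is asked because every time change fixes 0.\<close>

lemma J1conv_pointwise:
  assumes J: "J1conv xs x" and xs: "\<And>m. xs m \<in> Dsp" and x: "x \<in> Dsp" and s: "0 \<le> s"
    and c: "s = 0 \<or> ((\<lambda>s. x s k) \<longlongrightarrow> x s k) (at_left s)"
  shows "(\<lambda>m. xs m s k) \<longlonglongrightarrow> x s k"
proof -
  obtain ls where ls: "\<And>m. ls m \<in> LambdaJ" and \<gamma>: "(\<lambda>m. gammaJ (ls m)) \<longlonglongrightarrow> 0"
    and unif: "\<And>T. T > 0 \<Longrightarrow> (\<lambda>m. SUP t\<in>{0..T}. rhoU (xs m t) (x (ls m t))) \<longlonglongrightarrow> 0"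
    using J unfolding J1conv_def by blast
  have ls0: "0 \<le> ls m t" if "0 \<le> t" for m t using LambdaJ_bounds(1)[OF ls that] .
  have "(\<lambda>m. xs m s k - x (ls m s) k) \<longlonglongrightarrow> 0"
  proof (rule Lim_null_comparison)
    \<comment> \<open>The horizon \<open>s + 1\<close> contains \<open>s\<close> and is positive
      also for \<open>s = 0\<close>.\<close>
    have "(\<lambda>m. real k * (SUP t\<in>{0..s + 1}. rhoU (xs m t) (x (ls m t)))) \<longlonglongrightarrow> real k * 0"
      by (intro tendsto_intros unif) (use s in simp)
    then show "(\<lambda>m. real k * (SUP t\<in>{0..s + 1}. rhoU (xs m t) (x (ls m t)))) \<longlonglongrightarrow> 0" by simp
    show "\<forall>\<^sub>F m in sequentially. norm (xs m s k - x (ls m s) k) \<le> real k * (SUP t\<in>{0..s + 1}. rhoU (xs m t) (x (ls m t)))"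
    proof (intro always_eventually allI)
      fix m
      have "\<bar>xs m s k - x (ls m s) k\<bar> \<le> real k * rhoU (xs m s) (x (ls m s))"
        by (rule rhoU_coordinate[OF Dsp_Uset[OF xs s] Dsp_Uset[OF x ls0[OF s]]])
      also have "rhoU (xs m s) (x (ls m s)) \<le> (SUP t\<in>{0..s + 1}. rhoU (xs m t) (x (ls m t)))"
      proof (rule cSUP_upper)
        show "bdd_above ((\<lambda>t. rhoU (xs m t) (x (ls m t))) ` {0..s + 1})"
          by (rule bdd_aboveI[of _ 1]) (auto intro!: rhoU_le_1 Dsp_Uset xs x ls0)
      qed (use s in simp)
      finally show "norm (xs m s k - x (ls m s) k) \<le> real k * (SUP t\<in>{0..s + 1}. rhoU (xs m t) (x (ls m t)))"
        by (simp add: mult_left_mono)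
    qed
  qed
  moreover have "(\<lambda>m. x (ls m s) k) \<longlonglongrightarrow> x s k"
  proof (cases "s = 0")
    case True
    then show ?thesis using LambdaJ_zero[OF ls] by simp
  next
    case False
    have "isCont (\<lambda>s. x s k) s"
      using c False Dsp_right_continuous[OF x s, of k] unfolding isCont_def by (simp add: filterlim_at_split)
    moreover have "(\<lambda>m. ls m s) \<longlonglongrightarrow> s"
    proof (rule real_tendsto_sandwich)
      have "(\<lambda>m. s * exp (- gammaJ (ls m))) \<longlonglongrightarrow> s * exp (- 0)" by (intro tendsto_intros \<gamma>)
      then show "(\<lambda>m. s * exp (- gammaJ (ls m))) \<longlonglongrightarrow> s" by simp
      have "(\<lambda>m. s * exp (gammaJ (ls m))) \<longlonglongrightarrow> s * exp 0" by (intro tendsto_intros \<gamma>)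
      then show "(\<lambda>m. s * exp (gammaJ (ls m))) \<longlonglongrightarrow> s" by simp
    qed (use LambdaJ_bounds(2,3)[OF ls s] in auto)
    ultimately show ?thesis by (rule isCont_tendsto_compose)
  qed
  ultimately have "(\<lambda>m. (xs m s k - x (ls m s) k) + x (ls m s) k) \<longlonglongrightarrow> 0 + x s k" by (rule tendsto_add)
  then show ?thesis by simp
qed

text \<open>J1 convergence is pointwise off the jumps of the limit, and these are countable, hence
  null. Integration over time thus restores the continuity that evaluation lacks.\<close>

lemma J1conv_L1:
  assumes J: "J1conv xs x" and xs: "\<And>m. xs m \<in> Dsp" and x: "x \<in> Dsp"
  shows "(\<lambda>m. LINT s:{0..t}|lborel. \<bar>xs m (max 0 s) k - x (max 0 s) k\<bar>) \<longlonglongrightarrow> 0"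
proof -
  let ?D = "{s. 0 < s \<and> \<not> ((\<lambda>s. x s k) \<longlongrightarrow> x s k) (at_left s)}"
  have "countable ?D" by (rule countable_left_discontinuities) (rule Dsp_left_limit[OF x])
  then have D0: "?D \<in> null_sets lborel" by (rule countable_imp_null_set_lborel)
  have [measurable]: "(\<lambda>s. xs m (max 0 s) k) \<in> borel_measurable borel" "(\<lambda>s. x (max 0 s) k) \<in> borel_measurable borel" for m
    by (rule Dsp_measurable[OF xs], rule Dsp_measurable[OF x])
  have "(\<lambda>m. LINT s|lborel. indicator {0..t} s *\<^sub>R \<bar>xs m (max 0 s) k - x (max 0 s) k\<bar>) \<longlonglongrightarrow> (LINT s|(lborel :: real measure). 0)"
  proof (rule integral_dominated_convergence[where w="\<lambda>s. indicator {0..t} s *\<^sub>R 1"])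
    show "integrable lborel (\<lambda>s. indicator {0..t} s *\<^sub>R (1 :: real))"
      using bounded_set_integrable[of "\<lambda>_. 1" 0 t 1] by (simp add: set_integrable_def)
    show "AE s in lborel. norm (indicator {0..t} s *\<^sub>R \<bar>xs m (max 0 s) k - x (max 0 s) k\<bar>) \<le> indicator {0..t} s *\<^sub>R 1" for m
      using Uset_diff_le[OF Dsp_Uset[OF xs] Dsp_Uset[OF x]] by (auto simp: indicator_def)
    show "AE s in lborel. (\<lambda>m. indicator {0..t} s *\<^sub>R \<bar>xs m (max 0 s) k - x (max 0 s) k\<bar>) \<longlonglongrightarrow> 0"
      using AE_not_in[OF D0]
    proof eventually_elim
      case (elim s)
      have "(\<lambda>m. xs m (max 0 s) k) \<longlonglongrightarrow> x (max 0 s) k"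
        by (rule J1conv_pointwise[OF J xs x]) (use elim in \<open>auto simp: max_def\<close>)
      then have "(\<lambda>m. indicator {0..t} s *\<^sub>R \<bar>xs m (max 0 s) k - x (max 0 s) k\<bar>) \<longlonglongrightarrow> indicator {0..t} s *\<^sub>R \<bar>x (max 0 s) k - x (max 0 s) k\<bar>"
        by (intro tendsto_intros)
      then show ?case by simp
    qed
  qed auto
  then show ?thesis by (simp add: set_lebesgue_integral_def)
qed

section \<open>Measures with Lebesgue time marginal\<close>

abbreviation strip :: "real \<Rightarrow> (real \<times> (nat \<Rightarrow> enat)) set" where
  "strip t \<equiv> {0..<t} \<times> OmegaS"

lemma strip_sets: "\<mu> \<in> Lset \<Longrightarrow> A \<in> sets borel \<Longrightarrow> A \<times> B \<in> sets \<mu>"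
  by (auto simp: Lset_def SpaceL_def intro!: pair_measureI)

lemma Lset_measurable_cong: "\<mu> \<in> Lset \<Longrightarrow> borel_measurable \<mu> = borel_measurable SpaceL"
  by (rule measurable_cong_sets) (auto simp: Lset_def)

lemma fst_measurable_Lset: "\<mu> \<in> Lset \<Longrightarrow> fst \<in> \<mu> \<rightarrow>\<^sub>M borel"
  by (subst measurable_cong_sets[of _ SpaceL _ borel]) (auto simp: Lset_def SpaceL_def)

lemma snd_measurable_SpaceL: "(\<lambda>z. g (snd z)) \<in> borel_measurable SpaceL" for g :: "_ \<Rightarrow> real"
  unfolding SpaceL_def by (rule measurable_compose[OF measurable_snd]) simp

lemma Lset_space: "\<mu> \<in> Lset \<Longrightarrow> space \<mu> = UNIV"
  using sets_eq_imp_space_eq[of \<mu> SpaceL] by (auto simp: Lset_def SpaceL_def space_pair_measure)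

text \<open>The half-lines \<open>{..<c}\<close> generate the Borel sets and are stable under
  intersection, and the masses prescribed in \<open>Lset\<close> are those of Lebesgue measure. The
  densities are restrictions to nonnegative times.\<close>

lemma Lset_time_marginal:
  assumes \<mu>: "\<mu> \<in> Lset"
  shows "distr (density \<mu> (indicator ({0..} \<times> OmegaS))) borel fst = density lborel (indicator {0..})"
    (is "?\<nu> = ?\<kappa>")
proof (rule measure_eqI_generator_eq[where E="range lessThan" and \<Omega>=UNIV and A="\<lambda>i. {..<real i}"])
  have S[measurable]: "{0..} \<times> OmegaS \<in> sets \<mu>" by (rule strip_sets[OF \<mu>]) simp
  have f[measurable]: "fst \<in> \<mu> \<rightarrow>\<^sub>M borel" by (rule fst_measurable_Lset[OF \<mu>])
  have L: "emeasure ?\<nu> {..<c} = emeasure \<mu> (strip c)" for c :: real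
  proof -
    have v: "fst -` {..<c} \<inter> space \<mu> \<in> sets \<mu>" by measurable
    have "emeasure ?\<nu> {..<c} = emeasure (density \<mu> (indicator ({0..} \<times> OmegaS))) (fst -` {..<c} \<inter> space \<mu>)"
      by (subst emeasure_distr) auto
    also have "\<dots> = (\<integral>\<^sup>+z. indicator ({0..} \<times> OmegaS) z * indicator (fst -` {..<c} \<inter> space \<mu>) z \<partial>\<mu>)"
      by (rule emeasure_density) (use v in auto)
    also have "\<dots> = (\<integral>\<^sup>+z. indicator (strip c) z \<partial>\<mu>)"
      by (rule nn_integral_cong) (auto simp: indicator_def Lset_space[OF \<mu>])
    also have "\<dots> = emeasure \<mu> (strip c)" by (rule nn_integral_indicator) (rule strip_sets[OF \<mu>], simp)
    finally show ?thesis .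
  qed
  have R: "emeasure ?\<kappa> {..<c} = (if c \<le> 0 then 0 else ennreal c)" for c :: real
  proof -
    have "emeasure ?\<kappa> {..<c} = (\<integral>\<^sup>+s. indicator {0..} s * indicator {..<c} s \<partial>lborel)"
      by (rule emeasure_density) auto
    also have "\<dots> = (\<integral>\<^sup>+s. indicator {0..<c} s \<partial>lborel)"
      by (rule nn_integral_cong) (auto simp: indicator_def)
    also have "\<dots> = (if c \<le> 0 then 0 else ennreal c)" by (cases "c \<le> 0") auto
    finally show ?thesis .
  qed
  have Lc: "emeasure \<mu> (strip c) = (if c \<le> 0 then 0 else ennreal c)" for c
    using \<mu> by (auto simp: Lset_def)
  show "Int_stable (range (lessThan :: real \<Rightarrow> real set))"
  proof -
    have "{..<a} \<inter> {..<b} = {..<min a b}" for a b :: real by auto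
    then show ?thesis by (auto simp: Int_stable_def)
  qed
  show "emeasure ?\<nu> X = emeasure ?\<kappa> X" if "X \<in> range lessThan" for X
    using that L R Lc by auto
  show "sets ?\<nu> = sigma_sets UNIV (range lessThan)" "sets ?\<kappa> = sigma_sets UNIV (range lessThan)"
    by (simp_all add: borel_Iio)
  show "emeasure ?\<nu> {..<real i} \<noteq> \<infinity>" for i using L Lc by auto
  show "(\<Union>i. {..<real i}) = UNIV" using reals_Archimedean2 by auto
qed auto

lemma Lset_nn_integral_time:
  assumes \<mu>: "\<mu> \<in> Lset" and h[measurable]: "h \<in> borel_measurable borel"
  shows "(\<integral>\<^sup>+z. h (fst z) * indicator (strip t) z \<partial>\<mu>) = (\<integral>\<^sup>+s. h s * indicator {0..<t} s \<partial>lborel)"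
proof -
  have S[measurable]: "{0..} \<times> OmegaS \<in> sets \<mu>" by (rule strip_sets[OF \<mu>]) simp
  have f[measurable]: "fst \<in> \<mu> \<rightarrow>\<^sub>M borel" by (rule fst_measurable_Lset[OF \<mu>])
  have "(\<integral>\<^sup>+z. h (fst z) * indicator (strip t) z \<partial>\<mu>) = (\<integral>\<^sup>+z. indicator ({0..} \<times> OmegaS) z * (h (fst z) * indicator {..<t} (fst z)) \<partial>\<mu>)"
    by (rule nn_integral_cong) (auto simp: indicator_def)
  also have "\<dots> = (\<integral>\<^sup>+z. h (fst z) * indicator {..<t} (fst z) \<partial>density \<mu> (indicator ({0..} \<times> OmegaS)))"
    by (rule nn_integral_density[symmetric]) auto
  also have "\<dots> = (\<integral>\<^sup>+s. h s * indicator {..<t} s \<partial>distr (density \<mu> (indicator ({0..} \<times> OmegaS))) borel fst)"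
    by (rule nn_integral_distr[symmetric]) auto
  also have "\<dots> = (\<integral>\<^sup>+s. indicator {0..} s * (h s * indicator {..<t} s) \<partial>lborel)"
    unfolding Lset_time_marginal[OF \<mu>] by (rule nn_integral_density) auto
  also have "\<dots> = (\<integral>\<^sup>+s. h s * indicator {0..<t} s \<partial>lborel)"
    by (rule nn_integral_cong) (auto simp: indicator_def)
  finally show ?thesis .
qed

lemma strip_integrable:
  fixes h :: "_ \<Rightarrow> real"
  assumes \<mu>: "\<mu> \<in> Lset" and h: "h \<in> borel_measurable SpaceL" and B: "\<And>z. z \<in> strip t \<Longrightarrow> \<bar>h z\<bar> \<le> B"
  shows "set_integrable \<mu> (strip t) h"
  unfolding set_integrable_def
proof (rule integrableI_bounded_set_indicator[where B=B])
  show "strip t \<in> sets \<mu>" by (rule strip_sets[OF \<mu>]) simp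
  show "h \<in> borel_measurable \<mu>" unfolding Lset_measurable_cong[OF \<mu>] by (rule h)
  show "emeasure \<mu> (strip t) < \<infinity>" using \<mu> by (cases "t \<le> 0") (auto simp: Lset_def)
qed (use B in auto)

text \<open>The bound depends on \<open>\<mu>\<close> only through its time marginal, so it is
  uniform over \<open>Lset\<close>. This uniformity is what allows the path to be exchanged under a
  moving measure.\<close>

lemma strip_integral_bound:
  fixes h :: "_ \<Rightarrow> real" and b :: "real \<Rightarrow> real"
  assumes \<mu>: "\<mu> \<in> Lset" and h: "h \<in> borel_measurable SpaceL" and b[measurable]: "b \<in> borel_measurable borel"
    and hb: "\<And>z. z \<in> strip t \<Longrightarrow> \<bar>h z\<bar> \<le> b (fst z)" and B: "\<And>s. s \<in> {0..t} \<Longrightarrow> \<bar>b s\<bar> \<le> B"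
    and b0: "\<And>s. 0 \<le> b s"
  shows "\<bar>LINT z:strip t|\<mu>. h z\<bar> \<le> (LINT s:{0..t}|lborel. b s)"
proof -
  have i: "set_integrable \<mu> (strip t) h"
  proof (rule strip_integrable[OF \<mu> h, of t B])
    fix z assume z: "z \<in> strip t"
    then have "\<bar>b (fst z)\<bar> \<le> B" by (intro B) auto
    then show "\<bar>h z\<bar> \<le> B" using hb[OF z] by linarith
  qed
  have ib: "integrable lborel (\<lambda>s. indicator {0..t} s *\<^sub>R b s)"
    using bounded_set_integrable[OF b B] by (simp add: set_integrable_def)
  have "ennreal \<bar>LINT z:strip t|\<mu>. h z\<bar> \<le> (\<integral>\<^sup>+z. ennreal (norm (indicator (strip t) z *\<^sub>R h z)) \<partial>\<mu>)"
    using integral_norm_bound_ennreal[OF i[unfolded set_integrable_def]] by (simp add: set_lebesgue_integral_def)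
  also have "\<dots> \<le> (\<integral>\<^sup>+z. ennreal (b (fst z)) * indicator (strip t) z \<partial>\<mu>)"
    by (rule nn_integral_mono) (use hb in \<open>auto simp: indicator_def intro!: ennreal_leI\<close>)
  also have "\<dots> = (\<integral>\<^sup>+s. ennreal (b s) * indicator {0..<t} s \<partial>lborel)"
    by (rule Lset_nn_integral_time[OF \<mu>]) measurable
  also have "\<dots> \<le> (\<integral>\<^sup>+s. ennreal (indicator {0..t} s *\<^sub>R b s) \<partial>lborel)"
    by (rule nn_integral_mono) (auto simp: indicator_def)
  also have "\<dots> = ennreal (LINT s:{0..t}|lborel. b s)"
    unfolding set_lebesgue_integral_def by (rule nn_integral_eq_integral[OF ib]) (use b0 in auto)
  finally show ?thesis
    by (subst (asm) ennreal_le_iff) (use b0 in \<open>auto simp: set_lebesgue_integral_def intro!: integral_nonneg\<close>)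
qed

section \<open>Continuity on the space of fast variables\<close>

definition contO :: "((nat \<Rightarrow> enat) \<Rightarrow> real) \<Rightarrow> bool" where
  "contO g \<longleftrightarrow> (\<forall>ws w. (\<forall>i. ws i \<in> OmegaS) \<longrightarrow> w \<in> OmegaS \<longrightarrow> (\<lambda>i. rhoO (ws i) w) \<longlonglongrightarrow> 0 \<longrightarrow> (\<lambda>i. g (ws i)) \<longlonglongrightarrow> g w)"

lemma contO_const: "contO (\<lambda>_. c)" by (simp add: contO_def)
lemma contO_diff: "contO f \<Longrightarrow> contO g \<Longrightarrow> contO (\<lambda>w. f w - g w)" by (auto simp: contO_def intro!: tendsto_diff)
lemma contO_mult: "contO f \<Longrightarrow> contO g \<Longrightarrow> contO (\<lambda>w. f w * g w)" by (auto simp: contO_def intro!: tendsto_mult)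
lemma contO_sum: "(\<And>j. j \<in> J \<Longrightarrow> contO (f j)) \<Longrightarrow> contO (\<lambda>w. \<Sum>j\<in>J. f j w)"
  by (auto simp: contO_def intro!: tendsto_sum)

lemma hO_range: "0 \<le> hO e \<and> hO e \<le> 1"
  by (cases e) (auto simp: hO_def)

text \<open>Under \<open>hO\<close> every finite value becomes an isolated point and infinity
  becomes their limit 0. Convergence of a coordinate therefore means eventual equality at a finite
  limit and eventual excess over any \<open>N\<close> at infinity; truncation at \<open>N\<close>
  covers both cases.\<close>

lemma rhoO_tendsto_min:
  assumes ws: "\<And>i. ws i \<in> OmegaS" and w: "w \<in> OmegaS" and l: "(\<lambda>i. rhoO (ws i) w) \<longlonglongrightarrow> 0"
  shows "\<forall>\<^sub>F i in sequentially. min (ws i k) (enat N) = min (w k) (enat N)"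
proof (cases "k = 0")
  case True
  then show ?thesis using ws w by (simp add: OmegaS_def)
next
  case False
  have h: "(\<lambda>i. hO (ws i k)) \<longlonglongrightarrow> hO (w k)"
  proof (rule Lim_transform)
    show "(\<lambda>i. hO (w k)) \<longlonglongrightarrow> hO (w k)" by simp
    have "(\<lambda>i. real k * rhoO (ws i) w) \<longlonglongrightarrow> real k * 0" by (intro tendsto_intros l)
    then have l': "(\<lambda>i. real k * rhoO (ws i) w) \<longlonglongrightarrow> 0" by simp
    show "(\<lambda>i. hO (ws i k) - hO (w k)) \<longlonglongrightarrow> 0"
    proof (rule Lim_null_comparison[OF always_eventually l'], rule allI)
      fix i
      have "\<bar>hO (ws i k) - hO (w k)\<bar> / real k \<le> rhoO (ws i) w"
        unfolding rhoO_def
      proof (rule cSUP_upper)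
        show "bdd_above ((\<lambda>k. \<bar>hO (ws i k) - hO (w k)\<bar> / real k) ` {1..})"
        proof (rule bdd_aboveI2[where M=1])
          fix k :: nat assume "k \<in> {1..}"
          have "\<bar>hO (ws i k) - hO (w k)\<bar> \<le> 1" using hO_range[of "ws i k"] hO_range[of "w k"] by linarith
          also have "1 \<le> real k" using \<open>k \<in> {1..}\<close> by simp
          finally show "\<bar>hO (ws i k) - hO (w k)\<bar> / real k \<le> 1"
            using \<open>k \<in> {1..}\<close> by (simp add: divide_le_eq)
        qed
      qed (use False in simp)
      then show "norm (hO (ws i k) - hO (w k)) \<le> real k * rhoO (ws i) w"
        using False by (simp add: divide_le_eq mult.commute)
    qed
  qed
  show ?thesis
  proof (cases "w k")
    case (enat c)
    \<comment> \<open>The neighbours of \<open>1 / (1 + c)\<close> in the range of \<open>hO\<close>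
      are \<open>1 / (2 + c)\<close> and \<open>1 / c\<close>; for \<open>c = 0\<close> there is no
      neighbour above.\<close>
    then have hw: "hO (w k) = 1 / (1 + real c)" by (simp add: hO_def)
    have "\<forall>\<^sub>F i in sequentially. 1 / (2 + real c) < hO (ws i k)"
      by (rule order_tendstoD(1)[OF h]) (simp add: hw field_simps)
    moreover have "\<forall>\<^sub>F i in sequentially. c = 0 \<or> hO (ws i k) < 1 / real c"
    proof (cases "c = 0")
      case False
      have "\<forall>\<^sub>F i in sequentially. hO (ws i k) < 1 / real c"
        by (rule order_tendstoD(2)[OF h]) (use False in \<open>simp add: hw field_simps\<close>)
      then show ?thesis by eventually_elim simp
    qed simp
    ultimately show ?thesis
    proof eventually_elim
      case (elim i)
      obtain d where d: "ws i k = enat d"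
        using elim(1) by (cases "ws i k") (auto simp: hO_def divide_simps)
      have "real d < 1 + real c" using elim(1) d by (simp add: hO_def field_simps)
      moreover have "c = 0 \<or> real c < 1 + real d" using elim(2) d by (auto simp: hO_def field_simps)
      ultimately have "d = c" by linarith
      then show ?case using d enat by simp
    qed
  next
    case infinity
    then have "hO (w k) = 0" by (simp add: hO_def)
    then have "\<forall>\<^sub>F i in sequentially. hO (ws i k) < 1 / (1 + real N)"
      by (intro order_tendstoD(2)[OF h]) simp
    then show ?thesis
    proof eventually_elim
      case (elim i)
      show ?case
      proof (cases "ws i k")
        case (enat d)
        then have "real N < real d" using elim by (simp add: hO_def field_simps)
        then show ?thesis using enat infinity by (simp add: min_def)
      qed (use infinity in simp)
    qed
  qed
qed

text \<open>Finitely many truncated coordinates are simultaneously constant from some index on along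
  a convergent sequence.\<close>

lemma contO_cylinder:
  assumes g: "\<And>w w'. (\<And>i. i \<in> {1..K} \<Longrightarrow> min (w i) (enat N) = min (w' i) (enat N)) \<Longrightarrow> g w = g w'"
  shows "contO g"
  unfolding contO_def
proof (intro allI impI)
  fix ws w assume a: "\<forall>i. ws i \<in> OmegaS" "w \<in> OmegaS" "(\<lambda>i. rhoO (ws i) w) \<longlonglongrightarrow> 0"
  have "\<forall>\<^sub>F i in sequentially. \<forall>k\<in>{1..K}. min (ws i k) (enat N) = min (w k) (enat N)"
    by (rule eventually_ball_finite) (use rhoO_tendsto_min a in auto)
  then have "\<forall>\<^sub>F i in sequentially. g (ws i) = g w"
    by eventually_elim (rule g, blast)
  then show "(\<lambda>i. g (ws i)) \<longlonglongrightarrow> g w" by (rule tendsto_eventually)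
qed

lemma pw_range: "0 < q \<Longrightarrow> q \<le> 1 \<Longrightarrow> 0 \<le> pw q e \<and> pw q e \<le> 1"
  by (cases e) (auto simp: pw_def power_le_one)

text \<open>Not a cylinder function in general: at infinity continuity rests on
  \<open>(1 - q) ^ n\<close> tending to 0, hence on \<open>q > 0\<close>.\<close>

lemma contO_pw:
  assumes q: "0 < q" "q \<le> 1"
  shows "contO (\<lambda>w. pw q (w k))"
  unfolding contO_def
proof (intro allI impI)
  fix ws w assume a: "\<forall>i. ws i \<in> OmegaS" "w \<in> OmegaS" "(\<lambda>i. rhoO (ws i) w) \<longlonglongrightarrow> 0"
  note ev = rhoO_tendsto_min[OF a(1)[rule_format] a(2,3), of k]
  show "(\<lambda>i. pw q (ws i k)) \<longlonglongrightarrow> pw q (w k)"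
  proof (cases "w k")
    case (enat c)
    have "\<forall>\<^sub>F i in sequentially. pw q (ws i k) = pw q (w k)"
      using ev[of "Suc c"]
    proof eventually_elim
      case (elim i)
      then have "ws i k = enat c" using enat by (cases "ws i k") (auto simp: min_def split: if_splits)
      then show ?case using enat by simp
    qed
    then show ?thesis by (rule tendsto_eventually)
  next
    case infinity
    show ?thesis unfolding tendsto_iff
    proof (intro allI impI)
      fix \<epsilon> :: real assume "0 < \<epsilon>"
      have "(\<lambda>n. (1 - q) ^ n) \<longlonglongrightarrow> 0" by (rule LIMSEQ_power_zero) (use q in auto)
      then have "\<forall>\<^sub>F n in sequentially. (1 - q) ^ n < \<epsilon>" using \<open>0 < \<epsilon>\<close> by (rule order_tendstoD)
      then obtain N where N: "(1 - q) ^ N < \<epsilon>" by (auto simp: eventually_sequentially)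
      show "\<forall>\<^sub>F i in sequentially. dist (pw q (ws i k)) (pw q (w k)) < \<epsilon>"
        using ev[of N]
      proof eventually_elim
        case (elim i)
        show ?case
        proof (cases "ws i k")
          case (enat d)
          then have "N \<le> d" using elim infinity by (auto simp: min_def split: if_splits)
          then have "(1 - q) ^ d \<le> (1 - q) ^ N" using q by (intro power_decreasing) auto
          then show ?thesis using N enat infinity q by (simp add: pw_def dist_real_def)
        qed (use infinity \<open>0 < \<epsilon>\<close> in simp)
      qed
    qed
  qed
qed

section \<open>Building continuous functionals\<close>

lemma Ftest_const: "Ftest (\<lambda>_. c)"
  by (auto simp: Ftest_def bounded_iff)

text \<open>The values of \<open>F\<close> and \<open>G\<close> stay in a compact box, so continuity
  of \<open>h\<close> also gives boundedness.\<close>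

lemma Ftest_comp2:
  assumes F: "Ftest F" and G: "Ftest G" and c: "continuous_on UNIV (\<lambda>p. h (fst p) (snd p))"
  shows "Ftest (\<lambda>p. h (F p) (G p) :: real)"
proof -
  have b: "bounded ((\<lambda>p. h (F p) (G p)) ` (Dsp \<times> Lset))"
  proof -
    have bF: "bounded (F ` (Dsp \<times> Lset))" and bG: "bounded (G ` (Dsp \<times> Lset))"
      using F G unfolding Ftest_def by blast+
    obtain A where A: "F ` (Dsp \<times> Lset) \<subseteq> cball 0 A" using bF[unfolded bounded_iff] by (auto simp: image_subset_iff)
    obtain B where B: "G ` (Dsp \<times> Lset) \<subseteq> cball 0 B" using bG[unfolded bounded_iff] by (auto simp: image_subset_iff)
    have "compact ((\<lambda>p. h (fst p) (snd p)) ` (cball 0 A \<times> cball 0 B))"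
      by (intro compact_continuous_image continuous_on_subset[OF c] compact_Times compact_cball) simp
    then show ?thesis
    proof (rule bounded_subset[OF compact_imp_bounded], intro subsetI)
      fix r assume "r \<in> (\<lambda>p. h (F p) (G p)) ` (Dsp \<times> Lset)"
      then obtain p where "p \<in> Dsp \<times> Lset" "r = h (F p) (G p)" by blast
      then show "r \<in> (\<lambda>p. h (fst p) (snd p)) ` (cball 0 A \<times> cball 0 B)"
        using A B by (intro image_eqI[of _ _ "(F p, G p)"]) (auto simp: image_subset_iff)
    qed
  qed
  have t: "(\<lambda>m. h (F (xs m, \<mu>s m)) (G (xs m, \<mu>s m))) \<longlonglongrightarrow> h (F (x, \<mu>)) (G (x, \<mu>))"
    if "(\<lambda>m. F (xs m, \<mu>s m)) \<longlonglongrightarrow> F (x, \<mu>)" "(\<lambda>m. G (xs m, \<mu>s m)) \<longlonglongrightarrow> G (x, \<mu>)" for xs \<mu>s x \<mu>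
  proof -
    have "isCont (\<lambda>p. h (fst p) (snd p)) (F (x, \<mu>), G (x, \<mu>))"
      using c by (simp add: continuous_on_eq_continuous_at)
    from isCont_tendsto_compose[OF this tendsto_Pair[OF that]] show ?thesis by simp
  qed
  show ?thesis
    unfolding Ftest_def
  proof (intro conjI allI impI b)
    show "h (F (x, \<mu>)) (G (x, \<mu>)) = h (F (\<lambda>t. x (max 0 t), \<mu>)) (G (\<lambda>t. x (max 0 t), \<mu>))" for x \<mu>
      using F G unfolding Ftest_def by metis
  qed (rule t; use F G in \<open>unfold Ftest_def, blast\<close>)
qed

lemma Ftest_add: "Ftest F \<Longrightarrow> Ftest G \<Longrightarrow> Ftest (\<lambda>p. F p + G p)"
  by (rule Ftest_comp2[where h="(+)"]) (auto intro!: continuous_intros)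
lemma Ftest_diff: "Ftest F \<Longrightarrow> Ftest G \<Longrightarrow> Ftest (\<lambda>p. F p - G p)"
  by (rule Ftest_comp2[where h="(-)"]) (auto intro!: continuous_intros)
lemma Ftest_cmult: "Ftest F \<Longrightarrow> Ftest (\<lambda>p. c * F p)"
  by (rule Ftest_comp2[where h="\<lambda>a b. c * a"]) (auto intro!: continuous_intros)
lemma Ftest_abs: "Ftest F \<Longrightarrow> Ftest (\<lambda>p. \<bar>F p\<bar>)"
  by (rule Ftest_comp2[where h="\<lambda>a b. \<bar>a\<bar>"]) (auto intro!: continuous_intros)
lemma Ftest_sum: "finite J \<Longrightarrow> (\<And>j. j \<in> J \<Longrightarrow> Ftest (F j)) \<Longrightarrow> Ftest (\<lambda>p. \<Sum>j\<in>J. F j p)"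
  by (induction J rule: finite_induct) (auto intro: Ftest_const Ftest_add)

text \<open>Time changes fix 0, so this evaluation is continuous whatever the jumps of the
  path.\<close>

lemma Ftest_initial: "Ftest (\<lambda>p. fst p 0 k)"
  unfolding Ftest_def
proof (intro conjI allI impI)
  show "bounded ((\<lambda>p. fst p 0 k) ` (Dsp \<times> Lset))"
    unfolding bounded_iff using Dsp_range[of _ 0 k] by (intro exI[of _ 1]) auto
  show "fst (x, \<mu>) 0 k = fst (\<lambda>t. x (max 0 t), \<mu>) 0 k" for x :: "real \<Rightarrow> nat \<Rightarrow> real" and \<mu> :: "(real \<times> (nat \<Rightarrow> enat)) measure" by simp
  fix xs x and \<mu>s :: "nat \<Rightarrow> (real \<times> (nat \<Rightarrow> enat)) measure" and \<mu>
  assume "\<forall>m. xs m \<in> Dsp \<and> \<mu>s m \<in> Lset" "x \<in> Dsp" "J1conv xs x"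
  then show "(\<lambda>m. fst (xs m, \<mu>s m) 0 k) \<longlonglongrightarrow> fst (x, \<mu>) 0 k"
    using J1conv_pointwise[of xs x 0 k] by auto
qed

text \<open>The common shape of the functionals. Level \<open>k = 0\<close> turns the path factor
  into 1 on \<open>Dsp\<close>, so terms without a path factor need no separate treatment;
  \<open>max 0\<close> makes the value depend on nonnegative times only, as \<open>Ftest\<close>
  requires.\<close>

definition occF :: "real \<Rightarrow> (real \<Rightarrow> real) \<Rightarrow> nat \<Rightarrow> ((nat \<Rightarrow> enat) \<Rightarrow> real) \<Rightarrow> DL \<Rightarrow> real" where
  "occF t \<psi> k g p = (LINT z:strip t|snd p. \<psi> (fst z) * fst p (max 0 (fst z)) k * g (snd z))"

lemma fst_measurable_SpaceL: "h \<in> borel_measurable borel \<Longrightarrow> (\<lambda>z. h (fst z)) \<in> borel_measurable SpaceL"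
  for h :: "real \<Rightarrow> real"
  unfolding SpaceL_def by (rule measurable_compose[OF measurable_fst])

text \<open>Path and measure move together, and the path factor may jump in time. The path is first
  exchanged for its limit, at a cost bounded by the \<open>L^1\<close> distance of the paths
  uniformly over \<open>Lset\<close>; the limit path is then replaced by a continuous
  \<open>\<phi> n0\<close>, and weak convergence is used for the resulting continuous integrand
  only.\<close>

lemma Ftest_occF:
  assumes g: "contO g" and B: "\<And>w. \<bar>g w\<bar> \<le> B" and \<psi>: "continuous_on UNIV \<psi>" and t: "0 < t"
  shows "Ftest (occF t \<psi> k g)"
proof -
  have "compact (\<psi> ` {0..t})" by (intro compact_continuous_image continuous_on_subset[OF \<psi>]) auto
  then obtain C where C: "\<And>s. s \<in> {0..t} \<Longrightarrow> \<bar>\<psi> s\<bar> \<le> C"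
    using compact_imp_bounded[of "\<psi> ` {0..t}"] unfolding bounded_iff by (metis imageI real_norm_def)
  have C0: "0 \<le> C" using C[of 0] t by force
  have B0: "0 \<le> B" using B[of undefined] by linarith
  have [measurable]: "\<psi> \<in> borel_measurable borel" by (rule borel_measurable_continuous_onI[OF \<psi>])
  have m: "(\<lambda>z. \<psi> (fst z) * y (fst z) * g (snd z)) \<in> borel_measurable SpaceL" if "y \<in> borel_measurable borel" for y
    using that by (intro borel_measurable_times fst_measurable_SpaceL snd_measurable_SpaceL) auto
  have pt: "\<bar>\<psi> (fst z) * y (fst z) * g (snd z)\<bar> \<le> C * B * \<bar>y (fst z)\<bar>" if "z \<in> strip t" for z y
  proof -
    have "\<bar>\<psi> (fst z)\<bar> * \<bar>y (fst z)\<bar> * \<bar>g (snd z)\<bar> \<le> C * \<bar>y (fst z)\<bar> * B"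
      using C[of "fst z"] that B C0 B0 by (intro mult_mono) auto
    then show ?thesis by (simp add: abs_mult mult_ac)
  qed
  have bd: "\<bar>LINT z:strip t|\<mu>. \<psi> (fst z) * y (fst z) * g (snd z)\<bar> \<le> C * B * (LINT s:{0..t}|lborel. \<bar>y s\<bar>)"
    if \<mu>: "\<mu> \<in> Lset" and y: "y \<in> borel_measurable borel" and Y: "\<And>s. \<bar>y s\<bar> \<le> Y" for \<mu> y Y
  proof -
    have "\<bar>LINT z:strip t|\<mu>. \<psi> (fst z) * y (fst z) * g (snd z)\<bar> \<le> (LINT s:{0..t}|lborel. C * B * \<bar>y s\<bar>)"
    proof (rule strip_integral_bound[OF \<mu> m[OF y]])
      show "(\<lambda>s. C * B * \<bar>y s\<bar>) \<in> borel_measurable borel" using y by measurable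
      show "\<bar>C * B * \<bar>y s\<bar>\<bar> \<le> C * B * Y" for s using Y[of s] C0 B0 by (simp add: abs_mult mult_left_mono)
      show "0 \<le> C * B * \<bar>y s\<bar>" for s using C0 B0 by simp
    qed (rule pt)
    then show ?thesis by simp
  qed
  have int: "set_integrable \<mu> (strip t) (\<lambda>z. \<psi> (fst z) * y (fst z) * g (snd z))"
    if \<mu>: "\<mu> \<in> Lset" and y: "y \<in> borel_measurable borel" and Y: "\<And>s. \<bar>y s\<bar> \<le> Y" for \<mu> y Y
  proof (rule strip_integrable[OF \<mu> m[OF y], of _ "C * B * Y"])
    fix z assume "z \<in> strip t"
    from pt[OF this, of y] show "\<bar>\<psi> (fst z) * y (fst z) * g (snd z)\<bar> \<le> C * B * Y"
      using mult_left_mono[OF Y[of "fst z"], of "C * B"] C0 B0 by simp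
  qed
  have dif: "\<bar>(LINT z:strip t|\<mu>. \<psi> (fst z) * y (fst z) * g (snd z)) - (LINT z:strip t|\<mu>. \<psi> (fst z) * y' (fst z) * g (snd z))\<bar>
       \<le> C * B * (LINT s:{0..t}|lborel. \<bar>y s - y' s\<bar>)"
    if \<mu>: "\<mu> \<in> Lset" and y: "y \<in> borel_measurable borel" "y' \<in> borel_measurable borel" and Y: "\<And>s. \<bar>y s\<bar> \<le> 1" "\<And>s. \<bar>y' s\<bar> \<le> 1" for \<mu> y y'
  proof -
    have "(LINT z:strip t|\<mu>. \<psi> (fst z) * y (fst z) * g (snd z)) - (LINT z:strip t|\<mu>. \<psi> (fst z) * y' (fst z) * g (snd z))
       = (LINT z:strip t|\<mu>. \<psi> (fst z) * (y (fst z) - y' (fst z)) * g (snd z))"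
      using set_integral_diff(2)[OF int[OF \<mu> y(1) Y(1)] int[OF \<mu> y(2) Y(2)]] by (simp add: algebra_simps)
    also have "\<bar>\<dots>\<bar> \<le> C * B * (LINT s:{0..t}|lborel. \<bar>y s - y' s\<bar>)"
    proof (rule bd[OF \<mu>, of "\<lambda>s. y s - y' s" 2])
      show "\<bar>y s - y' s\<bar> \<le> 2" for s using Y(1)[of s] Y(2)[of s] by linarith
    qed (use y in measurable)
    finally show ?thesis .
  qed
  have xb: "\<bar>x (max 0 s) k\<bar> \<le> 1" if "x \<in> Dsp" for x s using Dsp_range[OF that, of "max 0 s" k] by simp
  show ?thesis
    unfolding Ftest_def
  proof (intro conjI allI impI)
    show "bounded (occF t \<psi> k g ` (Dsp \<times> Lset))"
      unfolding bounded_iff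
    proof (intro exI ballI)
      fix r assume "r \<in> occF t \<psi> k g ` (Dsp \<times> Lset)"
      then obtain x \<mu> where x: "x \<in> Dsp" "\<mu> \<in> Lset" and r: "r = occF t \<psi> k g (x, \<mu>)" by auto
      have "norm r \<le> C * B * (LINT s:{0..t}|lborel. \<bar>x (max 0 s) k\<bar>)"
        unfolding r occF_def using bd[OF x(2) Dsp_measurable[OF x(1)] xb[OF x(1)]] by simp
      also have "\<dots> \<le> C * B * (1 * (t - 0))"
      proof (rule mult_left_mono)
        have "\<bar>LINT s:{0..t}|lborel. \<bar>x (max 0 s) k\<bar>\<bar> \<le> 1 * (t - 0)"
        proof (rule set_integral_bound)
          show "(\<lambda>s. \<bar>x (max 0 s) k\<bar>) \<in> borel_measurable borel"
            by (intro borel_measurable_abs Dsp_measurable x)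
          show "\<bar>\<bar>x (max 0 s) k\<bar>\<bar> \<le> 1" for s using xb[OF x(1), of s] by (simp only: abs_abs)
        qed (use t in simp)
        then show "(LINT s:{0..t}|lborel. \<bar>x (max 0 s) k\<bar>) \<le> 1 * (t - 0)" by linarith
      qed (use C0 B0 in simp)
      finally show "norm r \<le> C * B * (1 * (t - 0))" .
    qed
    show "occF t \<psi> k g (x, \<mu>) = occF t \<psi> k g (\<lambda>t. x (max 0 t), \<mu>)" for x \<mu>
      by (simp add: occF_def)
    fix xs x \<mu>s \<mu>
    assume mem: "\<forall>m. xs m \<in> Dsp \<and> \<mu>s m \<in> Lset" and x: "x \<in> Dsp" and \<mu>: "\<mu> \<in> Lset" and J: "J1conv xs x" and L: "Lconv \<mu>s \<mu>"
    have xs: "xs m \<in> Dsp" and \<mu>s: "\<mu>s m \<in> Lset" for m using mem by auto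
    have L1: "(\<lambda>m. occF t \<psi> k g (xs m, \<mu>s m) - occF t \<psi> k g (x, \<mu>s m)) \<longlonglongrightarrow> 0"
    proof (rule Lim_null_comparison)
      have "(\<lambda>m. C * B * (LINT s:{0..t}|lborel. \<bar>xs m (max 0 s) k - x (max 0 s) k\<bar>)) \<longlonglongrightarrow> C * B * 0"
        by (intro tendsto_intros J1conv_L1[OF J xs x])
      then show "(\<lambda>m. C * B * (LINT s:{0..t}|lborel. \<bar>xs m (max 0 s) k - x (max 0 s) k\<bar>)) \<longlonglongrightarrow> 0" by simp
      show "\<forall>\<^sub>F m in sequentially. norm (occF t \<psi> k g (xs m, \<mu>s m) - occF t \<psi> k g (x, \<mu>s m))
          \<le> C * B * (LINT s:{0..t}|lborel. \<bar>xs m (max 0 s) k - x (max 0 s) k\<bar>)"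
        unfolding occF_def using dif[OF \<mu>s Dsp_measurable[OF xs] Dsp_measurable[OF x] xb[OF xs] xb[OF x]] by simp
    qed
    have L2: "(\<lambda>m. occF t \<psi> k g (x, \<mu>s m)) \<longlonglongrightarrow> occF t \<psi> k g (x, \<mu>)"
      unfolding tendsto_iff
    proof (intro allI impI)
      fix \<epsilon> :: real assume "0 < \<epsilon>"
      obtain \<phi> :: "nat \<Rightarrow> real \<Rightarrow> real" where \<phi>: "\<And>n. continuous_on UNIV (\<phi> n)" "\<And>n s. \<bar>\<phi> n s\<bar> \<le> 1"
        "(\<lambda>n. LINT s:{0..t}|lborel. \<bar>x (max 0 s) k - \<phi> n s\<bar>) \<longlonglongrightarrow> 0"
        by (rule continuous_L1_approx[OF Dsp_measurable[OF x, of k] xb[OF x], where a=0 and b=t]) (rule that)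
      have "(\<lambda>n. C * B * (LINT s:{0..t}|lborel. \<bar>x (max 0 s) k - \<phi> n s\<bar>)) \<longlonglongrightarrow> C * B * 0"
        by (intro tendsto_intros \<phi>(3))
      then have "\<forall>\<^sub>F n in sequentially. C * B * (LINT s:{0..t}|lborel. \<bar>x (max 0 s) k - \<phi> n s\<bar>) < \<epsilon> / 3"
        using \<open>0 < \<epsilon>\<close> by (intro order_tendstoD(2)) auto
      then obtain n0 where n0: "C * B * (LINT s:{0..t}|lborel. \<bar>x (max 0 s) k - \<phi> n0 s\<bar>) < \<epsilon> / 3"
        by (auto simp: eventually_sequentially)
      have pm: "\<phi> n0 \<in> borel_measurable borel" by (rule borel_measurable_continuous_onI[OF \<phi>(1)])
      let ?J = "\<lambda>\<mu>. LINT z:strip t|\<mu>. \<psi> (fst z) * \<phi> n0 (fst z) * g (snd z)"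
      have near: "\<bar>occF t \<psi> k g (x, \<mu>) - ?J \<mu>\<bar> < \<epsilon> / 3" if "\<mu> \<in> Lset" for \<mu>
        using dif[OF that Dsp_measurable[OF x] pm xb[OF x] \<phi>(2)] n0 unfolding occF_def by simp
      have "(\<lambda>m. ?J (\<mu>s m)) \<longlonglongrightarrow> ?J \<mu>"
      proof -
        have "bounded ((\<lambda>z. \<psi> (fst z) * \<phi> n0 (fst z) * g (snd z)) ` strip t)"
          unfolding bounded_iff
        proof (intro exI ballI)
          fix r assume "r \<in> (\<lambda>z. \<psi> (fst z) * \<phi> n0 (fst z) * g (snd z)) ` strip t"
          then obtain z where z: "z \<in> strip t" "r = \<psi> (fst z) * \<phi> n0 (fst z) * g (snd z)" by auto
          show "norm r \<le> C * B * 1"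
            using pt[OF z(1), of "\<phi> n0"] mult_left_mono[OF \<phi>(2)[of n0 "fst z"], of "C * B"] C0 B0 unfolding z(2) by simp
        qed
        moreover have "cont_on_strip t (\<lambda>z. \<psi> (fst z) * \<phi> n0 (fst z) * g (snd z))"
          unfolding cont_on_strip_def
        proof (intro allI impI)
          fix ss ws s w
          assume a: "\<forall>j. ss j \<in> {0..<t} \<and> ws j \<in> OmegaS" "s \<in> {0..<t}" "w \<in> OmegaS" "ss \<longlonglongrightarrow> s" "(\<lambda>j. rhoO (ws j) w) \<longlonglongrightarrow> 0"
          have c: "(\<lambda>j. f (ss j)) \<longlonglongrightarrow> f s" if "continuous_on UNIV f" for f :: "real \<Rightarrow> real"
            by (rule isCont_tendsto_compose[OF _ a(4)]) (use that in \<open>simp add: continuous_on_eq_continuous_at\<close>)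
          have "(\<lambda>j. g (ws j)) \<longlonglongrightarrow> g w" using g a unfolding contO_def by blast
          then show "(\<lambda>j. \<psi> (fst (ss j, ws j)) * \<phi> n0 (fst (ss j, ws j)) * g (snd (ss j, ws j)))
              \<longlonglongrightarrow> \<psi> (fst (s, w)) * \<phi> n0 (fst (s, w)) * g (snd (s, w))"
            using c[OF \<psi>] c[OF \<phi>(1)] by (simp add: tendsto_mult)
        qed
        ultimately show ?thesis using L m[OF pm] t unfolding Lconv_def by blast
      qed
      then have "\<forall>\<^sub>F m in sequentially. dist (?J (\<mu>s m)) (?J \<mu>) < \<epsilon> / 3"
        using \<open>0 < \<epsilon>\<close> by (intro tendstoD) auto
      then show "\<forall>\<^sub>F m in sequentially. dist (occF t \<psi> k g (x, \<mu>s m)) (occF t \<psi> k g (x, \<mu>)) < \<epsilon>"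
      proof eventually_elim
        case (elim m)
        then show ?case using near[OF \<mu>s, of m] near[OF \<mu>] unfolding dist_real_def by linarith
      qed
    qed
    from tendsto_add[OF L1 L2] show "(\<lambda>m. occF t \<psi> k g (xs m, \<mu>s m)) \<longlonglongrightarrow> occF t \<psi> k g (x, \<mu>)" by simp
  qed
qed

section \<open>Prelimit estimates\<close>

text \<open>Serves for time integrals and, with \<open>A = UNIV\<close>, for expectations under a
  probability mass function.\<close>

lemma set_integral_combination:
  fixes c :: real and a b :: "nat \<Rightarrow> 'a \<Rightarrow> real"
  assumes a: "\<And>j. set_integrable M A (a j)" and b: "\<And>j. set_integrable M A (b j)" and d: "set_integrable M A d"
  shows "(\<Sum>j<N. c * ((LINT z:A|M. a j z) - (LINT z:A|M. b j z))) + (LINT z:A|M. d z) =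
    (LINT z:A|M. (\<Sum>j<N. c * (a j z - b j z)) + d z)"
proof -
  have i: "set_integrable M A (\<lambda>z. c * (a j z - b j z))" for j
    by (intro set_integrable_mult_right set_integral_diff(1) a b)
  have eq: "(\<lambda>z. indicator A z *\<^sub>R ((\<Sum>j<N. c * (a j z - b j z)) + d z)) =
      (\<lambda>z. (\<Sum>j<N. indicator A z *\<^sub>R (c * (a j z - b j z))) + indicator A z *\<^sub>R d z)"
    by (simp only: scaleR_add_right scaleR_sum_right)
  have s: "integrable M (\<lambda>z. \<Sum>j<N. indicator A z *\<^sub>R (c * (a j z - b j z)))"
    by (rule Bochner_Integration.integrable_sum) (use i in \<open>simp add: set_integrable_def\<close>)
  have dd: "integrable M (\<lambda>z. indicator A z *\<^sub>R d z)" using d by (simp add: set_integrable_def)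
  have "(LINT z:A|M. (\<Sum>j<N. c * (a j z - b j z)) + d z) =
     (\<Sum>j<N. LINT z:A|M. c * (a j z - b j z)) + (LINT z:A|M. d z)"
    unfolding set_lebesgue_integral_def eq Bochner_Integration.integral_add[OF s dd]
    by (subst Bochner_Integration.integral_sum) (use i in \<open>simp_all add: set_integrable_def\<close>)
  also have "\<dots> = (\<Sum>j<N. c * ((LINT z:A|M. a j z) - (LINT z:A|M. b j z))) + (LINT z:A|M. d z)"
    using set_integral_diff(2)[OF a b] by simp
  finally show "(\<Sum>j<N. c * ((LINT z:A|M. a j z) - (LINT z:A|M. b j z))) + (LINT z:A|M. d z) =
    (LINT z:A|M. (\<Sum>j<N. c * (a j z - b j z)) + d z)" by simp
qed

definition upD :: "((nat \<Rightarrow> enat) \<Rightarrow> real) \<Rightarrow> nat \<Rightarrow> (nat \<Rightarrow> enat) \<Rightarrow> real" where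
  "upD f j w = f (w(Suc j := w (Suc j) + 1)) - f w"

text \<open>Departure rates depend on the fast variable alone, so all levels merge into one
  function; arrival rates carry the proportions, which is why \<open>upD\<close> stays separate for
  each level.\<close>

definition dnD :: "real \<Rightarrow> ((nat \<Rightarrow> enat) \<Rightarrow> real) \<Rightarrow> nat \<Rightarrow> (nat \<Rightarrow> enat) \<Rightarrow> real" where
  "dnD q f N w = (\<Sum>j<N. (pw q (w (Suc (Suc j))) - pw q (w (Suc j))) * (f (w(Suc j := w (Suc j) - 1)) - f w))"

text \<open>The generator with frozen rates, integrated against the occupation measure. It is linear
  in the proportions, hence a combination of \<open>occF\<close> terms; the departure part takes
  path level 0.\<close>

definition genF :: "real \<Rightarrow> real \<Rightarrow> real \<Rightarrow> ((nat \<Rightarrow> enat) \<Rightarrow> real) \<Rightarrow> nat \<Rightarrow> DL \<Rightarrow> real" where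
  "genF lam q t f N p = (\<Sum>j<N. lam * (occF t (\<lambda>_. 1) j (upD f j) p - occF t (\<lambda>_. 1) (Suc j) (upD f j) p))
     + occF t (\<lambda>_. 1) 0 (dnD q f N) p"

text \<open>The integral over [0,t] of the integral equation for coordinate k + 1, rewritten as an integral against the
  occupation measure by Fubini; this is the source of the weight t - s.\<close>

definition flowF :: "real \<Rightarrow> real \<Rightarrow> real \<Rightarrow> nat \<Rightarrow> DL \<Rightarrow> real" where
  "flowF lam q t k p = occF t (\<lambda>_. 1) (Suc k) (\<lambda>_. 1) p - t * fst p 0 (Suc k)
     - lam * (occF t (\<lambda>s. t - s) k (\<lambda>_. 1) p - occF t (\<lambda>s. t - s) (Suc k) (\<lambda>_. 1) p)
     + occF t (\<lambda>s. t - s) 0 (\<lambda>w. pw q (w (Suc (Suc k))) - pw q (w (Suc k))) p"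

definition dependsO :: "nat \<Rightarrow> ((nat \<Rightarrow> enat) \<Rightarrow> real) \<Rightarrow> bool" where
  "dependsO N f \<longleftrightarrow> (\<forall>w w'. (\<forall>i\<in>{1..N}. w i = w' i) \<longrightarrow> f w = f w')"

text \<open>The factors \<open>1\<close> and \<open>u 0\<close> are kept so that the summands have
  literally the shape of the \<open>occF\<close> integrands with weight 1.\<close>

lemma genO_finite:
  assumes f: "dependsO N f" and u: "u 0 = 1"
  shows "genO lam q u f w = (\<Sum>j<N. lam * (1 * u j * upD f j w - 1 * u (Suc j) * upD f j w)) + 1 * u 0 * dnD q f N w"
proof -
  have same: "f (w(Suc j := e)) = f w" if "j \<notin> {..<N}" for j e
    using f that unfolding dependsO_def by auto
  have "(\<Sum>j. lam * (u j - u (Suc j)) * (f (w(Suc j := w (Suc j) + 1)) - f w)) =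
      (\<Sum>j<N. lam * (u j - u (Suc j)) * (f (w(Suc j := w (Suc j) + 1)) - f w))"
    by (rule suminf_finite) (auto simp: same)
  moreover have "(\<Sum>j. (pw q (w (Suc (Suc j))) - pw q (w (Suc j))) * (f (w(Suc j := w (Suc j) - 1)) - f w)) =
      (\<Sum>j<N. (pw q (w (Suc (Suc j))) - pw q (w (Suc j))) * (f (w(Suc j := w (Suc j) - 1)) - f w))"
    by (rule suminf_finite) (auto simp: same)
  ultimately show ?thesis
    unfolding genO_def upD_def dnD_def u by (simp add: algebra_simps)
qed

lemma toO_OmegaS: "m \<in> Sn n \<Longrightarrow> toO m \<in> OmegaS"
  by (auto simp: Sn_def OmegaS_def toO_def)

lemma upD_bound: "(\<And>w. \<bar>f w\<bar> \<le> B) \<Longrightarrow> \<bar>upD f j w\<bar> \<le> 2 * B"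
  unfolding upD_def using abs_triangle_ineq4 by (smt (verit))

lemma dnD_bound:
  assumes f: "\<And>w. \<bar>f w\<bar> \<le> B" and q: "0 < q" "q \<le> 1"
  shows "\<bar>dnD q f N w\<bar> \<le> real N * (2 * B)"
proof -
  have "\<bar>dnD q f N w\<bar> \<le> (\<Sum>j<N. 1 * (2 * B))"
    unfolding dnD_def
  proof (rule order_trans[OF sum_abs sum_mono])
    fix j
    have "\<bar>pw q (w (Suc (Suc j))) - pw q (w (Suc j))\<bar> \<le> 1"
      using pw_range[OF q, of "w (Suc (Suc j))"] pw_range[OF q, of "w (Suc j)"] by linarith
    moreover have "\<bar>f (w(Suc j := w (Suc j) - 1)) - f w\<bar> \<le> 2 * B"
      using f[of "w(Suc j := w (Suc j) - 1)"] f[of w] by linarith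
    ultimately show "\<bar>(pw q (w (Suc (Suc j))) - pw q (w (Suc j))) * (f (w(Suc j := w (Suc j) - 1)) - f w)\<bar> \<le> 1 * (2 * B)"
      unfolding abs_mult by (rule mult_mono) auto
  qed
  then show ?thesis by simp
qed

section \<open>The functionals along the system of size n\<close>

context lcq
begin

definition Y :: "'a \<Rightarrow> DL" where "Y x = (\<lambda>s. uOf n (X x s), occ (X x))"

lemma toO_path_measurable: "(\<lambda>s. (s, toO (X x s))) \<in> restrict_space lborel {0..} \<rightarrow>\<^sub>M SpaceL"
proof -
  have c: "(\<lambda>s. toO (Z x s)) \<in> lborel \<rightarrow>\<^sub>M count_space UNIV"
  proof (rule measurableI)
    fix A :: "(nat \<Rightarrow> enat) set"
    have "(\<lambda>s. indicator A (toO (Z x s)) :: real) \<in> borel_measurable borel"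
      by (rule Z_path_measurable[of "\<lambda>m. indicator A (toO m)"])
    then have "(\<lambda>s. indicator A (toO (Z x s)) :: real) -` {1} \<inter> space borel \<in> sets borel"
      by (rule measurable_sets) simp
    moreover have "(\<lambda>s. indicator A (toO (Z x s)) :: real) -` {1} \<inter> space borel = (\<lambda>s. toO (Z x s)) -` A \<inter> space lborel"
      by (auto simp: indicator_def split: if_splits)
    ultimately show "(\<lambda>s. toO (Z x s)) -` A \<inter> space lborel \<in> sets lborel" by simp
  qed simp
  have "(\<lambda>s. (s, toO (Z x s))) \<in> lborel \<rightarrow>\<^sub>M SpaceL"
    unfolding SpaceL_def by (intro measurable_Pair c) simp
  then have "(\<lambda>s. (s, toO (Z x s))) \<in> restrict_space lborel {0..} \<rightarrow>\<^sub>M SpaceL"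
    by (rule measurable_restrict_space1)
  then show ?thesis
    by (rule measurable_cong[THEN iffD1, rotated]) (auto simp: space_restrict_space Z_eq)
qed

text \<open>The occupation measure is an image of Lebesgue measure, so the integral pulls back to
  time; the half-open strip and the closed interval differ by one point.\<close>

lemma Y_occF:
  assumes \<psi>: "\<psi> \<in> borel_measurable borel"
  shows "occF t \<psi> k g (Y x) = (LINT s:{0..t}|lborel. \<psi> s * (real (Z x s k) / real n) * g (toO (Z x s)))"
proof -
  define h where "h z = indicator (strip t) z *\<^sub>R (\<psi> (fst z) * uOf n (X x (max 0 (fst z))) k * g (snd z))" for z
  have "(\<lambda>s. uOf n (X x (max 0 s)) k) \<in> borel_measurable borel"
    using Z_path_measurable[of "\<lambda>m. uOf n m k" x] unfolding Z_def by simp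
  moreover have "strip t \<in> sets SpaceL" unfolding SpaceL_def by (rule pair_measureI) auto
  ultimately have hm: "h \<in> borel_measurable SpaceL"
    unfolding h_def using \<psi>
    by (intro borel_measurable_scaleR borel_measurable_indicator borel_measurable_times snd_measurable_SpaceL)
       (auto intro: fst_measurable_SpaceL[of \<psi>] fst_measurable_SpaceL[of "\<lambda>s. uOf n (X x (max 0 s)) k"])
  have "occF t \<psi> k g (Y x) = (\<integral>z. h z \<partial>distr (restrict_space lborel {0..}) SpaceL (\<lambda>s. (s, toO (X x s))))"
    by (simp add: occF_def Y_def occ_def h_def set_lebesgue_integral_def)
  also have "\<dots> = (\<integral>s. h (s, toO (X x s)) \<partial>restrict_space lborel {0..})"
    by (rule integral_distr[OF toO_path_measurable hm])
  also have "\<dots> = (LINT s|lborel. indicator {0..} s *\<^sub>R h (s, toO (X x s)))"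
    by (rule integral_restrict_space) simp
  also have "\<dots> = (LINT s|lborel. indicator {0..t} s *\<^sub>R (\<psi> s * (real (Z x s k) / real n) * g (toO (Z x s))))"
  proof (rule integral_cong_AE)
    show "(\<lambda>s. indicator {0..} s *\<^sub>R h (s, toO (X x s))) \<in> borel_measurable lborel"
      using measurable_compose[OF toO_path_measurable hm]
      by (simp add: borel_measurable_restrict_space_iff)
    show "(\<lambda>s. indicator {0..t} s *\<^sub>R (\<psi> s * (real (Z x s k) / real n) * g (toO (Z x s)))) \<in> borel_measurable lborel"
      using \<psi> Z_path_measurable[of "\<lambda>m. real (m k) / real n" x] Z_path_measurable[of "\<lambda>m. g (toO m)" x]
      by (intro borel_measurable_scaleR borel_measurable_indicator borel_measurable_times) auto
    show "AE s in lborel. indicator {0..} s *\<^sub>R h (s, toO (X x s)) = indicator {0..t} s *\<^sub>R (\<psi> s * (real (Z x s k) / real n) * g (toO (Z x s)))"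
      using AE_lborel_singleton[of t]
    proof eventually_elim
      case (elim s)
      show ?case
      proof (cases "0 \<le> s")
        case True
        have "toO (X x s) \<in> OmegaS" using toO_OmegaS[OF Z_Sn[of x s]] True by (simp add: Z_eq)
        then show ?thesis using True elim by (auto simp: h_def indicator_def Z_eq uOf_def)
      qed (simp add: indicator_def)
    qed
  qed
  finally show ?thesis by (simp add: set_lebesgue_integral_def)
qed

lemma Z_le_n: "Z x s k \<le> n"
proof -
  have "Z x s k \<le> Z x s 0" by (rule lift_Suc_antimono_le[of "Z x s"]) (use Z_Sn[of x s] in \<open>auto simp: Sn_def\<close>)
  then show ?thesis using Z_Sn[of x s] by (simp add: Sn_def)
qed

lemma uZ_range: "\<bar>real (Z x s k) / real n\<bar> \<le> 1"
  using Z_le_n[of x s k] n by (simp add: divide_le_eq)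

lemma Z_integrand_integrable:
  assumes \<psi>[measurable]: "\<psi> \<in> borel_measurable borel" and C: "\<And>s. s \<in> {0..t} \<Longrightarrow> \<bar>\<psi> s\<bar> \<le> C" and B: "\<And>w. \<bar>g w\<bar> \<le> B"
  shows "set_integrable lborel {0..t} (\<lambda>s. \<psi> s * (real (Z x s k) / real n) * g (toO (Z x s)))"
proof (rule bounded_set_integrable[where B="\<bar>C\<bar> * 1 * B"])
  show "(\<lambda>s. \<psi> s * (real (Z x s k) / real n) * g (toO (Z x s))) \<in> borel_measurable borel"
    using \<psi> Z_path_measurable[of "\<lambda>m. real (m k) / real n" x] Z_path_measurable[of "\<lambda>m. g (toO m)" x]
    by (intro borel_measurable_times) auto
  fix s assume "s \<in> {0..t}"
  then have "\<bar>\<psi> s\<bar> \<le> \<bar>C\<bar>" using C[of s] by linarith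
  then show "\<bar>\<psi> s * (real (Z x s k) / real n) * g (toO (Z x s))\<bar> \<le> \<bar>C\<bar> * 1 * B"
    unfolding abs_mult[of "\<psi> s * (real (Z x s k) / real n)"] abs_mult[of "\<psi> s"]
    by (intro mult_mono uZ_range B) auto
qed

text \<open>Where the count is below \<open>N\<close> its proportion is below \<open>N / n\<close>.
  In the limit this forces the count to be infinite wherever the proportion is positive.\<close>

lemma occ_small_bound:
  assumes t: "0 < t"
  shows "\<bar>occF t (\<lambda>_. 1) (Suc k) (\<lambda>w. if w (Suc k) < enat N then 1 else 0) (Y x)\<bar> \<le> real N * t / real n"
proof -
  have "\<bar>LINT s:{0..t}|lborel. 1 * (real (Z x s (Suc k)) / real n) * (if toO (Z x s) (Suc k) < enat N then 1 else 0)\<bar> \<le> real N / real n * (t - 0)"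
  proof (rule set_integral_bound)
    show "(\<lambda>s. 1 * (real (Z x s (Suc k)) / real n) * (if toO (Z x s) (Suc k) < enat N then 1 else 0)) \<in> borel_measurable borel"
      by (rule Z_path_measurable[of "\<lambda>m. 1 * (real (m (Suc k)) / real n) * (if toO m (Suc k) < enat N then 1 else 0)" x])
    show "\<bar>1 * (real (Z x s (Suc k)) / real n) * (if toO (Z x s) (Suc k) < enat N then 1 else 0)\<bar> \<le> real N / real n" for s
      by (auto simp: toO_def divide_right_mono)
  qed (use t in simp)
  then show ?thesis unfolding Y_occF[OF borel_measurable_const] by simp
qed

text \<open>The separation of time scales: jumps of the counts are jumps of the fast variable, at
  \<open>n\<close> times the rates. Level 0 never jumps, so \<open>toO\<close> may set it to
  infinity.\<close>

lemma genN_toO: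
  assumes f: "dependsO N f" and m: "m \<in> Sn n"
  shows "genN lam q n (\<lambda>m. f (toO m)) m = real n * genO lam q (uOf n m) f (toO m)"
proof -
  have same: "f ((toO m)(Suc j := e)) = f (toO m)" if "j \<notin> {..<N}" for j e
    using f that unfolding dependsO_def by auto
  have tu: "toO (m(Suc j := Suc (m (Suc j)))) = (toO m)(Suc j := toO m (Suc j) + 1)" for j
    by (auto simp: toO_def fun_eq_iff one_enat_def)
  have td: "toO (m(Suc j := m (Suc j) - 1)) = (toO m)(Suc j := toO m (Suc j) - 1)" for j
    by (auto simp: toO_def fun_eq_iff one_enat_def)
  have p: "pw q (toO m (Suc j)) = (1 - q) ^ m (Suc j)" for j by (simp add: toO_def pw_def)
  have u0: "uOf n m 0 = 1" using m n by (simp add: uOf_def Sn_def)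
  have "(\<Sum>j. lam * (real (m j) - real (m (Suc j))) * (f ((toO m)(Suc j := toO m (Suc j) + 1)) - f (toO m))) =
      (\<Sum>j<N. lam * (real (m j) - real (m (Suc j))) * (f ((toO m)(Suc j := toO m (Suc j) + 1)) - f (toO m)))"
    by (rule suminf_finite) (auto simp: same)
  moreover have "(\<Sum>j. real n * ((1 - q) ^ (m (Suc (Suc j))) - (1 - q) ^ (m (Suc j))) * (f ((toO m)(Suc j := toO m (Suc j) - 1)) - f (toO m))) =
      (\<Sum>j<N. real n * ((1 - q) ^ (m (Suc (Suc j))) - (1 - q) ^ (m (Suc j))) * (f ((toO m)(Suc j := toO m (Suc j) - 1)) - f (toO m)))"
    by (rule suminf_finite) (auto simp: same)
  moreover have "real n * (\<Sum>j<N. lam * (1 * uOf n m j * upD f j (toO m) - 1 * uOf n m (Suc j) * upD f j (toO m))) =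
      (\<Sum>j<N. lam * (real (m j) - real (m (Suc j))) * (f ((toO m)(Suc j := toO m (Suc j) + 1)) - f (toO m)))"
    unfolding sum_distrib_left
  proof (rule sum.cong)
    have "real n * (lam * (1 * uOf n m j * d - 1 * uOf n m (Suc j) * d)) = lam * (real (m j) - real (m (Suc j))) * d" for j d
      using n by (simp add: uOf_def field_simps)
    then show "real n * (lam * (1 * uOf n m j * upD f j (toO m) - 1 * uOf n m (Suc j) * upD f j (toO m))) =
        lam * (real (m j) - real (m (Suc j))) * (f ((toO m)(Suc j := toO m (Suc j) + 1)) - f (toO m))" for j
      by (simp only: upD_def)
  qed simp
  moreover have "real n * (1 * uOf n m 0 * dnD q f N (toO m)) =
      (\<Sum>j<N. real n * ((1 - q) ^ (m (Suc (Suc j))) - (1 - q) ^ (m (Suc j))) * (f ((toO m)(Suc j := toO m (Suc j) - 1)) - f (toO m)))"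
    by (simp add: u0 dnD_def p sum_distrib_left mult.assoc)
  ultimately show ?thesis
    unfolding genO_finite[of N f "uOf n m", OF f u0] genN_def tu td distrib_left by simp
qed

text \<open>The time integral of the generator is an endpoint increment minus a martingale. After
  division by \<open>n\<close> the increment contributes \<open>2 / n\<close>; jumps of a function
  bounded by 1 are at most 2, which gives the \<open>4\<close> as their square.\<close>

lemma genF_expectation:
  assumes f: "dependsO N f" and B: "\<And>w. \<bar>f w\<bar> \<le> 1" and t: "0 < t"
  shows "(\<integral>x. \<bar>genF lam q t f N (Y x)\<bar> \<partial>M) \<le> (1 + (lam + 1) * 4 * t) / sqrt (real n) + 2 / real n"
proof -
  define f' where "f' m = f (toO m)" for m
  define D where "D x = (f' (Z x t) - f' (Z x 0) - (LINT r:{0..t}|lborel. genN lam q n f' (Z x r))) / real n" for x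
  have b: "\<bar>f' m\<bar> \<le> 1" for m by (simp add: f'_def B)
  have b2: "\<bar>f' m - f' m'\<bar> \<le> 2" for m m' using b[of m] b[of m'] by linarith
  have E: "integrable M (\<lambda>x. \<bar>D x\<bar>)" "(\<integral>x. \<bar>D x\<bar> \<partial>M) \<le> (1 + (lam + 1) * 2\<^sup>2 * t) / sqrt (real n)"
    unfolding D_def using scaled_martingale_L1[of f' 1 t 2] b b2 t by auto
  have path: "genF lam q t f N (Y x) = (f' (Z x t) - f' (Z x 0)) / real n - D x" for x
  proof -
    have i1: "set_integrable lborel {0..t} (\<lambda>s. 1 * (real (Z x s j) / real n) * g (toO (Z x s)))" if "\<And>w. \<bar>g w\<bar> \<le> C" for j g C
      by (rule Z_integrand_integrable[where C=1]) (use that in auto)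
    have "genF lam q t f N (Y x) = (LINT s:{0..t}|lborel.
        (\<Sum>j<N. lam * (1 * (real (Z x s j) / real n) * upD f j (toO (Z x s)) - 1 * (real (Z x s (Suc j)) / real n) * upD f j (toO (Z x s))))
        + 1 * (real (Z x s 0) / real n) * dnD q f N (toO (Z x s)))"
      unfolding genF_def Y_occF[OF borel_measurable_const]
      by (rule set_integral_combination) (rule i1, rule upD_bound[OF B] dnD_bound[OF B q])+
    also have "\<dots> = (LINT s:{0..t}|lborel. genN lam q n f' (Z x s) / real n)"
    proof (rule set_lebesgue_integral_cong, simp, intro allI impI)
      fix s
      have u0: "uOf n (Z x s) 0 = 1" using Z_Sn[of x s] n by (simp add: uOf_def Sn_def)
      show "(\<Sum>j<N. lam * (1 * (real (Z x s j) / real n) * upD f j (toO (Z x s)) - 1 * (real (Z x s (Suc j)) / real n) * upD f j (toO (Z x s))))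
        + 1 * (real (Z x s 0) / real n) * dnD q f N (toO (Z x s)) = genN lam q n f' (Z x s) / real n"
        using n unfolding f'_def[abs_def] genN_toO[OF f Z_Sn] genO_finite[of N f "uOf n (Z x s)", OF f u0] by (simp add: uOf_def)
    qed
    also have "\<dots> = (f' (Z x t) - f' (Z x 0)) / real n - D x"
      unfolding D_def by (simp add: diff_divide_distrib)
    finally show ?thesis .
  qed
  have "(\<integral>x. \<bar>genF lam q t f N (Y x)\<bar> \<partial>M) \<le> (\<integral>x. \<bar>D x\<bar> + 2 / real n \<partial>M)"
  proof (rule integral_mono')
    show "integrable M (\<lambda>x. \<bar>D x\<bar> + 2 / real n)" using E(1) by simp
    fix x
    have "\<bar>(f' (Z x t) - f' (Z x 0)) / real n\<bar> \<le> 2 / real n"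
      using b2[of "Z x t" "Z x 0"] by (simp add: abs_divide divide_right_mono)
    then show "\<bar>genF lam q t f N (Y x)\<bar> \<le> \<bar>D x\<bar> + 2 / real n" unfolding path by linarith
  qed simp
  also have "\<dots> = (\<integral>x. \<bar>D x\<bar> \<partial>M) + 2 / real n" using E(1) by (simp add: prob_space)
  finally show ?thesis using E(2) by simp
qed

text \<open>The truncation at n makes the coordinate a bounded test function and is invisible on the state space.\<close>

lemma genN_coordinate:
  assumes m: "m \<in> Sn n"
  shows "genN lam q n (\<lambda>m. real (min (m (Suc k)) n)) m =
    lam * (real (m k) - real (m (Suc k))) - real n * ((1 - q) ^ m (Suc (Suc k)) - (1 - q) ^ m (Suc k))"
proof -
  have dec: "m (Suc j) \<le> m j" for j using m by (auto simp: Sn_def)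
  have le: "m j \<le> n" for j
    using lift_Suc_antimono_le[of m 0 j] dec m by (auto simp: Sn_def)
  have "(\<Sum>j. lam * (real (m j) - real (m (Suc j))) * (real (min ((m(Suc j := Suc (m (Suc j)))) (Suc k)) n) - real (min (m (Suc k)) n)))
     = (\<Sum>j\<in>{k}. lam * (real (m j) - real (m (Suc j))) * (real (min ((m(Suc j := Suc (m (Suc j)))) (Suc k)) n) - real (min (m (Suc k)) n)))"
    by (rule suminf_finite) auto
  also have "\<dots> = lam * (real (m k) - real (m (Suc k)))"
  \<comment> \<open>At the cap the truncated coordinate cannot grow, but then \<open>m k = n\<close>
    and the arrival rate is 0.\<close>
  proof (cases "m (Suc k) = n")
    case True
    then have "m k = n" using dec[of k] le[of k] by simp
    then show ?thesis using True by simp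
  next
    case False
    then have "m (Suc k) < n" using le[of "Suc k"] by simp
    then show ?thesis by (simp add: min_def)
  qed
  finally have 1: "(\<Sum>j. lam * (real (m j) - real (m (Suc j))) * (real (min ((m(Suc j := Suc (m (Suc j)))) (Suc k)) n) - real (min (m (Suc k)) n)))
     = lam * (real (m k) - real (m (Suc k)))" .
  have "(\<Sum>j. real n * ((1 - q) ^ m (Suc (Suc j)) - (1 - q) ^ m (Suc j)) * (real (min ((m(Suc j := m (Suc j) - 1)) (Suc k)) n) - real (min (m (Suc k)) n)))
     = (\<Sum>j\<in>{k}. real n * ((1 - q) ^ m (Suc (Suc j)) - (1 - q) ^ m (Suc j)) * (real (min ((m(Suc j := m (Suc j) - 1)) (Suc k)) n) - real (min (m (Suc k)) n)))"
    by (rule suminf_finite) auto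
  also have "\<dots> = - (real n * ((1 - q) ^ m (Suc (Suc k)) - (1 - q) ^ m (Suc k)))"
  \<comment> \<open>Natural subtraction keeps 0 fixed; the next level is then empty as well and the
    departure rate is 0.\<close>
  proof (cases "m (Suc k) = 0")
    case True
    then have "m (Suc (Suc k)) = 0" using dec[of "Suc k"] by simp
    then show ?thesis using True by simp
  next
    case False
    then have "real (m (Suc k) - 1) = real (m (Suc k)) - 1" by (simp add: of_nat_diff)
    moreover have "min (m (Suc k) - 1) n = m (Suc k) - 1" "min (m (Suc k)) n = m (Suc k)" using le[of "Suc k"] by auto
    ultimately show ?thesis by simp
  qed
  finally show ?thesis unfolding genN_def using 1 by simp
qed

text \<open>On the chain the functional is the time integral of the scaled coordinate martingale
  \<open>D\<close>. Its \<open>L^1\<close> norm is small uniformly for times up to \<open>t\<close>,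
  because a jump changes the coordinate by at most 1; the extra factor \<open>t\<close> is the
  length of the interval.\<close>

lemma flowF_expectation:
  assumes t: "0 < t"
  shows "(\<integral>x. \<bar>flowF lam q t k (Y x)\<bar> \<partial>M) \<le> t * ((1 + (lam + 1) * t) / sqrt (real n))"
proof -
  interpret ps: pair_sigma_finite M lborel ..
  define f where "f m = real (min (m (Suc k)) n)" for m :: "nat \<Rightarrow> nat"
  have fb: "\<bar>f m\<bar> \<le> real n" for m by (simp add: f_def)
  have up: "\<bar>f (m(Suc j := Suc (m (Suc j)))) - f m\<bar> \<le> 1" for m j by (auto simp: f_def min_def)
  have dn: "\<bar>f (m(Suc j := m (Suc j) - 1)) - f m\<bar> \<le> 1" for m j by (auto simp: f_def min_def of_nat_diff)
  define K where "K = real n * (lam + 1) * (2 * real n)"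
  have K: "\<bar>genS f m\<bar> \<le> K" for m unfolding K_def by (rule genS_bound[OF fb])
  have K0: "0 \<le> K" using K[of undefined] by linarith
  define D where "D x s = (f (Z x s) - f (Z x 0) - (LINT r:{0..s}|lborel. genS f (Z x r))) / real n" for x s
  have E: "integrable M (\<lambda>x. \<bar>D x s\<bar>)" "(\<integral>x. \<bar>D x s\<bar> \<partial>M) \<le> (1 + (lam + 1) * t) / sqrt (real n)" if s: "s \<in> {0..t}" for s
  proof -
    have s0: "0 \<le> s" using s by simp
    have *: "integrable M (\<lambda>x. \<bar>D x s\<bar>)" "(\<integral>x. \<bar>D x s\<bar> \<partial>M) \<le> (1 + (lam + 1) * 1\<^sup>2 * s) / sqrt (real n)"
      unfolding D_def using scaled_martingale_L1[OF fb s0 up dn] unfolding genS_Z by auto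
    have "(1 + (lam + 1) * 1\<^sup>2 * s) / sqrt (real n) \<le> (1 + (lam + 1) * t) / sqrt (real n)"
      using s lam by (intro divide_right_mono add_left_mono) (auto intro!: mult_left_mono)
    then show "integrable M (\<lambda>x. \<bar>D x s\<bar>)" "(\<integral>x. \<bar>D x s\<bar> \<partial>M) \<le> (1 + (lam + 1) * t) / sqrt (real n)"
      using * by auto
  qed
  have mI: "(\<lambda>s. LINT r:{0..s}|lborel. genS f (Z x r)) \<in> borel_measurable borel" for x
    by (rule integral_upto_measurable[OF Z_path_measurable])
  have Ib: "\<bar>LINT r:{0..s}|lborel. genS f (Z x r)\<bar> \<le> K * t" if "s \<in> {0..t}" for x s
  proof -
    have "\<bar>LINT r:{0..s}|lborel. genS f (Z x r)\<bar> \<le> K * (s - 0)"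
      by (rule integral_Z_bound[of "genS f", OF K]) (use that in auto)
    also have "\<dots> \<le> K * t" using that K0 by (intro mult_left_mono) auto
    finally show ?thesis .
  qed
  have Db: "\<bar>D x s\<bar> \<le> (2 * real n + K * t) / real n" if "s \<in> {0..t}" for x s
    using fb[of "Z x s"] fb[of "Z x 0"] Ib[OF that, of x] unfolding D_def abs_divide
    by (simp add: divide_right_mono)
  have Dm: "(\<lambda>s. D x s) \<in> borel_measurable borel" for x
    unfolding D_def by (intro borel_measurable_divide borel_measurable_diff Z_path_measurable mI borel_measurable_const)
  have Dpair[measurable]: "(\<lambda>z. D (fst z) (snd z)) \<in> borel_measurable (M \<Otimes>\<^sub>M lborel)"
  proof -
    have m1: "(\<lambda>z. g (Z (fst z) (snd z))) \<in> borel_measurable (M \<Otimes>\<^sub>M lborel)" for g :: "_ \<Rightarrow> real"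
      by (rule Z_pair_measurable)
    have m2: "(\<lambda>z. f (Z (fst z) 0)) \<in> borel_measurable (M \<Otimes>\<^sub>M lborel)"
      by (rule measurable_compose[OF measurable_fst Z_measurable])
    have m3: "(\<lambda>z. LINT s:{0..snd z}|lborel. genS f (Z (fst z) s)) \<in> borel_measurable (M \<Otimes>\<^sub>M lborel)"
      unfolding set_lebesgue_integral_def
    proof (rule lborel.borel_measurable_lebesgue_integral)
      have p: "(\<lambda>w. (fst (fst w), snd w)) \<in> (M \<Otimes>\<^sub>M lborel) \<Otimes>\<^sub>M lborel \<rightarrow>\<^sub>M M \<Otimes>\<^sub>M (lborel :: real measure)" by measurable
      have [measurable]: "(\<lambda>w. genS f (Z (fst (fst w)) (snd w))) \<in> borel_measurable ((M \<Otimes>\<^sub>M (lborel :: real measure)) \<Otimes>\<^sub>M lborel)"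
        using measurable_compose[OF p m1[of "genS f"]] by simp
      have "(\<lambda>w. if 0 \<le> snd w \<and> snd w \<le> snd (fst w) then genS f (Z (fst (fst w)) (snd w)) else 0)
         \<in> borel_measurable ((M \<Otimes>\<^sub>M (lborel :: real measure)) \<Otimes>\<^sub>M lborel)" by measurable
      then show "(\<lambda>(z, s). indicator {0..snd z} s *\<^sub>R genS f (Z (fst z) s)) \<in> borel_measurable ((M \<Otimes>\<^sub>M lborel) \<Otimes>\<^sub>M lborel)"
        by (rule measurable_cong[THEN iffD1, rotated]) (auto simp: indicator_def)
    qed
    show ?thesis unfolding D_def using m1[of f] m2 m3
      by (intro borel_measurable_divide borel_measurable_diff) auto
  qed
  have path: "flowF lam q t k (Y x) = (LINT s:{0..t}|lborel. D x s)" for x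
  proof -
    define a where "a s = genS f (Z x s)" for s
    have am: "a \<in> borel_measurable borel" unfolding a_def by (rule Z_path_measurable)
    have ab: "\<bar>a s\<bar> \<le> K" for s unfolding a_def by (rule K)
    have ts: "\<bar>t - s\<bar> \<le> t" if "s \<in> {0..t}" for s using that by auto
    have i0: "set_integrable lborel {0..t} (\<lambda>s. (t - s) * (real (Z x s j) / real n) * g (toO (Z x s)))" if "\<And>w. \<bar>g w\<bar> \<le> C" for j g C
      by (rule Z_integrand_integrable[where C=t]) (use that ts in auto)
    have pwb: "\<bar>pw q (w (Suc (Suc k))) - pw q (w (Suc k))\<bar> \<le> 1" for w
      using pw_range[OF q, of "w (Suc (Suc k))"] pw_range[OF q, of "w (Suc k)"] by linarith
    have id: "set_integrable lborel {0..t} (\<lambda>s. (t - s) * (real (Z x s 0) / real n) * (pw q (toO (Z x s) (Suc (Suc k))) - pw q (toO (Z x s) (Suc k))))"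
      by (rule i0[of "\<lambda>w. pw q (w (Suc (Suc k))) - pw q (w (Suc k))", OF pwb])
    have i1: "set_integrable lborel {0..t} (\<lambda>s. (t - s) * (real (Z x s j) / real n) * 1)" for j
      by (rule i0[of "\<lambda>_. 1" 1]) simp
    \<comment> \<open>The one-term sum over \<open>j < Suc 0\<close> brings the expression into the
      form of \<open>set_integral_combination\<close>.\<close>
    have comb: "- lam * (occF t (\<lambda>s. t - s) k (\<lambda>_. 1) (Y x) - occF t (\<lambda>s. t - s) (Suc k) (\<lambda>_. 1) (Y x))
     + occF t (\<lambda>s. t - s) 0 (\<lambda>w. pw q (w (Suc (Suc k))) - pw q (w (Suc k))) (Y x)
       = (LINT s:{0..t}|lborel. - (a s / real n) * (t - s))"
    proof -
      have "- lam * (occF t (\<lambda>s. t - s) k (\<lambda>_. 1) (Y x) - occF t (\<lambda>s. t - s) (Suc k) (\<lambda>_. 1) (Y x))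
        + occF t (\<lambda>s. t - s) 0 (\<lambda>w. pw q (w (Suc (Suc k))) - pw q (w (Suc k))) (Y x)
        = (\<Sum>j<Suc 0. - lam * ((LINT s:{0..t}|lborel. (t - s) * (real (Z x s k) / real n) * 1) - (LINT s:{0..t}|lborel. (t - s) * (real (Z x s (Suc k)) / real n) * 1)))
        + (LINT s:{0..t}|lborel. (t - s) * (real (Z x s 0) / real n) * (pw q (toO (Z x s) (Suc (Suc k))) - pw q (toO (Z x s) (Suc k))))"
        by (subst (1 2 3) Y_occF) auto
      also have "\<dots> = (LINT s:{0..t}|lborel. (\<Sum>j<Suc 0. - lam * ((t - s) * (real (Z x s k) / real n) * 1 - (t - s) * (real (Z x s (Suc k)) / real n) * 1))
        + (t - s) * (real (Z x s 0) / real n) * (pw q (toO (Z x s) (Suc (Suc k))) - pw q (toO (Z x s) (Suc k))))"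
        by (rule set_integral_combination[OF i1 i1 id])
      also have "\<dots> = (LINT s:{0..t}|lborel. - (a s / real n) * (t - s))"
      proof (rule set_lebesgue_integral_cong, simp, intro allI impI)
        fix s
        have z0: "real (Z x s 0) / real n = 1" using Z_Sn[of x s] n by (simp add: Sn_def)
        have "a s = lam * (real (Z x s k) - real (Z x s (Suc k))) - real n * ((1 - q) ^ Z x s (Suc (Suc k)) - (1 - q) ^ Z x s (Suc k))"
          unfolding a_def genS_def f_def[abs_def] using genN_coordinate[OF Z_Sn[of x s], of k] Z_Sn[of x s] by simp
        then have an: "a s / real n = lam * (real (Z x s k) / real n - real (Z x s (Suc k)) / real n)
            - ((1 - q) ^ Z x s (Suc (Suc k)) - (1 - q) ^ Z x s (Suc k))"
          using n by (simp add: field_simps)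
        have p: "pw q (toO (Z x s) (Suc i)) = (1 - q) ^ Z x s (Suc i)" for i by (simp add: toO_def pw_def)
        have alg: "(\<Sum>j<Suc 0. - lam * ((t - s) * \<alpha> * 1 - (t - s) * \<beta> * 1)) + (t - s) * 1 * (\<gamma> - \<delta>)
            = - (lam * (\<alpha> - \<beta>) - (\<gamma> - \<delta>)) * (t - s)" for \<alpha> \<beta> \<gamma> \<delta> :: real
          by (simp add: algebra_simps)
        show "(\<Sum>j<Suc 0. - lam * ((t - s) * (real (Z x s k) / real n) * 1 - (t - s) * (real (Z x s (Suc k)) / real n) * 1))
          + (t - s) * (real (Z x s 0) / real n) * (pw q (toO (Z x s) (Suc (Suc k))) - pw q (toO (Z x s) (Suc k))) = - (a s / real n) * (t - s)"
          unfolding z0 an p by (rule alg)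
      qed
      finally show ?thesis .
    qed
    \<comment> \<open>With \<open>t - s\<close> read as the integral of 1 over
      \<open>{s..t}\<close>, Fubini on the triangle undoes the weight.\<close>
    have tri: "(LINT s:{0..t}|lborel. - (a s / real n) * (t - s)) = (LINT s:{0..t}|lborel. - (LINT r:{0..s}|lborel. a r) / real n)"
    proof -
      have "(LINT s:{0..t}|lborel. a s * (t - s)) = (LINT r:{0..t}|lborel. a r * (LINT s:{r..t}|lborel. 1))"
        by (rule set_lebesgue_integral_cong) (auto simp: set_integral_const)
      also have "\<dots> = (LINT s:{0..t}|lborel. 1 * (LINT r:{0..s}|lborel. a r))"
        by (rule bounded_triangle_Fubini[OF am, of "\<lambda>_. 1" t K 1]) (use ab in auto)
      finally have eq: "(LINT s:{0..t}|lborel. a s * (t - s)) = (LINT s:{0..t}|lborel. LINT r:{0..s}|lborel. a r)" by simp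
      have "(LINT s:{0..t}|lborel. - (a s / real n) * (t - s)) = (LINT s:{0..t}|lborel. (- 1 / real n) * (a s * (t - s)))"
        by (rule set_lebesgue_integral_cong) auto
      also have "\<dots> = (- 1 / real n) * (LINT s:{0..t}|lborel. a s * (t - s))" by (rule set_integral_mult_right)
      also have "\<dots> = (LINT s:{0..t}|lborel. (- 1 / real n) * (LINT r:{0..s}|lborel. a r))"
        unfolding eq by (rule set_integral_mult_right[symmetric])
      also have "\<dots> = (LINT s:{0..t}|lborel. - (LINT r:{0..s}|lborel. a r) / real n)"
        by (rule set_lebesgue_integral_cong) auto
      finally show ?thesis .
    qed
    have fst1: "occF t (\<lambda>_. 1) (Suc k) (\<lambda>_. 1) (Y x) - t * fst (Y x) 0 (Suc k) = (LINT s:{0..t}|lborel. (f (Z x s) - f (Z x 0)) / real n)"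
    proof -
      have fz: "f (Z x s) = real (Z x s (Suc k))" for s using Z_le_n[of x s "Suc k"] by (simp add: f_def min_def)
      have "(LINT s:{0..t}|lborel. (f (Z x s) - f (Z x 0)) / real n) = (LINT s:{0..t}|lborel. f (Z x s) / real n - f (Z x 0) / real n)"
        by (simp add: diff_divide_distrib)
      also have "\<dots> = (LINT s:{0..t}|lborel. f (Z x s) / real n) - (LINT s:{0..t}|lborel. f (Z x 0) / real n)"
      proof (rule set_integral_diff(2))
        show "set_integrable lborel {0..t} (\<lambda>s. f (Z x s) / real n)"
          by (rule integral_Z_integrable[of "\<lambda>m. f m / real n" 1]) (use fb n in \<open>simp add: divide_le_eq abs_divide\<close>)
        show "set_integrable lborel {0..t} (\<lambda>s. f (Z x 0) / real n)"
          by (rule bounded_set_integrable[where B="\<bar>f (Z x 0) / real n\<bar>"]) auto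
      qed
      also have "(LINT s:{0..t}|lborel. f (Z x 0) / real n) = t * fst (Y x) 0 (Suc k)"
        using t unfolding fz by (subst set_integral_const) (auto simp: Y_def uOf_def Z_eq)
      finally show ?thesis unfolding fz Y_occF[OF borel_measurable_const] by simp
    qed
    have "flowF lam q t k (Y x) = (LINT s:{0..t}|lborel. (f (Z x s) - f (Z x 0)) / real n) + (LINT s:{0..t}|lborel. - (LINT r:{0..s}|lborel. a r) / real n)"
      unfolding flowF_def fst1[symmetric] tri[symmetric] comb[symmetric] by simp
    also have "\<dots> = (LINT s:{0..t}|lborel. (f (Z x s) - f (Z x 0)) / real n + - (LINT r:{0..s}|lborel. a r) / real n)"
    proof (rule set_integral_add(2)[symmetric])
      show "set_integrable lborel {0..t} (\<lambda>s. (f (Z x s) - f (Z x 0)) / real n)"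
      proof (rule bounded_set_integrable[where B="2 * real n / real n"])
        show "(\<lambda>s. (f (Z x s) - f (Z x 0)) / real n) \<in> borel_measurable borel"
          by (rule Z_path_measurable[of "\<lambda>m. (f m - f (Z x 0)) / real n"])
        have "\<bar>f (Z x s) - f (Z x 0)\<bar> \<le> 2 * real n" for s using fb[of "Z x s"] fb[of "Z x 0"] by linarith
        from divide_right_mono[OF this, of "real n"]
        show "\<bar>(f (Z x s) - f (Z x 0)) / real n\<bar> \<le> 2 * real n / real n" for s
          unfolding abs_divide by simp
      qed
      show "set_integrable lborel {0..t} (\<lambda>s. - (LINT r:{0..s}|lborel. a r) / real n)"
      proof (rule bounded_set_integrable[where B="K * t / real n"])
        show "(\<lambda>s. - (LINT r:{0..s}|lborel. a r) / real n) \<in> borel_measurable borel"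
          unfolding a_def by (intro borel_measurable_divide borel_measurable_uminus mI) simp
        show "\<bar>- (LINT r:{0..s}|lborel. a r) / real n\<bar> \<le> K * t / real n" if "s \<in> {0..t}" for s
          using Ib[OF that, of x] unfolding a_def by (simp add: abs_divide divide_right_mono)
      qed
    qed
    also have "\<dots> = (LINT s:{0..t}|lborel. D x s)"
      unfolding D_def a_def by (simp add: diff_divide_distrib)
    finally show ?thesis .
  qed
  have int: "integrable (M \<Otimes>\<^sub>M lborel) (\<lambda>(x, s). indicator {0..t} s *\<^sub>R \<bar>D x s\<bar>)"
  proof -
    have "integrable (M \<Otimes>\<^sub>M lborel) (\<lambda>z. indicator (space M \<times> {0..t}) z *\<^sub>R \<bar>D (fst z) (snd z)\<bar>)"
    proof (rule integrableI_bounded_set_indicator)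
      show "emeasure (M \<Otimes>\<^sub>M lborel) (space M \<times> {0..t}) < \<infinity>"
        by (subst lborel.emeasure_pair_measure_Times) (auto simp: emeasure_space_1 emeasure_lborel_Icc_eq)
      show "AE z in M \<Otimes>\<^sub>M lborel. z \<in> space M \<times> {0..t} \<longrightarrow> norm \<bar>D (fst z) (snd z)\<bar> \<le> (2 * real n + K * t) / real n"
        using Db by (intro AE_I2) auto
    qed auto
    moreover have "integrable (M \<Otimes>\<^sub>M lborel) (\<lambda>z. indicator (space M \<times> {0..t}) z *\<^sub>R \<bar>D (fst z) (snd z)\<bar>) \<longleftrightarrow>
       integrable (M \<Otimes>\<^sub>M lborel) (\<lambda>(x, s). indicator {0..t} s *\<^sub>R \<bar>D x s\<bar>)"
      by (rule Bochner_Integration.integrable_cong) (auto simp: space_pair_measure indicator_def)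
    ultimately show ?thesis by blast
  qed
  have "(\<integral>x. \<bar>flowF lam q t k (Y x)\<bar> \<partial>M) \<le> (\<integral>x. (LINT s|lborel. indicator {0..t} s *\<^sub>R \<bar>D x s\<bar>) \<partial>M)"
  proof (rule integral_mono')
    show "integrable M (\<lambda>x. LINT s|lborel. indicator {0..t} s *\<^sub>R \<bar>D x s\<bar>)"
      using ps.integrable_fst'[OF int] by simp
    fix x
    have "set_integrable lborel {0..t} (D x)" by (rule bounded_set_integrable[OF Dm Db])
    from set_integral_norm_bound[OF this]
    show "\<bar>flowF lam q t k (Y x)\<bar> \<le> (LINT s|lborel. indicator {0..t} s *\<^sub>R \<bar>D x s\<bar>)"
      unfolding path by (simp add: set_lebesgue_integral_def)
  qed (auto intro!: integral_nonneg)
  also have "\<dots> = (LINT s|lborel. (\<integral>x. indicator {0..t} s *\<^sub>R \<bar>D x s\<bar> \<partial>M))"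
    using ps.Fubini_integral[OF int] by simp
  also have "\<dots> \<le> (LINT s|lborel. indicator {0..t} s *\<^sub>R ((1 + (lam + 1) * t) / sqrt (real n)))"
  proof (rule integral_mono')
    show "integrable lborel (\<lambda>s. indicator {0..t} s *\<^sub>R ((1 + (lam + 1) * t) / sqrt (real n)))"
      using bounded_set_integrable[of "\<lambda>_. (1 + (lam + 1) * t) / sqrt (real n)" 0 t "\<bar>(1 + (lam + 1) * t) / sqrt (real n)\<bar>"]
      by (simp add: set_integrable_def)
    show "(\<integral>x. indicator {0..t} s *\<^sub>R \<bar>D x s\<bar> \<partial>M) \<le> indicator {0..t} s *\<^sub>R ((1 + (lam + 1) * t) / sqrt (real n))" for s
      using E(2)[of s] by (auto simp: indicator_def)
    show "0 \<le> indicator {0..t} s *\<^sub>R ((1 + (lam + 1) * t) / sqrt (real n))" for s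
      using lam t by (auto simp: indicator_def)
  qed
  also have "\<dots> = t * ((1 + (lam + 1) * t) / sqrt (real n))"
    using set_integral_const[of "{0..t}" lborel "(1 + (lam + 1) * t) / sqrt (real n)"] t
    by (simp add: set_lebesgue_integral_def)
  finally show ?thesis .
qed

end

text \<open>A nonnegative continuous functional whose expectations tend to 0 has expectation 0 under
  the limit law. Every passage to the limit in distribution goes through here.\<close>

lemma conv_dist_AE_zero:
  fixes M :: "nat \<Rightarrow> 'a measure" and P :: "'b measure"
  assumes conv: "conv_dist M W P V" and F: "Ftest F" and pos: "\<And>p. 0 \<le> F p" and P: "prob_space P"
    and V: "\<And>x. V x \<in> Dsp \<times> Lset" and bound: "\<And>j. (\<integral>x. F (W j x) \<partial>M j) \<le> c j" and c: "c \<longlonglongrightarrow> 0"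
  shows "AE x in P. F (V x) = 0"
proof -
  interpret prob_space P by fact
  have m: "(\<lambda>x. F (V x)) \<in> borel_measurable P" and l: "(\<lambda>j. \<integral>x. F (W j x) \<partial>M j) \<longlonglongrightarrow> (\<integral>x. F (V x) \<partial>P)"
    using conv F unfolding conv_dist_def by blast+
  have "bounded (F ` (Dsp \<times> Lset))" using F by (simp add: Ftest_def)
  then obtain B where B: "\<And>p. p \<in> Dsp \<times> Lset \<Longrightarrow> \<bar>F p\<bar> \<le> B"
    unfolding bounded_iff by (metis imageI real_norm_def)
  have i: "integrable P (\<lambda>x. F (V x))"
    by (rule integrable_const_bound[of _ B]) (use B V m in auto)
  have "(\<integral>x. F (V x) \<partial>P) \<le> 0"
    by (rule LIMSEQ_le[OF l c]) (use bound in auto)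
  moreover have "0 \<le> (\<integral>x. F (V x) \<partial>P)" using pos by simp
  ultimately have "(\<integral>x. F (V x) \<partial>P) = 0" by simp
  then show ?thesis using integral_nonneg_eq_0_iff_AE[OF i] pos by simp
qed

section \<open>Disintegration of the limiting occupation measure\<close>

lemma OmegaS_antimono: "w \<in> OmegaS \<Longrightarrow> i \<le> j \<Longrightarrow> w j \<le> w i"
  by (rule lift_Suc_antimono_le[of w]) (auto simp: OmegaS_def)

lemma countable_OmegaS: "countable OmegaS"
proof -
  \<comment> \<open>A finite list codes the sequence that repeats its last entry for ever.\<close>
  define F :: "enat list \<Rightarrow> nat \<Rightarrow> enat" where "F xs k = (if k < length xs then xs ! k else last xs)" for xs k
  have "OmegaS \<subseteq> range F"
  proof
    fix w assume w: "w \<in> OmegaS"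
    \<comment> \<open>Extended naturals are well-ordered, so the range has a least value; a
      nonincreasing sequence stays at it once it is reached.\<close>
    define e where "e = (LEAST e. e \<in> range w)"
    have "e \<in> range w" unfolding e_def by (rule LeastI[of _ "w 0"]) simp
    then obtain K where K: "w K = e" by auto
    have tail: "w k = w K" if "K \<le> k" for k
    proof (rule antisym)
      show "w k \<le> w K" by (rule OmegaS_antimono[OF w that])
      show "w K \<le> w k" unfolding K e_def by (rule Least_le) simp
    qed
    have "F (map w [0..<Suc K]) k = w k" for k
    proof (cases "k < Suc K")
      case True
      then show ?thesis unfolding F_def by (simp del: upt_Suc)
    next
      case False
      then show ?thesis using tail[of k] by (simp add: F_def)
    qed
    then have "F (map w [0..<Suc K]) = w" by (rule ext)
    then show "w \<in> range F" by (metis rangeI)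
  qed
  then show ?thesis by (rule countable_subset) simp
qed

text \<open>Makes the enumeration a bijection with all of \<open>nat\<close>, so that sums over
  states become series.\<close>

lemma infinite_OmegaS: "infinite OmegaS"
proof -
  define F :: "nat \<Rightarrow> nat \<Rightarrow> enat" where "F n k = (if k = 0 then \<infinity> else enat n)" for n k
  have "inj F"
  proof (rule injI)
    fix m n assume "F m = F n"
    then have "F m 1 = F n 1" by simp
    then show "m = n" by (simp add: F_def)
  qed
  moreover have "range F \<subseteq> OmegaS" by (auto simp: F_def OmegaS_def)
  ultimately show ?thesis using infinite_iff_countable_subset by blast
qed

definition enumO :: "nat \<Rightarrow> nat \<Rightarrow> enat" where "enumO = from_nat_into OmegaS"

lemma bij_enumO: "bij_betw enumO UNIV OmegaS"
  unfolding enumO_def by (rule bij_betw_from_nat_into[OF countable_OmegaS infinite_OmegaS])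

lemma enumO_in: "enumO n \<in> OmegaS" using bij_enumO by (auto simp: bij_betw_def)
lemma inj_enumO: "inj enumO" using bij_enumO by (auto simp: bij_betw_def)
lemma enumO_ex: "w \<in> OmegaS \<Longrightarrow> \<exists>n. enumO n = w" using bij_enumO by (force simp: bij_betw_def)

abbreviation topO :: "nat \<Rightarrow> enat" where "topO \<equiv> (\<lambda>_. \<infinity>)"

lemma topO_in: "topO \<in> OmegaS" by (simp add: OmegaS_def)

text \<open>Each slice \<open>{0..} \<times> {enumO n}\<close> has a time marginal dominated by that
  of the whole measure, which is Lebesgue measure; Radon-Nikodym applies, and the densities of the
  countably many slices add up to that of the whole.\<close>

lemma Lset_densities:
  assumes \<mu>: "\<mu> \<in> Lset"
  obtains p :: "nat \<Rightarrow> real \<Rightarrow> ennreal" where "\<And>n. p n \<in> borel_measurable borel"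
    "\<And>n. distr (density \<mu> (indicator ({0..} \<times> {enumO n}))) borel fst = density lborel (p n)"
    "AE s in lborel. (\<Sum>n. p n s) = indicator {0..} s"
proof -
  have f[measurable]: "fst \<in> \<mu> \<rightarrow>\<^sub>M borel" by (rule fst_measurable_Lset[OF \<mu>])
  have S[measurable]: "{0..} \<times> B \<in> sets \<mu>" for B by (rule strip_sets[OF \<mu>]) simp
  define \<nu> where "\<nu> n = distr (density \<mu> (indicator ({0..} \<times> {enumO n}))) borel fst" for n
  have em: "emeasure (distr (density \<mu> (indicator ({0..} \<times> B))) borel fst) A = emeasure \<mu> ((A \<inter> {0..}) \<times> B)"
    if [measurable]: "A \<in> sets borel" for A B
  proof -
    have v: "fst -` A \<inter> space \<mu> \<in> sets \<mu>" by measurable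
    have "emeasure (distr (density \<mu> (indicator ({0..} \<times> B))) borel fst) A =
        emeasure (density \<mu> (indicator ({0..} \<times> B))) (fst -` A \<inter> space \<mu>)"
      by (subst emeasure_distr) auto
    also have "\<dots> = (\<integral>\<^sup>+z. indicator ({0..} \<times> B) z * indicator (fst -` A \<inter> space \<mu>) z \<partial>\<mu>)"
      by (rule emeasure_density) (use v in auto)
    also have "\<dots> = (\<integral>\<^sup>+z. indicator ((A \<inter> {0..}) \<times> B) z \<partial>\<mu>)"
      by (rule nn_integral_cong) (auto simp: indicator_def Lset_space[OF \<mu>])
    also have "\<dots> = emeasure \<mu> ((A \<inter> {0..}) \<times> B)" by (rule nn_integral_indicator) (rule strip_sets[OF \<mu>], measurable)
    finally show ?thesis .
  qed
  have tot: "emeasure \<mu> ((A \<inter> {0..}) \<times> OmegaS) = emeasure (density lborel (indicator {0..})) A" if "A \<in> sets borel" for A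
    using em[OF that, of OmegaS] unfolding Lset_time_marginal[OF \<mu>] by simp
  have ex: "\<exists>p\<in>borel_measurable lborel. density lborel p = \<nu> n" for n
  proof (rule sigma_finite_measure.Radon_Nikodym[OF lborel.sigma_finite_measure_axioms])
    show "absolutely_continuous lborel (\<nu> n)"
      unfolding absolutely_continuous_def
    proof
      fix A :: "real set" assume A: "A \<in> null_sets lborel"
      then have As: "A \<in> sets borel" by auto
      have "emeasure (\<nu> n) A \<le> emeasure \<mu> ((A \<inter> {0..}) \<times> OmegaS)"
        unfolding \<nu>_def em[OF As] by (rule emeasure_mono) (use As enumO_in in \<open>auto intro!: strip_sets[OF \<mu>]\<close>)
      also have "\<dots> = (\<integral>\<^sup>+s. indicator {0..} s * indicator A s \<partial>lborel)"
        unfolding tot[OF As] by (rule emeasure_density) (use As in auto)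
      also have "\<dots> \<le> (\<integral>\<^sup>+s. indicator A s \<partial>lborel)"
        by (rule nn_integral_mono) (auto simp: indicator_def)
      also have "\<dots> = 0" by (subst nn_integral_indicator) (use A in auto)
      finally show "A \<in> null_sets (\<nu> n)" using As by (auto simp: null_sets_def \<nu>_def)
    qed
  qed (simp add: \<nu>_def)
  then obtain p where p: "\<And>n. p n \<in> borel_measurable lborel" "\<And>n. density lborel (p n) = \<nu> n" by metis
  have [measurable]: "p n \<in> borel_measurable borel" for n using p(1)[of n] by simp
  \<comment> \<open>Uniqueness of densities turns this equality of measures into an almost
    everywhere identity.\<close>
  have "density lborel (\<lambda>s. \<Sum>n. p n s) = density lborel (indicator {0..})"
  proof (rule measure_eqI)
    fix A :: "real set" assume "A \<in> sets (density lborel (\<lambda>s. \<Sum>n. p n s))"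
    then have A[measurable]: "A \<in> sets borel" by simp
    have "emeasure (density lborel (\<lambda>s. \<Sum>n. p n s)) A = (\<integral>\<^sup>+s. (\<Sum>n. p n s) * indicator A s \<partial>lborel)"
      by (rule emeasure_density) auto
    also have "\<dots> = (\<integral>\<^sup>+s. (\<Sum>n. p n s * indicator A s) \<partial>lborel)" by simp
    also have "\<dots> = (\<Sum>n. \<integral>\<^sup>+s. p n s * indicator A s \<partial>lborel)" by (rule nn_integral_suminf) auto
    also have "\<dots> = (\<Sum>n. emeasure (density lborel (p n)) A)"
      by (subst emeasure_density) auto
    also have "\<dots> = (\<Sum>n. emeasure \<mu> ((A \<inter> {0..}) \<times> {enumO n}))"
      unfolding p(2) \<nu>_def em[OF A] ..
    also have "\<dots> = emeasure \<mu> (\<Union>n. (A \<inter> {0..}) \<times> {enumO n})"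
    proof (rule suminf_emeasure)
      show "range (\<lambda>n. (A \<inter> {0..}) \<times> {enumO n}) \<subseteq> sets \<mu>" by (auto intro!: strip_sets[OF \<mu>])
      show "disjoint_family (\<lambda>n. (A \<inter> {0..}) \<times> {enumO n})"
        using inj_enumO by (auto simp: disjoint_family_on_def inj_def)
    qed
    also have "(\<Union>n. (A \<inter> {0..}) \<times> {enumO n}) = (A \<inter> {0..}) \<times> OmegaS"
      using enumO_in enumO_ex by force
    also have "emeasure \<mu> \<dots> = emeasure (density lborel (indicator {0..})) A" by (rule tot[OF A])
    finally show "emeasure (density lborel (\<lambda>s. \<Sum>n. p n s)) A = emeasure (density lborel (indicator {0..})) A" .
  qed simp
  then have "AE s in lborel. (\<Sum>n. p n s) = indicator {0..} s"
    by (intro sigma_finite_measure.density_unique[OF lborel.sigma_finite_measure_axioms]) auto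
  then show thesis using that[of p] p(2) unfolding \<nu>_def by simp
qed

definition disint :: "(real \<times> (nat \<Rightarrow> enat)) measure \<Rightarrow> (real \<Rightarrow> (nat \<Rightarrow> enat) pmf) \<Rightarrow> bool" where
  "disint \<mu> \<kappa> \<longleftrightarrow> (\<forall>s. set_pmf (\<kappa> s) \<subseteq> OmegaS) \<and>
     (\<forall>g (B :: real). (\<forall>w. \<bar>g w\<bar> \<le> B) \<longrightarrow> (\<lambda>s. measure_pmf.expectation (\<kappa> s) g) \<in> borel_measurable borel \<and>
       (\<forall>\<phi> C t. \<phi> \<in> borel_measurable borel \<longrightarrow> (\<forall>s. \<bar>\<phi> s\<bar> \<le> C) \<longrightarrow>
          (LINT z:strip t|\<mu>. \<phi> (fst z) * g (snd z)) = (LINT s:{0..t}|lborel. \<phi> s * measure_pmf.expectation (\<kappa> s) g)))"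

lemma expectation_bound:
  fixes g :: "'a \<Rightarrow> real"
  assumes "\<And>w. w \<in> set_pmf \<kappa> \<Longrightarrow> \<bar>g w\<bar> \<le> B"
  shows "\<bar>measure_pmf.expectation \<kappa> g\<bar> \<le> B" "integrable (measure_pmf \<kappa>) g"
proof -
  show i: "integrable (measure_pmf \<kappa>) g"
    by (rule measure_pmf.integrable_const_bound[of _ B]) (use assms in \<open>auto simp: AE_measure_pmf_iff\<close>)
  have "\<bar>measure_pmf.expectation \<kappa> g\<bar> \<le> measure_pmf.expectation \<kappa> (\<lambda>w. \<bar>g w\<bar>)" by (rule integral_abs_bound)
  also have "\<dots> \<le> measure_pmf.expectation \<kappa> (\<lambda>w. B)"
    by (rule integral_mono_AE) (use i assms in \<open>auto simp: AE_measure_pmf_iff\<close>)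
  finally show "\<bar>measure_pmf.expectation \<kappa> g\<bar> \<le> B" by simp
qed

text \<open>At times where the slice densities sum to 1 they form a probability mass function;
  elsewhere a point mass is used, which time integrals over \<open>{0..t}\<close> do not
  see.\<close>

lemma Lset_disintegration:
  assumes \<mu>: "\<mu> \<in> Lset"
  obtains \<kappa> where "disint \<mu> \<kappa>"
proof -
  obtain p where pm[measurable]: "\<And>n. p n \<in> borel_measurable borel"
    and pd: "\<And>n. distr (density \<mu> (indicator ({0..} \<times> {enumO n}))) borel fst = density lborel (p n)"
    and p1: "AE s in lborel. (\<Sum>n. p n s) = indicator {0..} s"
    by (rule Lset_densities[OF \<mu>]) (rule that)
  have f[measurable]: "fst \<in> \<mu> \<rightarrow>\<^sub>M borel" by (rule fst_measurable_Lset[OF \<mu>])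
  have S[measurable]: "{0..} \<times> B \<in> sets \<mu>" for B by (rule strip_sets[OF \<mu>]) simp
  define good where "good s \<longleftrightarrow> (\<Sum>n. p n s) = 1" for s
  have [measurable]: "Measurable.pred borel good" unfolding good_def by measurable
  \<comment> \<open>The default for times without a proper vector of densities.\<close>
  obtain n0 where n0: "enumO n0 = topO" using enumO_ex[OF topO_in] by blast
  define \<kappa>' where "\<kappa>' s = (if good s then embed_pmf (\<lambda>n. enn2real (p n s)) else return_pmf n0)" for s
  have fin: "ennreal (enn2real (p n s)) = p n s" if "good s" for s n
  proof -
    have "p n s \<le> (\<Sum>n. p n s)" by (rule sum_le_suminf[of _ "{n}", simplified]) auto
    then have "p n s \<le> 1" using that by (simp add: good_def)
    then show ?thesis by (simp add: less_top_ennreal ennreal_enn2real_if top_unique split: if_splits) (metis ennreal_one_neq_top neq_top_trans)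
  qed
  have pmf': "pmf (\<kappa>' s) n = (if good s then enn2real (p n s) else if n = n0 then 1 else 0)" for s n
  proof (cases "good s")
    case True
    have "(\<integral>\<^sup>+n. ennreal (enn2real (p n s)) \<partial>count_space UNIV) = 1"
      unfolding fin[OF True] nn_integral_count_space_nat using True by (simp add: good_def)
    then show ?thesis using True by (simp add: \<kappa>'_def pmf_embed_pmf)
  qed (auto simp: \<kappa>'_def indicator_def)
  define \<kappa> where "\<kappa> s = map_pmf enumO (\<kappa>' s)" for s
  have E: "measure_pmf.expectation (\<kappa> s) g = measure_pmf.expectation (\<kappa>' s) (\<lambda>n. g (enumO n))" for s and g :: "_ \<Rightarrow> real"
    by (simp add: \<kappa>_def)
  have nnE: "(\<integral>\<^sup>+n. g n \<partial>measure_pmf (\<kappa>' s)) = (\<Sum>n. ennreal (pmf (\<kappa>' s) n) * g n)" for s and g :: "nat \<Rightarrow> ennreal"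
    by (simp add: nn_integral_measure_pmf nn_integral_count_space_nat)
  \<comment> \<open>The formula is shown slice by slice for nonnegative integrands, where sums and
    integrals commute freely; signed ones follow by a shift.\<close>
  have main: "(\<integral>\<^sup>+z. h z * indicator (strip t) z \<partial>\<mu>) = (\<integral>\<^sup>+s. (\<integral>\<^sup>+n. h (s, enumO n) \<partial>measure_pmf (\<kappa>' s)) * indicator {0..t} s \<partial>lborel)"
    if h: "h \<in> borel_measurable SpaceL" for h :: "_ \<Rightarrow> ennreal" and t
  proof -
    have hm: "(\<lambda>s. h (s, w)) \<in> borel_measurable borel" for w
      by (rule measurable_compose[OF _ h]) (simp add: SpaceL_def)
    have hm': "h \<in> borel_measurable \<mu>" unfolding measurable_cong_sets[of \<mu> SpaceL borel borel] using h \<mu> by (simp add: Lset_def measurable_cong_sets[of \<mu> SpaceL borel borel])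
    have one: "(\<integral>\<^sup>+z. h z * indicator ({0..<t} \<times> {enumO n}) z \<partial>\<mu>) = (\<integral>\<^sup>+s. p n s * (h (s, enumO n) * indicator {..<t} s) \<partial>lborel)" for n
    proof -
      have [measurable]: "(\<lambda>s. h (s, enumO n)) \<in> borel_measurable borel" by (rule hm)
      have "(\<integral>\<^sup>+z. h z * indicator ({0..<t} \<times> {enumO n}) z \<partial>\<mu>) = (\<integral>\<^sup>+z. indicator ({0..} \<times> {enumO n}) z * (h (fst z, enumO n) * indicator {..<t} (fst z)) \<partial>\<mu>)"
        by (rule nn_integral_cong) (auto simp: indicator_def)
      also have "\<dots> = (\<integral>\<^sup>+z. h (fst z, enumO n) * indicator {..<t} (fst z) \<partial>density \<mu> (indicator ({0..} \<times> {enumO n})))"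
        by (rule nn_integral_density[symmetric]) auto
      also have "\<dots> = (\<integral>\<^sup>+s. h (s, enumO n) * indicator {..<t} s \<partial>distr (density \<mu> (indicator ({0..} \<times> {enumO n}))) borel fst)"
        by (rule nn_integral_distr[symmetric]) auto
      also have "\<dots> = (\<integral>\<^sup>+s. p n s * (h (s, enumO n) * indicator {..<t} s) \<partial>lborel)"
        unfolding pd by (rule nn_integral_density) auto
      finally show ?thesis .
    qed
    have "(\<integral>\<^sup>+z. h z * indicator (strip t) z \<partial>\<mu>) = (\<integral>\<^sup>+z. (\<Sum>n. h z * indicator ({0..<t} \<times> {enumO n}) z) \<partial>\<mu>)"
    proof (rule nn_integral_cong)
      fix z
      show "h z * indicator (strip t) z = (\<Sum>n. h z * indicator ({0..<t} \<times> {enumO n}) z)"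
      proof (cases "z \<in> strip t")
        case True
        then obtain m where m: "enumO m = snd z" using enumO_ex by fastforce
        have "(\<Sum>n. h z * indicator ({0..<t} \<times> {enumO n}) z) = (\<Sum>n\<in>{m}. h z * indicator ({0..<t} \<times> {enumO n}) z)"
          by (rule suminf_finite) (use True m inj_enumO in \<open>auto simp: indicator_def inj_def\<close>)
        then show ?thesis using True m by (auto simp: indicator_def mem_Times_iff)
      next
        case False
        then have "indicator ({0..<t} \<times> {enumO n}) z = (0 :: ennreal)" for n
          using enumO_in[of n] by (auto simp: indicator_def)
        then show ?thesis using False by simp
      qed
    qed
    also have "\<dots> = (\<Sum>n. \<integral>\<^sup>+z. h z * indicator ({0..<t} \<times> {enumO n}) z \<partial>\<mu>)"
    proof (rule nn_integral_suminf)
      have [measurable]: "{0..<t} \<times> {enumO n} \<in> sets \<mu>" for n by (rule strip_sets[OF \<mu>]) simp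
      show "(\<lambda>z. h z * indicator ({0..<t} \<times> {enumO n}) z) \<in> borel_measurable \<mu>" for n using hm' by measurable
    qed
    also have "\<dots> = (\<Sum>n. \<integral>\<^sup>+s. p n s * (h (s, enumO n) * indicator {..<t} s) \<partial>lborel)" unfolding one ..
    also have "\<dots> = (\<integral>\<^sup>+s. (\<Sum>n. p n s * (h (s, enumO n) * indicator {..<t} s)) \<partial>lborel)"
    proof (rule nn_integral_suminf[symmetric])
      show "(\<lambda>s. p n s * (h (s, enumO n) * indicator {..<t} s)) \<in> borel_measurable lborel" for n
        using hm[of "enumO n"] by measurable
    qed
    also have "\<dots> = (\<integral>\<^sup>+s. (\<integral>\<^sup>+n. h (s, enumO n) \<partial>measure_pmf (\<kappa>' s)) * indicator {0..t} s \<partial>lborel)"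
    proof (rule nn_integral_cong_AE)
      show "AE s in lborel. (\<Sum>n. p n s * (h (s, enumO n) * indicator {..<t} s)) = (\<integral>\<^sup>+n. h (s, enumO n) \<partial>measure_pmf (\<kappa>' s)) * indicator {0..t} s"
        using p1 AE_lborel_singleton[of t]
      proof eventually_elim
        case (elim s)
        show ?case
        proof (cases "0 \<le> s")
          case True
          then have g: "good s" using elim by (simp add: good_def)
          have ind: "(indicator {..<t} s :: ennreal) = indicator {0..t} s" using True elim by (auto simp: indicator_def)
          show ?thesis unfolding nnE pmf' ind using g fin[OF g] by (simp add: mult.assoc[symmetric])
        next
          case False
          then have "(\<Sum>n. p n s) = 0" using elim by simp
          then have "p n s = 0" for n by (simp add: suminf_eq_zero_iff)
          then show ?thesis using False by (simp add: indicator_def)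
        qed
      qed
    qed
    finally show ?thesis .
  qed
  have "disint \<mu> \<kappa>"
    unfolding disint_def
  proof (intro conjI allI impI)
    show "set_pmf (\<kappa> s) \<subseteq> OmegaS" for s by (auto simp: \<kappa>_def enumO_in)
  next
    fix g :: "(nat \<Rightarrow> enat) \<Rightarrow> real" and B assume g: "\<forall>w. \<bar>g w\<bar> \<le> B"
    have B0: "0 \<le> B" using g[rule_format, of topO] by linarith
    have Eg: "\<bar>measure_pmf.expectation (\<kappa> s) g\<bar> \<le> B" "integrable (measure_pmf (\<kappa>' s)) (\<lambda>n. g (enumO n))" for s
      using expectation_bound[of "\<kappa> s" g B] expectation_bound[of "\<kappa>' s" "\<lambda>n. g (enumO n)" B] g by auto
    have nn: "(\<integral>\<^sup>+n. ennreal (a * g (enumO n) + b) \<partial>measure_pmf (\<kappa>' s)) = ennreal (a * measure_pmf.expectation (\<kappa> s) g + b)"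
      if "\<bar>a\<bar> * B \<le> b" for a b s
    proof -
      have "0 \<le> a * g w + b" for w
      proof -
        have "\<bar>a * g w\<bar> \<le> \<bar>a\<bar> * B" unfolding abs_mult using g by (intro mult_left_mono) auto
        then show ?thesis using that by linarith
      qed
      then have "(\<integral>\<^sup>+n. ennreal (a * g (enumO n) + b) \<partial>measure_pmf (\<kappa>' s)) = ennreal (measure_pmf.expectation (\<kappa>' s) (\<lambda>n. a * g (enumO n) + b))"
        by (intro nn_integral_eq_integral) (use Eg(2) in auto)
      then show ?thesis using Eg(2) unfolding E by simp
    qed
    show Em: "(\<lambda>s. measure_pmf.expectation (\<kappa> s) g) \<in> borel_measurable borel"
    proof -
      have "(\<lambda>s. \<Sum>n. ennreal (pmf (\<kappa>' s) n) * ennreal (1 * g (enumO n) + B)) \<in> borel_measurable borel"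
        unfolding pmf' by measurable
      then have "(\<lambda>s. enn2real (ennreal (1 * measure_pmf.expectation (\<kappa> s) g + B)) - B) \<in> borel_measurable borel"
        unfolding nnE[symmetric] by (subst (asm) nn) auto
      moreover have "enn2real (ennreal (1 * measure_pmf.expectation (\<kappa> s) g + B)) - B = measure_pmf.expectation (\<kappa> s) g" for s
        using Eg(1)[of s] by simp
      ultimately show ?thesis by simp
    qed
    fix \<phi> :: "real \<Rightarrow> real" and C t assume \<phi>[measurable]: "\<phi> \<in> borel_measurable borel" and C: "\<forall>s. \<bar>\<phi> s\<bar> \<le> C"
    have C0: "0 \<le> C" using C[rule_format, of 0] by linarith
    \<comment> \<open>Adding this bound makes the integrands on both sides nonnegative; it is
      removed at the end.\<close>
    define K where "K = C * B"
    have K: "\<bar>\<phi> s\<bar> * B \<le> K" for s unfolding K_def using C B0 by (intro mult_right_mono) auto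
    have K0: "0 \<le> K" using C0 B0 by (simp add: K_def)
    have pK: "\<bar>\<phi> s * y\<bar> \<le> K" if "\<bar>y\<bar> \<le> B" for s y
    proof -
      have "\<bar>\<phi> s * y\<bar> \<le> \<bar>\<phi> s\<bar> * B" unfolding abs_mult using that by (intro mult_left_mono) auto
      then show ?thesis using K[of s] by linarith
    qed
    have hm: "(\<lambda>z. \<phi> (fst z) * g (snd z)) \<in> borel_measurable SpaceL"
      by (intro borel_measurable_times fst_measurable_SpaceL snd_measurable_SpaceL \<phi>)
    have i1: "set_integrable \<mu> (strip t) (\<lambda>z. \<phi> (fst z) * g (snd z))"
      by (rule strip_integrable[OF \<mu> hm, of _ K]) (use pK g in auto)
    have i1': "set_integrable \<mu> (strip t) (\<lambda>z. K)"
      by (rule strip_integrable[OF \<mu>, of _ _ "\<bar>K\<bar>"]) auto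
    have i2: "set_integrable lborel {0..t} (\<lambda>s. \<phi> s * measure_pmf.expectation (\<kappa> s) g)"
      by (rule bounded_set_integrable[where B=K]) (use pK Eg Em in auto)
    have i2': "set_integrable lborel {0..t} (\<lambda>s. K)"
      by (rule bounded_set_integrable[where B="\<bar>K\<bar>"]) auto
    have "ennreal (LINT z:strip t|\<mu>. \<phi> (fst z) * g (snd z) + K) = (\<integral>\<^sup>+z. ennreal (\<phi> (fst z) * g (snd z) + K) * indicator (strip t) z \<partial>\<mu>)"
    proof -
      have "(\<integral>\<^sup>+z. ennreal (indicator (strip t) z *\<^sub>R (\<phi> (fst z) * g (snd z) + K)) \<partial>\<mu>) = ennreal (LINT z:strip t|\<mu>. \<phi> (fst z) * g (snd z) + K)"
        unfolding set_lebesgue_integral_def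
      proof (rule nn_integral_eq_integral)
        show "integrable \<mu> (\<lambda>z. indicator (strip t) z *\<^sub>R (\<phi> (fst z) * g (snd z) + K))"
          using set_integral_add(1)[OF i1 i1'] by (simp add: set_integrable_def)
        have "0 \<le> \<phi> (fst z) * g (snd z) + K" for z using pK[of "g (snd z)" "fst z"] g by (auto simp: abs_le_iff)
        then show "AE z in \<mu>. 0 \<le> indicator (strip t) z *\<^sub>R (\<phi> (fst z) * g (snd z) + K)" by simp
      qed
      moreover have "(\<integral>\<^sup>+z. ennreal (indicator (strip t) z *\<^sub>R (\<phi> (fst z) * g (snd z) + K)) \<partial>\<mu>) = (\<integral>\<^sup>+z. ennreal (\<phi> (fst z) * g (snd z) + K) * indicator (strip t) z \<partial>\<mu>)"
        by (rule nn_integral_cong) (auto simp: indicator_def)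
      ultimately show ?thesis by simp
    qed
    also have "\<dots> = (\<integral>\<^sup>+s. (\<integral>\<^sup>+n. ennreal (\<phi> s * g (enumO n) + K) \<partial>measure_pmf (\<kappa>' s)) * indicator {0..t} s \<partial>lborel)"
      by (subst main) (use hm in auto)
    also have "\<dots> = (\<integral>\<^sup>+s. ennreal (indicator {0..t} s *\<^sub>R (\<phi> s * measure_pmf.expectation (\<kappa> s) g + K)) \<partial>lborel)"
      by (rule nn_integral_cong) (use nn[OF K] in \<open>auto simp: indicator_def\<close>)
    also have "\<dots> = ennreal (LINT s:{0..t}|lborel. \<phi> s * measure_pmf.expectation (\<kappa> s) g + K)"
      unfolding set_lebesgue_integral_def
    proof (rule nn_integral_eq_integral)
      show "integrable lborel (\<lambda>s. indicator {0..t} s *\<^sub>R (\<phi> s * measure_pmf.expectation (\<kappa> s) g + K))"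
        using set_integral_add(1)[OF i2 i2'] by (simp add: set_integrable_def)
      have "0 \<le> \<phi> s * measure_pmf.expectation (\<kappa> s) g + K" for s using pK[OF Eg(1)[of s], of s] by linarith
      then show "AE s in lborel. 0 \<le> indicator {0..t} s *\<^sub>R (\<phi> s * measure_pmf.expectation (\<kappa> s) g + K)" by simp
    qed
    finally have "(LINT z:strip t|\<mu>. \<phi> (fst z) * g (snd z) + K) = (LINT s:{0..t}|lborel. \<phi> s * measure_pmf.expectation (\<kappa> s) g + K)"
    proof (subst (asm) ennreal_inj)
      have "0 \<le> \<phi> (fst z) * g (snd z) + K" for z using pK[of "g (snd z)" "fst z"] g by (auto simp: abs_le_iff)
      then show "0 \<le> (LINT z:strip t|\<mu>. \<phi> (fst z) * g (snd z) + K)"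
        unfolding set_lebesgue_integral_def by (intro Bochner_Integration.integral_nonneg) auto
      have "0 \<le> \<phi> s * measure_pmf.expectation (\<kappa> s) g + K" for s using pK[OF Eg(1)[of s], of s] by linarith
      then show "0 \<le> (LINT s:{0..t}|lborel. \<phi> s * measure_pmf.expectation (\<kappa> s) g + K)"
        unfolding set_lebesgue_integral_def by (intro Bochner_Integration.integral_nonneg) auto
    qed
    \<comment> \<open>The shift has the same integral on both sides because the strip has mass
      \<open>t\<close>; for \<open>t \<le> 0\<close> both sides are 0.\<close>
    moreover have "(LINT z:strip t|\<mu>. K) = (LINT s:{0..t}|lborel. K)"
    proof (cases "0 < t")
      case True
      have "emeasure \<mu> (strip t) = ennreal t" using \<mu> True by (simp add: Lset_def)
      then have "(LINT z:strip t|\<mu>. K) = t * K"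
        using True by (subst set_integral_const) (auto intro!: strip_sets[OF \<mu>] simp: measure_def)
      moreover have "(LINT s:{0..t}|lborel. K) = t * K" using True by (subst set_integral_const) auto
      ultimately show ?thesis by simp
    next
      case False
      have "AE s in lborel. s \<notin> {0..t}" using AE_lborel_singleton[of 0] by eventually_elim (use False in auto)
      then have "(LINT s:{0..t}|lborel. K) = 0" unfolding set_lebesgue_integral_def by (intro integral_eq_zero_AE) auto
      then show ?thesis using False by (simp add: set_lebesgue_integral_def)
    qed
    ultimately show "(LINT z:strip t|\<mu>. \<phi> (fst z) * g (snd z)) = (LINT s:{0..t}|lborel. \<phi> s * measure_pmf.expectation (\<kappa> s) g)"
      unfolding set_integral_add(2)[OF i1 i1'] set_integral_add(2)[OF i2 i2'] by simp
  qed
  then show thesis by (rule that)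
qed

text \<open>Time integrals do not see a null set. This frees the kernel to take the absorbing value
  wherever stationarity may fail.\<close>

lemma disint_modify:
  assumes d: "disint \<mu> \<kappa>" and N: "N \<in> null_sets lborel"
  shows "disint \<mu> (\<lambda>s. if s \<in> N then return_pmf topO else \<kappa> s)"
  unfolding disint_def
proof (intro conjI allI impI)
  show "set_pmf (if s \<in> N then return_pmf topO else \<kappa> s) \<subseteq> OmegaS" for s
    using d topO_in by (auto simp: disint_def)
  fix g :: "(nat \<Rightarrow> enat) \<Rightarrow> real" and B assume g: "\<forall>w. \<bar>g w\<bar> \<le> B"
  have [measurable]: "N \<in> sets borel" using N by auto
  have m[measurable]: "(\<lambda>s. measure_pmf.expectation (\<kappa> s) g) \<in> borel_measurable borel"
    using d g unfolding disint_def by blast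
  have eq: "measure_pmf.expectation (if s \<in> N then return_pmf topO else \<kappa> s) g = (if s \<in> N then g topO else measure_pmf.expectation (\<kappa> s) g)" for s
    by simp
  show m2: "(\<lambda>s. measure_pmf.expectation (if s \<in> N then return_pmf topO else \<kappa> s) g) \<in> borel_measurable borel"
    unfolding eq by measurable
  fix \<phi> :: "real \<Rightarrow> real" and C t assume \<phi>[measurable]: "\<phi> \<in> borel_measurable borel" and C: "\<forall>s. \<bar>\<phi> s\<bar> \<le> C"
  have "(LINT z:strip t|\<mu>. \<phi> (fst z) * g (snd z)) = (LINT s:{0..t}|lborel. \<phi> s * measure_pmf.expectation (\<kappa> s) g)"
    using d g \<phi> C unfolding disint_def by blast
  also have "\<dots> = (LINT s:{0..t}|lborel. \<phi> s * measure_pmf.expectation (if s \<in> N then return_pmf topO else \<kappa> s) g)"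
    unfolding set_lebesgue_integral_def
  proof (rule integral_cong_AE)
    show "AE s in lborel. indicator {0..t} s *\<^sub>R (\<phi> s * measure_pmf.expectation (\<kappa> s) g) = indicator {0..t} s *\<^sub>R (\<phi> s * measure_pmf.expectation (if s \<in> N then return_pmf topO else \<kappa> s) g)"
      using AE_not_in[OF N] by eventually_elim simp
  qed (use m m2 in measurable)
  finally show "(LINT z:strip t|\<mu>. \<phi> (fst z) * g (snd z)) = (LINT s:{0..t}|lborel. \<phi> s * measure_pmf.expectation (if s \<in> N then return_pmf topO else \<kappa> s) g)" .
qed

section \<open>Stationary distributions\<close>

text \<open>One parameter truncates both the number of coordinates and their values. Truncated
  values make it continuous although infinity is not isolated, and for states in
  \<open>OmegaS\<close> it tends to the indicator of \<open>a\<close> as \<open>N\<close>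
  grows.\<close>

definition cylO :: "nat \<Rightarrow> (nat \<Rightarrow> enat) \<Rightarrow> (nat \<Rightarrow> enat) \<Rightarrow> real" where
  "cylO N a w = (if \<forall>i\<in>{1..N}. min (w i) (enat N) = min (a i) (enat N) then 1 else 0)"

lemma cylO_bound: "\<bar>cylO N a w\<bar> \<le> 1" by (simp add: cylO_def)

lemma dependsO_cylO: "dependsO N (cylO N a)"
  unfolding dependsO_def cylO_def by auto

text \<open>A unit jump costs at most one truncation level, which accounts for the
  \<open>Suc N\<close> in the continuity proofs.\<close>

lemma enat_min_shift:
  assumes "min e (enat (Suc N)) = min e' (enat (Suc N))"
  shows "min e (enat N) = min e' (enat N)" "min (e + 1) (enat N) = min (e' + 1) (enat N)"
    "min (e - 1) (enat N) = min (e' - 1) (enat N)"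
  using assms by (cases e; cases e'; auto simp: min_def one_enat_def split: if_splits)+

lemma cylO_cong:
  assumes "\<And>i. i \<in> {1..N} \<Longrightarrow> min (w i) (enat N) = min (w' i) (enat N)"
  shows "cylO N a w = cylO N a w'"
  using assms unfolding cylO_def by simp

lemma contO_upD_cylO: "contO (upD (cylO N a) j)"
proof (rule contO_cylinder[where K=N and N="Suc N"])
  fix w w' :: "nat \<Rightarrow> enat" assume "\<And>i. i \<in> {1..N} \<Longrightarrow> min (w i) (enat (Suc N)) = min (w' i) (enat (Suc N))"
  note s = enat_min_shift[OF this]
  have "cylO N a w = cylO N a w'" by (rule cylO_cong) (rule s)
  moreover have "cylO N a (w(Suc j := w (Suc j) + 1)) = cylO N a (w'(Suc j := w' (Suc j) + 1))"
    by (rule cylO_cong) (use s in auto)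
  ultimately show "upD (cylO N a) j w = upD (cylO N a) j w'" by (simp add: upD_def)
qed

text \<open>The departure increments are cylinder functions; their rates are handled by
  \<open>contO_pw\<close>.\<close>

lemma contO_dnD_cylO:
  assumes q: "0 < q" "q \<le> 1"
  shows "contO (dnD q (cylO N a) N)"
  unfolding dnD_def[abs_def]
proof (intro contO_sum contO_mult contO_diff contO_pw q)
  fix j
  show "contO (cylO N a)"
  proof (rule contO_cylinder[where K=N and N="Suc N"])
    fix w w' :: "nat \<Rightarrow> enat" assume "\<And>i. i \<in> {1..N} \<Longrightarrow> min (w i) (enat (Suc N)) = min (w' i) (enat (Suc N))"
    note s = enat_min_shift[OF this]
    show "cylO N a w = cylO N a w'" by (rule cylO_cong) (rule s)
  qed
  show "contO (\<lambda>w. cylO N a (w(Suc j := w (Suc j) - 1)))"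
  proof (rule contO_cylinder[where K=N and N="Suc N"])
    fix w w' :: "nat \<Rightarrow> enat" assume "\<And>i. i \<in> {1..N} \<Longrightarrow> min (w i) (enat (Suc N)) = min (w' i) (enat (Suc N))"
    note s = enat_min_shift[OF this]
    show "cylO N a (w(Suc j := w (Suc j) - 1)) = cylO N a (w'(Suc j := w' (Suc j) - 1))"
      by (rule cylO_cong) (use s in auto)
  qed
qed

lemma Ftest_genF_cylO:
  assumes q: "0 < q" "q \<le> 1" and t: "0 < t"
  shows "Ftest (genF lam q t (cylO N a) N)"
  unfolding genF_def[abs_def]
  by (intro Ftest_add Ftest_sum Ftest_cmult Ftest_diff finite_lessThan
      Ftest_occF[OF contO_upD_cylO upD_bound[OF cylO_bound] continuous_on_const t]
      Ftest_occF[OF contO_dnD_cylO[OF q] dnD_bound[OF cylO_bound q] continuous_on_const t])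

lemma Ftest_flowF:
  assumes q: "0 < q" "q \<le> 1" and t: "0 < t"
  shows "Ftest (flowF lam q t k)"
proof -
  have pwb: "\<bar>pw q (w (Suc (Suc k))) - pw q (w (Suc k))\<bar> \<le> 1" for w
    using pw_range[OF q, of "w (Suc (Suc k))"] pw_range[OF q, of "w (Suc k)"] by linarith
  have c: "continuous_on UNIV (\<lambda>s. t - s)" by (intro continuous_intros)
  have one: "\<bar>1 :: real\<bar> \<le> 1" by simp
  show ?thesis
    unfolding flowF_def[abs_def]
    by (intro Ftest_add Ftest_cmult Ftest_diff Ftest_initial
       Ftest_occF[OF contO_const one _ t] Ftest_occF[OF _ pwb _ t] contO_diff contO_pw q c continuous_on_const)
qed

text \<open>Whether a value lies below \<open>N\<close> can be read off its truncation at
  \<open>N\<close>, so the indicator is a cylinder function in spite of its jump.\<close>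

lemma Ftest_occ_small:
  assumes t: "0 < t"
  shows "Ftest (occF t (\<lambda>_. 1) (Suc k) (\<lambda>w. if w (Suc k) < enat N then 1 else 0))"
proof (rule Ftest_occF[where B=1, OF _ _ continuous_on_const t])
  show "contO (\<lambda>w. if w (Suc k) < enat N then 1 else 0)"
  proof (rule contO_cylinder[where K="Suc k" and N=N])
    fix w w' :: "nat \<Rightarrow> enat" assume "\<And>i. i \<in> {1..Suc k} \<Longrightarrow> min (w i) (enat N) = min (w' i) (enat N)"
    then have "min (w (Suc k)) (enat N) = min (w' (Suc k)) (enat N)" by simp
    then have "w (Suc k) < enat N \<longleftrightarrow> w' (Suc k) < enat N" by (auto simp: min_def split: if_splits)
    then show "(if w (Suc k) < enat N then 1 else 0 :: real) = (if w' (Suc k) < enat N then 1 else 0)" by simp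
  qed
qed simp

lemma rates_OmegaS:
  assumes w: "w \<in> OmegaS" and q: "0 < q" "q \<le> 1"
  shows "\<And>j. 0 \<le> pw q (w (Suc (Suc j))) - pw q (w (Suc j))" "summable (\<lambda>j. pw q (w (Suc (Suc j))) - pw q (w (Suc j)))"
    "(\<Sum>j. pw q (w (Suc (Suc j))) - pw q (w (Suc j))) \<le> 1"
proof -
  have mono: "pw q (w (Suc j)) \<le> pw q (w (Suc (Suc j)))" for j
  proof -
    have "w (Suc (Suc j)) \<le> w (Suc j)" using w by (simp add: OmegaS_def)
    then show ?thesis using q by (cases "w (Suc j)"; cases "w (Suc (Suc j))") (auto simp: pw_def intro!: power_decreasing)
  qed
  show "0 \<le> pw q (w (Suc (Suc j))) - pw q (w (Suc j))" for j using mono[of j] by simp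
  have "summable (\<lambda>j. (1 - pw q (w (Suc j))) - (1 - pw q (w (Suc (Suc j)))))"
    "(\<Sum>j. (1 - pw q (w (Suc j))) - (1 - pw q (w (Suc (Suc j))))) \<le> 1 - pw q (w (Suc 0))"
    using mono pw_range[OF q] by (intro telescoping_weights[of "\<lambda>j. 1 - pw q (w (Suc j))"]; simp)+
  moreover have "(\<lambda>j. (1 - pw q (w (Suc j))) - (1 - pw q (w (Suc (Suc j))))) = (\<lambda>j. pw q (w (Suc (Suc j))) - pw q (w (Suc j)))"
    by auto
  ultimately show "summable (\<lambda>j. pw q (w (Suc (Suc j))) - pw q (w (Suc j)))" "(\<Sum>j. pw q (w (Suc (Suc j))) - pw q (w (Suc j))) \<le> 1"
    using pw_range[OF q, of "w (Suc 0)"] by auto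
qed

lemma rates_Uset:
  assumes u: "u \<in> Uset" and lam: "0 < lam"
  shows "\<And>j. 0 \<le> lam * (u j - u (Suc j))" "summable (\<lambda>j. lam * (u j - u (Suc j)))" "(\<Sum>j. lam * (u j - u (Suc j))) \<le> lam"
proof -
  show "0 \<le> lam * (u j - u (Suc j))" for j using u lam by (auto simp: Uset_def)
  have "summable (\<lambda>j. lam * u j - lam * u (Suc j))" "(\<Sum>j. lam * u j - lam * u (Suc j)) \<le> lam * u 0"
    using u lam by (intro telescoping_weights[of "\<lambda>j. lam * u j"]; simp add: Uset_def)+
  then show "summable (\<lambda>j. lam * (u j - u (Suc j)))" "(\<Sum>j. lam * (u j - u (Suc j))) \<le> lam"
    using u by (auto simp: Uset_def algebra_simps)
qed

locale frozen_rates =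
  fixes lam q :: real and u :: "nat \<Rightarrow> real"
  assumes lam: "0 < lam" and q: "0 < q" "q \<le> 1" and u: "u \<in> Uset"
begin

text \<open>Arrivals have total rate at most \<open>lam\<close>, departures at most 1, and an
  increment is at most \<open>2 * B\<close>.\<close>

lemma genO_summable:
  assumes w: "w \<in> OmegaS" and f: "\<And>v. \<bar>f v\<bar> \<le> B"
  shows "summable (\<lambda>j. lam * (u j - u (Suc j)) * (f (w(Suc j := w (Suc j) + 1)) - f w))"
    "summable (\<lambda>j. (pw q (w (Suc (Suc j))) - pw q (w (Suc j))) * (f (w(Suc j := w (Suc j) - 1)) - f w))"
    "\<bar>genO lam q u f w\<bar> \<le> (lam + 1) * (2 * B)"
proof -
  have d: "\<bar>f v - f w\<bar> \<le> 2 * B" for v using f[of v] f[of w] by linarith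
  note a = weighted_suminf_bound[OF rates_Uset(2,3,1)[OF u lam], of "\<lambda>j. f (w(Suc j := w (Suc j) + 1)) - f w", OF d]
  note b = weighted_suminf_bound[OF rates_OmegaS(2,3,1)[OF w q], of "\<lambda>j. f (w(Suc j := w (Suc j) - 1)) - f w", OF d]
  show "summable (\<lambda>j. lam * (u j - u (Suc j)) * (f (w(Suc j := w (Suc j) + 1)) - f w))" by (rule a)
  show "summable (\<lambda>j. (pw q (w (Suc (Suc j))) - pw q (w (Suc j))) * (f (w(Suc j := w (Suc j) - 1)) - f w))" by (rule b)
  show "\<bar>genO lam q u f w\<bar> \<le> (lam + 1) * (2 * B)"
    unfolding genO_def using a(2) b(2) by (simp add: algebra_simps)
qed

lemma genO_linear:
  assumes w: "w \<in> OmegaS" and f: "\<And>v. \<bar>f v\<bar> \<le> B" and g: "\<And>v. \<bar>g v\<bar> \<le> C"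
  shows "genO lam q u (\<lambda>v. f v + c * g v) w = genO lam q u f w + c * genO lam q u g w"
proof -
  have lin: "(\<Sum>j. a j * ((f (v j) + c * g (v j)) - (f w + c * g w))) = (\<Sum>j. a j * (f (v j) - f w)) + c * (\<Sum>j. a j * (g (v j) - g w))"
    if "summable (\<lambda>j. a j * (f (v j) - f w))" "summable (\<lambda>j. a j * (g (v j) - g w))" for a :: "nat \<Rightarrow> real" and v
  proof -
    have "(\<Sum>j. a j * ((f (v j) + c * g (v j)) - (f w + c * g w))) = (\<Sum>j. a j * (f (v j) - f w) + c * (a j * (g (v j) - g w)))"
      by (rule arg_cong[of _ _ suminf]) (simp add: fun_eq_iff algebra_simps)
    also have "\<dots> = (\<Sum>j. a j * (f (v j) - f w)) + (\<Sum>j. c * (a j * (g (v j) - g w)))"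
      by (rule suminf_add[symmetric]) (use that summable_mult in auto)
    finally show ?thesis using suminf_mult[OF that(2), of c] by simp
  qed
  show ?thesis unfolding genO_def
    unfolding lin[of "\<lambda>j. lam * (u j - u (Suc j))" "\<lambda>j. w(Suc j := w (Suc j) + 1)",
        OF genO_summable(1)[of w f B, OF w f] genO_summable(1)[of w g C, OF w g]]
      lin[of "\<lambda>j. pw q (w (Suc (Suc j))) - pw q (w (Suc j))" "\<lambda>j. w(Suc j := w (Suc j) - 1)",
        OF genO_summable(2)[of w f B, OF w f] genO_summable(2)[of w g C, OF w g]]
    by (simp add: algebra_simps)
qed

text \<open>Tannery's theorem, dominated convergence for series, with \<open>2 * B\<close> times the
  summable rates as majorant.\<close>

lemma genO_tendsto:
  assumes w: "w \<in> OmegaS" and f: "\<And>n v. \<bar>f n v\<bar> \<le> B" and l: "\<And>v. (\<lambda>n. f n v) \<longlonglongrightarrow> g v"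
  shows "(\<lambda>n. genO lam q u (f n) w) \<longlonglongrightarrow> genO lam q u g w"
proof -
  have t: "(\<lambda>n. \<Sum>j. a j * (f n (v j) - f n w)) \<longlonglongrightarrow> (\<Sum>j. a j * (g (v j) - g w))"
    if a: "summable a" "\<And>j. 0 \<le> a j" for a :: "nat \<Rightarrow> real" and v
  proof -
    have "\<forall>\<^sub>F n in sequentially. summable (\<lambda>j. norm (a j * (f n (v j) - f n w)))" and "summable (\<lambda>j. norm (a j * (g (v j) - g w)))"
      and "(\<lambda>n. \<Sum>j. a j * (f n (v j) - f n w)) \<longlonglongrightarrow> (\<Sum>j. a j * (g (v j) - g w))"
    proof (atomize (full), rule tannerys_theorem[where M="\<lambda>j. a j * (2 * B)"])
      show "(\<lambda>n. a j * (f n (v j) - f n w)) \<longlonglongrightarrow> a j * (g (v j) - g w)" for j by (intro tendsto_intros l)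
      show "\<forall>\<^sub>F (j, n) in at_top \<times>\<^sub>F sequentially. norm (a j * (f n (v j) - f n w)) \<le> a j * (2 * B)"
      proof (intro always_eventually allI, clarify)
        fix j n
        have "\<bar>f n (v j) - f n w\<bar> \<le> 2 * B" using f[of n "v j"] f[of n w] by linarith
        then show "norm (a j * (f n (v j) - f n w)) \<le> a j * (2 * B)"
          using a(2)[of j] by (simp add: abs_mult mult_left_mono)
      qed
      show "summable (\<lambda>j. a j * (2 * B))" by (rule summable_mult2[OF a(1)])
    qed simp
    then show ?thesis by blast
  qed
  show ?thesis unfolding genO_def
    by (intro tendsto_add t rates_Uset[OF u lam] rates_OmegaS[OF w q])
qed

text \<open>A jump that leaves the space of nonincreasing sequences has rate zero: an arrival at level k + 1 needs
  u k > 0, which forces w k to be infinite.\<close>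

lemma genO_cong_OmegaS:
  assumes w: "w \<in> OmegaS" and top: "\<And>k. 0 < u k \<Longrightarrow> w k = \<infinity>" and eq: "\<And>v. v \<in> OmegaS \<Longrightarrow> f v = g v"
  shows "genO lam q u f w = genO lam q u g w"
proof -
  have dec: "w (Suc k) \<le> w k" for k using w by (simp add: OmegaS_def)
  have w0: "w 0 = \<infinity>" using w by (simp add: OmegaS_def)
  have fw: "f w = g w" by (rule eq[OF w])
  have "lam * (u j - u (Suc j)) * (f (w(Suc j := w (Suc j) + 1)) - f w) = lam * (u j - u (Suc j)) * (g (w(Suc j := w (Suc j) + 1)) - g w)" for j
  proof (cases "0 < u j")
    case True
    have "w(Suc j := w (Suc j) + 1) \<in> OmegaS"
      unfolding OmegaS_def mem_Collect_eq
    proof (intro conjI allI)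
      show "(w(Suc j := w (Suc j) + 1)) 0 = \<infinity>" by (simp add: w0)
      fix k
      show "(w(Suc j := w (Suc j) + 1)) (Suc k) \<le> (w(Suc j := w (Suc j) + 1)) k"
      proof -
        consider "k = j" | "k = Suc j" | "k \<noteq> j" "k \<noteq> Suc j" by blast
        then show ?thesis
        proof cases
          case 1
          then show ?thesis using top[OF True] by simp
        next
          case 2
          have "w (Suc (Suc j)) \<le> w (Suc j) + 1" using dec[of "Suc j"] by (meson add_increasing2 order_trans zero_le)
          then show ?thesis using 2 by simp
        next
          case 3
          then show ?thesis using dec[of k] by simp
        qed
      qed
    qed
    then show ?thesis using eq fw by simp
  next
    case False
    have "u (Suc j) \<le> u j" using u by (simp add: Uset_def)
    then have "u j = 0" "u (Suc j) = 0" using False Uset_range[OF u, of j] Uset_range[OF u, of "Suc j"] by linarith+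
    then show ?thesis by simp
  qed
  moreover have "(pw q (w (Suc (Suc j))) - pw q (w (Suc j))) * (f (w(Suc j := w (Suc j) - 1)) - f w) =
     (pw q (w (Suc (Suc j))) - pw q (w (Suc j))) * (g (w(Suc j := w (Suc j) - 1)) - g w)" for j
  proof (cases "w (Suc (Suc j)) = w (Suc j)")
    case False
    then have lt: "w (Suc (Suc j)) < w (Suc j)" using dec[of "Suc j"] by (simp add: order_less_le)
    have "w(Suc j := w (Suc j) - 1) \<in> OmegaS"
      unfolding OmegaS_def mem_Collect_eq
    proof (intro conjI allI)
      show "(w(Suc j := w (Suc j) - 1)) 0 = \<infinity>" by (simp add: w0)
      fix k
      show "(w(Suc j := w (Suc j) - 1)) (Suc k) \<le> (w(Suc j := w (Suc j) - 1)) k"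
      proof -
        consider "k = j" | "k = Suc j" | "k \<noteq> j" "k \<noteq> Suc j" by blast
        then show ?thesis
        proof cases
          case 1
          have "w (Suc j) - 1 \<le> w (Suc j)" by (cases "w (Suc j)") (auto simp: one_enat_def)
          from order_trans[OF this dec[of j]] show ?thesis using 1 by simp
        next
          case 2
          have "w (Suc (Suc j)) \<le> w (Suc j) - 1" using lt
            by (cases "w (Suc j)"; cases "w (Suc (Suc j))") (auto simp: one_enat_def)
          then show ?thesis using 2 by simp
        next
          case 3
          then show ?thesis using dec[of k] by simp
        qed
      qed
    qed
    then show ?thesis using eq fw by simp
  qed simp
  ultimately show ?thesis unfolding genO_def by presburger
qed

text \<open>The functional \<open>L\<close> is linear and passes to bounded pointwise limits.
  Cylinders shrink to points, finite combinations of point indicators exhaust a bounded function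
  along the enumeration, and values off \<open>OmegaS\<close> are invisible because jumps leaving it
  have rate zero.\<close>

lemma stationaryO_if_cylinders:
  assumes \<pi>: "set_pmf \<pi> \<subseteq> OmegaS" and top: "\<And>w k. w \<in> set_pmf \<pi> \<Longrightarrow> 0 < u k \<Longrightarrow> w k = \<infinity>"
    and cyl: "\<And>N a. a \<in> OmegaS \<Longrightarrow> measure_pmf.expectation \<pi> (genO lam q u (cylO N a)) = 0"
  shows "stationaryO lam q u \<pi>"
proof -
  define L where "L f = measure_pmf.expectation \<pi> (genO lam q u f)" for f
  have int: "integrable (measure_pmf \<pi>) (genO lam q u f)" if "\<And>v. \<bar>f v\<bar> \<le> B" for f B
    by (rule expectation_bound(2)[of _ _ "(lam + 1) * (2 * B)"]) (rule genO_summable(3), use \<pi> that in auto)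
  have lim: "(\<lambda>n. L (f n)) \<longlonglongrightarrow> L g" if f: "\<And>n v. \<bar>f n v\<bar> \<le> B" and l: "\<And>v. (\<lambda>n. f n v) \<longlonglongrightarrow> g v" for f g B
    unfolding L_def
  proof (rule integral_dominated_convergence[where w="\<lambda>_. (lam + 1) * (2 * B)"])
    show "AE w in measure_pmf \<pi>. (\<lambda>n. genO lam q u (f n) w) \<longlonglongrightarrow> genO lam q u g w"
      using \<pi> genO_tendsto[OF _ f l] by (auto simp: AE_measure_pmf_iff)
    show "AE w in measure_pmf \<pi>. norm (genO lam q u (f n) w) \<le> (lam + 1) * (2 * B)" for n
      using \<pi> genO_summable(3)[OF _ f] by (auto simp: AE_measure_pmf_iff)
  qed auto
  have cong: "L f = L g" if "\<And>v. v \<in> OmegaS \<Longrightarrow> f v = g v" for f g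
    unfolding L_def
    by (rule integral_cong_AE) (use \<pi> top in \<open>auto simp: AE_measure_pmf_iff intro!: genO_cong_OmegaS that\<close>)
  have lin: "L (\<lambda>v. f v + c * g v) = L f + c * L g" if "\<And>v. \<bar>f v\<bar> \<le> B" "\<And>v. \<bar>g v\<bar> \<le> C" for f g c B C
  proof -
    have "L (\<lambda>v. f v + c * g v) = measure_pmf.expectation \<pi> (\<lambda>w. genO lam q u f w + c * genO lam q u g w)"
      unfolding L_def
      by (rule integral_cong_AE) (use \<pi> in \<open>auto simp: AE_measure_pmf_iff intro!: genO_linear that\<close>)
    then show ?thesis unfolding L_def using int[OF that(1)] int[OF that(2)] by simp
  qed
  have pt: "L (indicator {a}) = 0" if a: "a \<in> OmegaS" for a
  proof -
    \<comment> \<open>Cylinders test levels from 1 on, so their limit ignores level 0; on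
      \<open>OmegaS\<close> level 0 is always infinite and \<open>P\<close> is the indicator of
      \<open>a\<close>.\<close>
    define P where "P w = (if \<forall>i\<ge>1. w i = a i then 1 else 0 :: real)" for w :: "nat \<Rightarrow> enat"
    have "(\<lambda>N. cylO N a w) \<longlonglongrightarrow> P w" for w
    proof (cases "\<forall>i\<ge>1. w i = a i")
      case True
      then have "cylO N a w = P w" for N by (auto simp: cylO_def P_def)
      then show ?thesis by simp
    next
      case False
      then obtain i where i: "1 \<le> i" "w i \<noteq> a i" by blast
      \<comment> \<open>The smaller of two distinct values is finite; truncation above it keeps them
        apart.\<close>
      have "\<exists>N0. \<forall>N\<ge>N0. min (w i) (enat N) \<noteq> min (a i) (enat N)"
      proof (cases "w i < a i")
        case True
        then obtain c where "w i = enat c" by (cases "w i") auto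
        then show ?thesis using True by (intro exI[of _ "Suc c"]) (auto simp: min_def)
      next
        case False
        then have "a i < w i" using i(2) by simp
        then obtain c where "a i = enat c" by (cases "a i") auto
        then show ?thesis using \<open>a i < w i\<close> by (intro exI[of _ "Suc c"]) (auto simp: min_def)
      qed
      then obtain N0 where N0: "\<And>N. N0 \<le> N \<Longrightarrow> min (w i) (enat N) \<noteq> min (a i) (enat N)" by blast
      have "\<forall>\<^sub>F N in sequentially. cylO N a w = P w"
        using eventually_ge_at_top[of "max N0 i"]
      proof eventually_elim
        case (elim N)
        then have "\<not> (\<forall>i\<in>{1..N}. min (w i) (enat N) = min (a i) (enat N))" using N0[of N] i by auto
        then show ?case unfolding cylO_def P_def using False by (simp only: if_False)
      qed
      then show ?thesis by (rule tendsto_eventually)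
    qed
    then have "(\<lambda>N. L (cylO N a)) \<longlonglongrightarrow> L P" by (intro lim[where B=1]) (simp_all add: cylO_bound)
    moreover have "L (cylO N a) = 0" for N unfolding L_def by (rule cyl[OF a])
    ultimately have "L P = 0" by (simp add: LIMSEQ_const_iff)
    moreover have "L (indicator {a}) = L P"
    proof (rule cong)
      fix v assume v: "v \<in> OmegaS"
      have "(\<forall>i\<ge>1. v i = a i) \<longleftrightarrow> v = a"
      proof
        assume *: "\<forall>i\<ge>1. v i = a i"
        show "v = a"
        proof
          fix i show "v i = a i" using * v a by (cases "i = 0") (auto simp: OmegaS_def)
        qed
      qed simp
      then show "indicator {a} v = P v" by (simp add: P_def indicator_def)
    qed
    ultimately show ?thesis by simp
  qed
  have "L f = 0" if fb: "\<And>v. \<bar>f v\<bar> \<le> B" for f B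
  proof -
    have B0: "0 \<le> B" using fb[of topO] by linarith
    \<comment> \<open>The enumeration is injective, so a partial sum equals \<open>f\<close> on the
      first \<open>K\<close> states and 0 elsewhere; the bound \<open>B\<close> persists.\<close>
    define F where "F K v = (\<Sum>n<K. f (enumO n) * indicator {enumO n} v)" for K v
    have Fv: "F K v = (if v \<in> enumO ` {..<K} then f v else 0)" for K v
    proof (cases "v \<in> enumO ` {..<K}")
      case True
      then obtain m where m: "m < K" "v = enumO m" by auto
      have "F K v = (\<Sum>n<K. if n = m then f (enumO n) else 0)"
        unfolding F_def using inj_enumO m(2) by (intro sum.cong) (auto simp: indicator_def inj_def)
      then show ?thesis using True m by simp
    next
      case False
      then show ?thesis unfolding F_def by (auto intro!: sum.neutral simp: indicator_def)
    qed
    have Fb: "\<bar>F K v\<bar> \<le> B" for K v using fb[of v] B0 by (simp add: Fv)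
    have F0: "L (F K) = 0" for K
    proof (induction K)
      case 0
      have "genO lam q u (F 0) = (\<lambda>_. 0)" by (simp add: genO_def F_def fun_eq_iff)
      then show ?case by (simp add: L_def)
    next
      case (Suc K)
      have "F (Suc K) = (\<lambda>v. F K v + f (enumO K) * indicator {enumO K} v)" by (simp add: F_def fun_eq_iff)
      then have "L (F (Suc K)) = L (F K) + f (enumO K) * L (indicator {enumO K})"
        using lin[of "F K" B "indicator {enumO K}" 1 "f (enumO K)"] Fb by (simp add: indicator_def)
      then show ?case using Suc pt[OF enumO_in] by simp
    qed
    have "(\<lambda>K. F K v) \<longlonglongrightarrow> (if v \<in> OmegaS then f v else 0)" for v
    proof (cases "v \<in> OmegaS")
      case True
      then obtain m where m: "enumO m = v" using enumO_ex by blast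
      have "\<forall>\<^sub>F K in sequentially. F K v = f v"
        using eventually_gt_at_top[of m] by eventually_elim (use m in \<open>auto simp: Fv\<close>)
      then show ?thesis using True by (simp add: tendsto_eventually)
    next
      case False
      then have "F K v = 0" for K using enumO_in by (auto simp: Fv)
      then show ?thesis using False by simp
    qed
    from lim[of F B "\<lambda>v. if v \<in> OmegaS then f v else 0", OF Fb this] have "L (\<lambda>v. if v \<in> OmegaS then f v else 0) = 0"
      unfolding F0 by (simp add: LIMSEQ_const_iff)
    moreover have "L f = L (\<lambda>v. if v \<in> OmegaS then f v else 0)" by (rule cong) simp
    ultimately show ?thesis by simp
  qed
  then show ?thesis unfolding stationaryO_def L_def bounded_iff by (metis rangeI real_norm_def)
qed

end

lemma stationaryO_topO: "stationaryO lam q u (return_pmf topO)"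
proof -
  have "topO(Suc j := topO (Suc j) + 1) = topO" "topO(Suc j := topO (Suc j) - 1) = topO" for j by (auto simp: fun_eq_iff)
  then have "genO lam q u f topO = 0" for f unfolding genO_def by simp
  then show ?thesis by (simp add: stationaryO_def)
qed

section \<open>Identification of the limit\<close>

lemma occF_disint:
  assumes d: "disint \<mu> \<kappa>" and x: "x \<in> Dsp" and \<psi>[measurable]: "\<psi> \<in> borel_measurable borel"
    and C: "\<And>s. s \<in> {0..t} \<Longrightarrow> \<bar>\<psi> s\<bar> \<le> C" and B: "\<And>w. \<bar>g w\<bar> \<le> B"
  shows "occF t \<psi> j g (x, \<mu>) = (LINT s:{0..t}|lborel. \<psi> s * x (max 0 s) j * measure_pmf.expectation (\<kappa> s) g)"
    "set_integrable lborel {0..t} (\<lambda>s. \<psi> s * x (max 0 s) j * measure_pmf.expectation (\<kappa> s) g)"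
proof -
  have xm[measurable]: "(\<lambda>s. x (max 0 s) j) \<in> borel_measurable borel" by (rule Dsp_measurable[OF x])
  have xb: "\<bar>x (max 0 s) j\<bar> \<le> 1" for s using Dsp_range[OF x, of "max 0 s" j] by simp
  \<comment> \<open>\<open>disint\<close> asks for a weight bounded on the whole line, while
    \<open>\<psi>\<close> is bounded on \<open>{0..t}\<close>; the indicator changes neither
    integral.\<close>
  define \<phi> where "\<phi> s = indicator {0..t} s * (\<psi> s * x (max 0 s) j)" for s
  have [measurable]: "\<phi> \<in> borel_measurable borel" unfolding \<phi>_def by measurable
  have \<phi>b: "\<bar>\<phi> s\<bar> \<le> \<bar>C\<bar>" for s
  proof (cases "s \<in> {0..t}")
    case True
    have "\<bar>\<psi> s\<bar> * \<bar>x (max 0 s) j\<bar> \<le> \<bar>C\<bar> * 1" using C[OF True] xb[of s] by (intro mult_mono) auto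
    then show ?thesis using True by (simp add: \<phi>_def abs_mult)
  qed (simp add: \<phi>_def)
  have Em: "(\<lambda>s. measure_pmf.expectation (\<kappa> s) g) \<in> borel_measurable borel"
    and eq: "(LINT z:strip t|\<mu>. \<phi> (fst z) * g (snd z)) = (LINT s:{0..t}|lborel. \<phi> s * measure_pmf.expectation (\<kappa> s) g)"
    using d B \<phi>b \<open>\<phi> \<in> borel_measurable borel\<close> unfolding disint_def by blast+
  have "occF t \<psi> j g (x, \<mu>) = (LINT z:strip t|\<mu>. \<phi> (fst z) * g (snd z))"
    unfolding occF_def set_lebesgue_integral_def
    by (rule Bochner_Integration.integral_cong) (auto simp: \<phi>_def indicator_def)
  also have "\<dots> = (LINT s:{0..t}|lborel. \<psi> s * x (max 0 s) j * measure_pmf.expectation (\<kappa> s) g)"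
    unfolding eq unfolding set_lebesgue_integral_def
    by (rule Bochner_Integration.integral_cong) (auto simp: \<phi>_def indicator_def)
  finally show "occF t \<psi> j g (x, \<mu>) = (LINT s:{0..t}|lborel. \<psi> s * x (max 0 s) j * measure_pmf.expectation (\<kappa> s) g)" .
  show "set_integrable lborel {0..t} (\<lambda>s. \<psi> s * x (max 0 s) j * measure_pmf.expectation (\<kappa> s) g)"
  proof (rule bounded_set_integrable[where B="\<bar>C\<bar> * 1 * B"])
    show "(\<lambda>s. \<psi> s * x (max 0 s) j * measure_pmf.expectation (\<kappa> s) g) \<in> borel_measurable borel"
      using Em by measurable
    fix s assume "s \<in> {0..t}"
    then have "\<bar>\<psi> s\<bar> \<le> \<bar>C\<bar>" using C[of s] by linarith
    then show "\<bar>\<psi> s * x (max 0 s) j * measure_pmf.expectation (\<kappa> s) g\<bar> \<le> \<bar>C\<bar> * 1 * B"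
      unfolding abs_mult using xb[of s] expectation_bound(1)[of "\<kappa> s" g B] B by (intro mult_mono) auto
  qed
qed

text \<open>Expectation in the fast variable commutes with the finite combination, the proportions
  being constants at a fixed time.\<close>

lemma genF_disint:
  assumes d: "disint \<mu> \<kappa>" and x: "x \<in> Dsp" and f: "dependsO N f" and B: "\<And>w. \<bar>f w\<bar> \<le> 1" and q: "0 < q" "q \<le> 1" and lam: "0 < lam"
  shows "genF lam q t f N (x, \<mu>) = (LINT s:{0..t}|lborel. measure_pmf.expectation (\<kappa> s) (genO lam q (x (max 0 s)) f))"
    and "(\<lambda>s. measure_pmf.expectation (\<kappa> s) (genO lam q (x (max 0 s)) f)) \<in> borel_measurable borel"
    and "\<bar>measure_pmf.expectation (\<kappa> s) (genO lam q (x (max 0 s)) f)\<bar> \<le> (lam + 1) * 2"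
proof -
  have one: "\<bar>1 :: real\<bar> \<le> 1" by simp
  have E: "measure_pmf.expectation (\<kappa> s) (genO lam q (x (max 0 s)) f) =
     (\<Sum>j<N. lam * (1 * x (max 0 s) j * measure_pmf.expectation (\<kappa> s) (upD f j) - 1 * x (max 0 s) (Suc j) * measure_pmf.expectation (\<kappa> s) (upD f j)))
      + 1 * x (max 0 s) 0 * measure_pmf.expectation (\<kappa> s) (dnD q f N)" for s
  proof -
    have u0: "x (max 0 s) 0 = 1" using Dsp_Uset[OF x, of "max 0 s"] by (simp add: Uset_def)
    have iu: "set_integrable (measure_pmf (\<kappa> s)) UNIV (\<lambda>w. 1 * c * upD f j w)" for c j
      using expectation_bound(2)[of "\<kappa> s" "upD f j" "2 * 1"] upD_bound[OF B] by (simp add: set_integrable_def)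
    have id: "set_integrable (measure_pmf (\<kappa> s)) UNIV (\<lambda>w. 1 * c * dnD q f N w)" for c
      using expectation_bound(2)[of "\<kappa> s" "dnD q f N" "real N * (2 * 1)"] dnD_bound[OF B q] by (simp add: set_integrable_def)
    have "measure_pmf.expectation (\<kappa> s) (genO lam q (x (max 0 s)) f) = (LINT w:UNIV|measure_pmf (\<kappa> s).
        (\<Sum>j<N. lam * (1 * x (max 0 s) j * upD f j w - 1 * x (max 0 s) (Suc j) * upD f j w)) + 1 * x (max 0 s) 0 * dnD q f N w)"
      unfolding genO_finite[of N f "x (max 0 s)", OF f u0, abs_def] by (simp add: set_lebesgue_integral_def)
    also have "\<dots> = (\<Sum>j<N. lam * ((LINT w:UNIV|measure_pmf (\<kappa> s). 1 * x (max 0 s) j * upD f j w) - (LINT w:UNIV|measure_pmf (\<kappa> s). 1 * x (max 0 s) (Suc j) * upD f j w)))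
      + (LINT w:UNIV|measure_pmf (\<kappa> s). 1 * x (max 0 s) 0 * dnD q f N w)"
      by (rule set_integral_combination[symmetric]) (rule iu id)+
    finally show ?thesis by (simp add: set_lebesgue_integral_def)
  qed
  have up: "\<bar>upD f j w\<bar> \<le> 2 * 1" for j w by (rule upD_bound[OF B])
  have dn: "\<bar>dnD q f N w\<bar> \<le> real N * (2 * 1)" for w by (rule dnD_bound[OF B q])
  note ou = occF_disint[OF d x borel_measurable_const one up]
  note od = occF_disint[OF d x borel_measurable_const one dn]
  show "genF lam q t f N (x, \<mu>) = (LINT s:{0..t}|lborel. measure_pmf.expectation (\<kappa> s) (genO lam q (x (max 0 s)) f))"
    unfolding genF_def ou(1) od(1) E by (rule set_integral_combination[OF ou(2) ou(2) od(2)])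
  have [measurable]: "(\<lambda>s. measure_pmf.expectation (\<kappa> s) (upD f j)) \<in> borel_measurable borel"
    "(\<lambda>s. measure_pmf.expectation (\<kappa> s) (dnD q f N)) \<in> borel_measurable borel" for j
    using d up dn unfolding disint_def by blast+
  have [measurable]: "(\<lambda>s. x (max 0 s) j) \<in> borel_measurable borel" for j by (rule Dsp_measurable[OF x])
  show "(\<lambda>s. measure_pmf.expectation (\<kappa> s) (genO lam q (x (max 0 s)) f)) \<in> borel_measurable borel"
    unfolding E by measurable
  interpret frozen_rates lam q "x (max 0 s)"
    by unfold_locales (use lam q Dsp_Uset[OF x] in auto)
  have "\<bar>genO lam q (x (max 0 s)) f w\<bar> \<le> (lam + 1) * (2 * 1)" if "w \<in> set_pmf (\<kappa> s)" for w
    by (rule genO_summable(3)) (use d that B in \<open>auto simp: disint_def\<close>)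
  from expectation_bound(1)[OF this] show "\<bar>measure_pmf.expectation (\<kappa> s) (genO lam q (x (max 0 s)) f)\<bar> \<le> (lam + 1) * 2" by simp
qed

text \<open>The right side of the fluid equation for level \<open>k + 1\<close>; the shift avoids
  \<open>k - 1\<close> on naturals.\<close>

definition drift :: "real \<Rightarrow> real \<Rightarrow> (real \<Rightarrow> nat \<Rightarrow> real) \<Rightarrow> (real \<Rightarrow> (nat \<Rightarrow> enat) pmf) \<Rightarrow> nat \<Rightarrow> real \<Rightarrow> real" where
  "drift lam q x \<kappa> k s = lam * (x (max 0 s) k - x (max 0 s) (Suc k))
     - measure_pmf.expectation (\<kappa> s) (\<lambda>w. pw q (w (Suc (Suc k))) - pw q (w (Suc k)))"

lemma drift_measurable_bounded:
  assumes d: "disint \<mu> \<kappa>" and x: "x \<in> Dsp" and q: "0 < q" "q \<le> 1" and lam: "0 < lam"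
  shows "drift lam q x \<kappa> k \<in> borel_measurable borel" "\<bar>drift lam q x \<kappa> k s\<bar> \<le> lam + 1"
proof -
  have pwb: "\<bar>pw q (w (Suc (Suc k))) - pw q (w (Suc k))\<bar> \<le> 1" for w
    using pw_range[OF q, of "w (Suc (Suc k))"] pw_range[OF q, of "w (Suc k)"] by linarith
  have [measurable]: "(\<lambda>s. x (max 0 s) j) \<in> borel_measurable borel" for j by (rule Dsp_measurable[OF x])
  have [measurable]: "(\<lambda>s. measure_pmf.expectation (\<kappa> s) (\<lambda>w. pw q (w (Suc (Suc k))) - pw q (w (Suc k)))) \<in> borel_measurable borel"
    using d[unfolded disint_def, THEN conjunct2, rule_format, of "\<lambda>w. pw q (w (Suc (Suc k))) - pw q (w (Suc k))" 1] pwb by blast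
  show "drift lam q x \<kappa> k \<in> borel_measurable borel" unfolding drift_def[abs_def] by measurable
  have "\<bar>x (max 0 s) k - x (max 0 s) (Suc k)\<bar> \<le> 1"
    using Dsp_range[OF x max.cobounded1[of 0 s], of k] Dsp_range[OF x max.cobounded1[of 0 s], of "Suc k"] by linarith
  then have "\<bar>lam * (x (max 0 s) k - x (max 0 s) (Suc k))\<bar> \<le> lam * 1"
    unfolding abs_mult using lam by (simp add: mult_left_le)
  moreover have "\<bar>measure_pmf.expectation (\<kappa> s) (\<lambda>w. pw q (w (Suc (Suc k))) - pw q (w (Suc k)))\<bar> \<le> 1"
    by (rule expectation_bound) (rule pwb)
  ultimately show "\<bar>drift lam q x \<kappa> k s\<bar> \<le> lam + 1" unfolding drift_def by linarith
qed

text \<open>The same Fubini on the triangle as for the finite system: the weight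
  \<open>t - s\<close> becomes an inner integral, and the functional is the time integral of the
  defect of the fluid equation.\<close>

lemma flowF_disint:
  assumes d: "disint \<mu> \<kappa>" and x: "x \<in> Dsp" and q: "0 < q" "q \<le> 1" and lam: "0 < lam" and t: "0 < t"
  shows "flowF lam q t k (x, \<mu>) = (LINT s:{0..t}|lborel. x (max 0 s) (Suc k) - x 0 (Suc k) - (LINT r:{0..s}|lborel. drift lam q x \<kappa> k r))"
proof -
  let ?c = "drift lam q x \<kappa> k"
  let ?g = "\<lambda>w. pw q (w (Suc (Suc k))) - pw q (w (Suc k))"
  have pwb: "\<bar>?g w\<bar> \<le> 1" for w
    using pw_range[OF q, of "w (Suc (Suc k))"] pw_range[OF q, of "w (Suc k)"] by linarith
  have cm: "?c \<in> borel_measurable borel" and cb: "\<bar>?c s\<bar> \<le> lam + 1" for s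
    using drift_measurable_bounded[OF d x q lam, of k] by auto
  have one: "\<bar>1 :: real\<bar> \<le> 1" by simp
  have ts: "\<bar>t - s\<bar> \<le> t" if "s \<in> {0..t}" for s using that by auto
  have tm: "(\<lambda>s. t - s) \<in> borel_measurable borel" by measurable
  note o1 = occF_disint[where g="\<lambda>_. 1" and B=1 and \<psi>="\<lambda>_. 1" and C=1 and t=t and j="Suc k", OF d x borel_measurable_const one one]
  note o2 = occF_disint[where g="\<lambda>_. 1" and B=1, OF d x tm ts one]
  note o3 = occF_disint[where g="?g" and B=1 and j=0, OF d x tm ts pwb]
  have e2: "occF t (\<lambda>s. t - s) j (\<lambda>_. 1) (x, \<mu>) = (LINT s:{0..t}|lborel. (t - s) * x (max 0 s) j * measure_pmf.expectation (\<kappa> s) (\<lambda>_. 1))" for j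
    by (rule occF_disint(1)[OF d x tm ts, where B=1]) simp_all
  have e3: "occF t (\<lambda>s. t - s) 0 ?g (x, \<mu>) = (LINT s:{0..t}|lborel. (t - s) * x (max 0 s) 0 * measure_pmf.expectation (\<kappa> s) ?g)"
    by (rule occF_disint(1)[OF d x tm ts, where B=1]) (simp, rule pwb)
  have comb: "- lam * (occF t (\<lambda>s. t - s) k (\<lambda>_. 1) (x, \<mu>) - occF t (\<lambda>s. t - s) (Suc k) (\<lambda>_. 1) (x, \<mu>)) + occF t (\<lambda>s. t - s) 0 ?g (x, \<mu>)
     = - (LINT s:{0..t}|lborel. LINT r:{0..s}|lborel. ?c r)"
  proof -
    have "- lam * (occF t (\<lambda>s. t - s) k (\<lambda>_. 1) (x, \<mu>) - occF t (\<lambda>s. t - s) (Suc k) (\<lambda>_. 1) (x, \<mu>)) + occF t (\<lambda>s. t - s) 0 ?g (x, \<mu>)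
      = (\<Sum>j<Suc 0. - lam * ((LINT s:{0..t}|lborel. (t - s) * x (max 0 s) k * measure_pmf.expectation (\<kappa> s) (\<lambda>_. 1)) - (LINT s:{0..t}|lborel. (t - s) * x (max 0 s) (Suc k) * measure_pmf.expectation (\<kappa> s) (\<lambda>_. 1))))
       + (LINT s:{0..t}|lborel. (t - s) * x (max 0 s) 0 * measure_pmf.expectation (\<kappa> s) ?g)"
      by (simp add: e2 e3)
    also have "\<dots> = (LINT s:{0..t}|lborel. (\<Sum>j<Suc 0. - lam * ((t - s) * x (max 0 s) k * measure_pmf.expectation (\<kappa> s) (\<lambda>_. 1) - (t - s) * x (max 0 s) (Suc k) * measure_pmf.expectation (\<kappa> s) (\<lambda>_. 1)))
       + (t - s) * x (max 0 s) 0 * measure_pmf.expectation (\<kappa> s) ?g)"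
      by (rule set_integral_combination[OF o2(2) o2(2) o3(2)])
    also have "\<dots> = (LINT s:{0..t}|lborel. - (?c s * (t - s)))"
    proof (rule set_lebesgue_integral_cong, simp, intro allI impI)
      fix s
      have u0: "x (max 0 s) 0 = 1" using Dsp_Uset[OF x, of "max 0 s"] by (simp add: Uset_def)
      show "(\<Sum>j<Suc 0. - lam * ((t - s) * x (max 0 s) k * measure_pmf.expectation (\<kappa> s) (\<lambda>_. 1) - (t - s) * x (max 0 s) (Suc k) * measure_pmf.expectation (\<kappa> s) (\<lambda>_. 1)))
       + (t - s) * x (max 0 s) 0 * measure_pmf.expectation (\<kappa> s) ?g = - (?c s * (t - s))"
        unfolding u0 drift_def by (simp add: algebra_simps)
    qed
    also have "\<dots> = - (LINT s:{0..t}|lborel. ?c s * (t - s))"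
      by (simp add: set_lebesgue_integral_def)
    also have "(LINT s:{0..t}|lborel. ?c s * (t - s)) = (LINT r:{0..t}|lborel. ?c r * (LINT s:{r..t}|lborel. 1))"
      by (rule set_lebesgue_integral_cong) (auto simp: set_integral_const)
    also have "\<dots> = (LINT s:{0..t}|lborel. 1 * (LINT r:{0..s}|lborel. ?c r))"
      by (rule bounded_triangle_Fubini[OF cm, of "\<lambda>_. 1" t "lam + 1" 1]) (use cb in auto)
    finally show ?thesis by simp
  qed
  have iI: "set_integrable lborel {0..t} (\<lambda>s. LINT r:{0..s}|lborel. ?c r)"
  proof (rule bounded_set_integrable[OF integral_upto_measurable[OF cm], where B="(lam + 1) * t"])
    fix s assume s: "s \<in> {0..t}"
    have "\<bar>LINT r:{0..s}|lborel. ?c r\<bar> \<le> (lam + 1) * (s - 0)" by (rule set_integral_bound[OF cm cb]) (use s in auto)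
    also have "\<dots> \<le> (lam + 1) * t" using s lam by (intro mult_left_mono) auto
    finally show "\<bar>LINT r:{0..s}|lborel. ?c r\<bar> \<le> (lam + 1) * t" .
  qed
  have ix: "set_integrable lborel {0..t} (\<lambda>s. x (max 0 s) (Suc k))" using o1(2) by simp
  have ic: "set_integrable lborel {0..t} (\<lambda>s. x 0 (Suc k))"
    by (rule bounded_set_integrable[where B="\<bar>x 0 (Suc k)\<bar>"]) auto
  have "flowF lam q t k (x, \<mu>) = (LINT s:{0..t}|lborel. x (max 0 s) (Suc k)) - (LINT s:{0..t}|lborel. x 0 (Suc k)) - (LINT s:{0..t}|lborel. LINT r:{0..s}|lborel. ?c r)"
  proof -
    have "(LINT s:{0..t}|lborel. x 0 (Suc k)) = t * x 0 (Suc k)" using t by (subst set_integral_const) auto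
    moreover have "occF t (\<lambda>_. 1) (Suc k) (\<lambda>_. 1) (x, \<mu>) = (LINT s:{0..t}|lborel. x (max 0 s) (Suc k))" using o1(1) by simp
    ultimately show ?thesis unfolding flowF_def using comb by simp
  qed
  then show ?thesis
    unfolding set_integral_diff(2)[OF set_integral_diff(1)[OF ix ic] iI] set_integral_diff(2)[OF ix ic] .
qed

text \<open>Vanishing integrals of the defect give the equation at almost every time; path and
  integral are right-continuous, which extends it to every time.\<close>

lemma flow_equation:
  assumes d: "disint \<mu> \<kappa>" and x: "x \<in> Dsp" and q: "0 < q" "q \<le> 1" and lam: "0 < lam"
    and flow: "\<And>t. t \<in> \<rat> \<Longrightarrow> 0 < t \<Longrightarrow> flowF lam q t k (x, \<mu>) = 0" and t: "0 \<le> t"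
  shows "x t (Suc k) = x 0 (Suc k) + (LINT s:{0..t}|lborel. drift lam q x \<kappa> k s)"
proof -
  let ?c = "drift lam q x \<kappa> k"
  have cm: "?c \<in> borel_measurable borel" and cb: "\<bar>?c s\<bar> \<le> lam + 1" for s
    using drift_measurable_bounded[OF d x q lam, of k] by auto
  define h where "h s = x (max 0 s) (Suc k) - x 0 (Suc k) - (LINT r:{0..s}|lborel. ?c r)" for s
  have "AE t in lborel. 0 < t \<longrightarrow> h t = 0"
  proof (rule AE_zero_if_integrals_zero_local)
    show "h \<in> borel_measurable borel" unfolding h_def[abs_def]
      by (intro borel_measurable_diff Dsp_measurable[OF x] borel_measurable_const integral_upto_measurable[OF cm])
    show "(LINT s:{0..t}|lborel. h s) = 0" if "t \<in> \<rat>" "0 < t" for t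
      unfolding h_def using flow[OF that] flowF_disint[OF d x q lam that(2), of k] by simp
    fix T
    have "\<bar>h s\<bar> \<le> 1 + (lam + 1) * T" if s: "s \<in> {0..T}" for s
    proof -
      have "\<bar>LINT r:{0..s}|lborel. ?c r\<bar> \<le> (lam + 1) * (s - 0)" by (rule set_integral_bound[OF cm cb]) (use s in auto)
      also have "\<dots> \<le> (lam + 1) * T" using s lam by (intro mult_left_mono) auto
      finally show ?thesis
        using Dsp_range[OF x max.cobounded1[of 0 s], of "Suc k"] Dsp_range[OF x order_refl, of "Suc k"] unfolding h_def by linarith
    qed
    then show "\<exists>B. \<forall>s\<in>{0..T}. \<bar>h s\<bar> \<le> B" by blast
  qed
  moreover have "(h \<longlongrightarrow> h t) (at_right t)"
    unfolding h_def
  proof (intro tendsto_diff tendsto_const)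
    have "\<forall>\<^sub>F s in at_right t. x s (Suc k) = x (max 0 s) (Suc k)"
      unfolding eventually_at_right_field using t by (intro exI[of _ "t + 1"]) auto
    from Lim_transform_eventually[OF Dsp_right_continuous[OF x t, of "Suc k"] this]
    show "((\<lambda>s. x (max 0 s) (Suc k)) \<longlongrightarrow> x (max 0 t) (Suc k)) (at_right t)" using t by simp
    show "((\<lambda>s. LINT r:{0..s}|lborel. ?c r) \<longlongrightarrow> (LINT r:{0..t}|lborel. ?c r)) (at_right t)"
    proof (rule Lim_transform[OF tendsto_const])
      have "((\<lambda>s. (lam + 1) * (s - t)) \<longlongrightarrow> (lam + 1) * (t - t)) (at_right t)" by (intro tendsto_intros)
      then have l: "((\<lambda>s. (lam + 1) * (s - t)) \<longlongrightarrow> 0) (at_right t)" by simp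
      show "((\<lambda>s. (LINT r:{0..s}|lborel. ?c r) - (LINT r:{0..t}|lborel. ?c r)) \<longlongrightarrow> 0) (at_right t)"
      proof (rule Lim_null_comparison[OF _ l])
        show "\<forall>\<^sub>F s in at_right t. norm ((LINT r:{0..s}|lborel. ?c r) - (LINT r:{0..t}|lborel. ?c r)) \<le> (lam + 1) * (s - t)"
          unfolding eventually_at_right_field
        proof (intro exI[of _ "t + 1"] conjI allI impI)
          fix s assume s: "t < s"
          have "(LINT r:{0..s}|lborel. ?c r) = (LINT r:{0..t}|lborel. ?c r) + (LINT r:{t..s}|lborel. ?c r)"
            by (rule set_integral_Icc_split[OF bounded_set_integrable[OF cm cb]]) (use t s in auto)
          moreover have "\<bar>LINT r:{t..s}|lborel. ?c r\<bar> \<le> (lam + 1) * (s - t)"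
            by (rule set_integral_bound[OF cm cb]) (use s in auto)
          ultimately show "norm ((LINT r:{0..s}|lborel. ?c r) - (LINT r:{0..t}|lborel. ?c r)) \<le> (lam + 1) * (s - t)" by simp
        qed simp
      qed
    qed
  qed
  ultimately have "h t = 0" by (rule zero_if_AE_zero_right_continuous[OF _ _ t])
  then show ?thesis using t by (simp add: h_def)
qed

text \<open>A deterministic statement about one pair of path and measure: all randomness has been
  spent on producing the three families of vanishing functionals.\<close>

lemma fluid_limit_characterisation:
  assumes x: "x \<in> Dsp" and \<mu>: "\<mu> \<in> Lset" and q: "0 < q" "q \<le> 1" and lam: "0 < lam"
    and small: "\<And>t k N. t \<in> \<rat> \<Longrightarrow> 0 < t \<Longrightarrow> occF t (\<lambda>_. 1) (Suc k) (\<lambda>w. if w (Suc k) < enat N then 1 else 0) (x, \<mu>) = 0"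
    and gen: "\<And>t N a. t \<in> \<rat> \<Longrightarrow> 0 < t \<Longrightarrow> a \<in> OmegaS \<Longrightarrow> genF lam q t (cylO N a) N (x, \<mu>) = 0"
    and flow: "\<And>t k. t \<in> \<rat> \<Longrightarrow> 0 < t \<Longrightarrow> flowF lam q t k (x, \<mu>) = 0"
  shows "\<exists>\<pi> :: real \<Rightarrow> (nat \<Rightarrow> enat) pmf.
     (\<forall>s>0. set_pmf (\<pi> s) \<subseteq> OmegaS \<and> stationaryO lam q (x s) (\<pi> s) \<and>
            (\<forall>k. 0 < x s k \<longrightarrow> measure_pmf.prob (\<pi> s) {w. w k = \<infinity>} = 1)) \<and>
     (\<forall>t>0. \<forall>A \<subseteq> OmegaS.
            set_integrable lborel {0..t} (\<lambda>s. measure_pmf.prob (\<pi> s) A) \<and>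
            measure \<mu> ({0..<t} \<times> A) = (LINT s:{0..t}|lborel. measure_pmf.prob (\<pi> s) A)) \<and>
     (\<forall>k\<ge>1.
        (\<forall>t\<ge>0. set_integrable lborel {0..t}
                  (\<lambda>s. lam * (x s (k - 1) - x s k)
                       - measure_pmf.expectation (\<pi> s) (\<lambda>w. pw q (w (Suc k)) - pw q (w k))) \<and>
                x t k = x 0 k + (LINT s:{0..t}|lborel. lam * (x s (k - 1) - x s k)
                       - measure_pmf.expectation (\<pi> s) (\<lambda>w. pw q (w (Suc k)) - pw q (w k)))) \<and>
        (AE t in lborel. 0 < t \<longrightarrow>
           ((\<lambda>\<tau>. x \<tau> k) has_real_derivative
              (lam * (x t (k - 1) - x t k)
               - measure_pmf.expectation (\<pi> t) (\<lambda>w. pw q (w (Suc k)) - pw q (w k)))) (at t)))"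
proof -
  obtain \<kappa> where d: "disint \<mu> \<kappa>" by (rule Lset_disintegration[OF \<mu>])
  let ?ind = "\<lambda>k N w. if w (Suc k) < enat N then 1 else (0 :: real)"
  have indb: "\<bar>?ind k N w\<bar> \<le> 1" for k N and w :: "nat \<Rightarrow> enat" by simp
  have one: "\<bar>1 :: real\<bar> \<le> 1" by simp
  have inde: "\<bar>measure_pmf.expectation \<rho> (?ind k N)\<bar> \<le> 1" "integrable (measure_pmf \<rho>) (?ind k N)" for \<rho> k N
    by (rule expectation_bound[where B=1]; simp)+
  \<comment> \<open>Where \<open>x s (Suc k)\<close> is positive, the mass of states with that
    coordinate below \<open>N\<close> vanishes for every \<open>N\<close>, so the coordinate is
    infinite almost surely.\<close>
  have A1: "AE s in lborel. \<forall>k N. 0 < s \<longrightarrow> 1 * x (max 0 s) (Suc k) * measure_pmf.expectation (\<kappa> s) (?ind k N) = 0"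
    unfolding AE_all_countable
  proof (intro allI)
    fix k N
    have o: "occF t (\<lambda>_. 1) (Suc k) (?ind k N) (x, \<mu>) = (LINT s:{0..t}|lborel. 1 * x (max 0 s) (Suc k) * measure_pmf.expectation (\<kappa> s) (?ind k N))" for t
      by (rule occF_disint(1)[OF d x, where B=1 and C=1]) simp_all
    show "AE s in lborel. 0 < s \<longrightarrow> 1 * x (max 0 s) (Suc k) * measure_pmf.expectation (\<kappa> s) (?ind k N) = 0"
    proof (rule AE_zero_if_integrals_zero[where B=1])
      have "(\<lambda>s. measure_pmf.expectation (\<kappa> s) (?ind k N)) \<in> borel_measurable borel"
        using d[unfolded disint_def, THEN conjunct2, rule_format, of "?ind k N" 1] indb by blast
      then show "(\<lambda>s. 1 * x (max 0 s) (Suc k) * measure_pmf.expectation (\<kappa> s) (?ind k N)) \<in> borel_measurable borel"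
        by (intro borel_measurable_times borel_measurable_const Dsp_measurable[OF x])
      show "\<bar>1 * x (max 0 s) (Suc k) * measure_pmf.expectation (\<kappa> s) (?ind k N)\<bar> \<le> 1" for s
      proof -
        have "\<bar>x (max 0 s) (Suc k)\<bar> * \<bar>measure_pmf.expectation (\<kappa> s) (?ind k N)\<bar> \<le> 1 * 1"
          using Dsp_range[OF x, of "max 0 s" "Suc k"] inde(1)[of "\<kappa> s" k N]
          by (intro mult_mono) auto
        then show ?thesis by (simp add: abs_mult)
      qed
      fix t :: real assume "t \<in> \<rat>" "0 < t"
      from small[OF this, of k N] show "(LINT s:{0..t}|lborel. 1 * x (max 0 s) (Suc k) * measure_pmf.expectation (\<kappa> s) (?ind k N)) = 0"
        unfolding o .
    qed
  qed
  have A2: "AE s in lborel. \<forall>N n. 0 < s \<longrightarrow> measure_pmf.expectation (\<kappa> s) (genO lam q (x (max 0 s)) (cylO N (enumO n))) = 0"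
    unfolding AE_all_countable
  proof (intro allI)
    fix N n
    note g = genF_disint[OF d x dependsO_cylO[of N "enumO n"] cylO_bound q lam]
    show "AE s in lborel. 0 < s \<longrightarrow> measure_pmf.expectation (\<kappa> s) (genO lam q (x (max 0 s)) (cylO N (enumO n))) = 0"
    proof (rule AE_zero_if_integrals_zero[OF g(2,3)])
      fix t :: real assume "t \<in> \<rat>" "0 < t"
      from gen[OF this enumO_in, of N n]
      show "(LINT s:{0..t}|lborel. measure_pmf.expectation (\<kappa> s) (genO lam q (x (max 0 s)) (cylO N (enumO n)))) = 0"
        unfolding g(1) .
    qed
  qed
  define good where "good s \<longleftrightarrow> (\<forall>k N. 0 < s \<longrightarrow> 1 * x (max 0 s) (Suc k) * measure_pmf.expectation (\<kappa> s) (?ind k N) = 0) \<and>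
     (\<forall>N n. 0 < s \<longrightarrow> measure_pmf.expectation (\<kappa> s) (genO lam q (x (max 0 s)) (cylO N (enumO n))) = 0)" for s
  have "AE s in lborel. good s" using A1 A2 unfolding good_def by eventually_elim blast
  then obtain Nul where Nul: "{s \<in> space lborel. \<not> good s} \<subseteq> Nul" "Nul \<in> null_sets lborel"
    unfolding eventually_ae_filter by blast
  \<comment> \<open>The point mass also has every coordinate infinite, as is asked where a
    proportion is positive.\<close>
  define \<pi> where "\<pi> s = (if s \<in> Nul then return_pmf topO else \<kappa> s)" for s
  have dp: "disint \<mu> \<pi>" unfolding \<pi>_def[abs_def] by (rule disint_modify[OF d Nul(2)])
  have part1: "set_pmf (\<pi> s) \<subseteq> OmegaS \<and> stationaryO lam q (x s) (\<pi> s) \<and>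
            (\<forall>k. 0 < x s k \<longrightarrow> measure_pmf.prob (\<pi> s) {w. w k = \<infinity>} = 1)" if s: "0 < s" for s
  proof (cases "s \<in> Nul")
    case True
    then show ?thesis using stationaryO_topO topO_in by (simp add: \<pi>_def indicator_def)
  next
    case False
    then have \<pi>s: "\<pi> s = \<kappa> s" and g: "good s" using Nul(1) by (auto simp: \<pi>_def)
    have sub: "set_pmf (\<kappa> s) \<subseteq> OmegaS" using d by (simp add: disint_def)
    have top: "w k = \<infinity>" if w: "w \<in> set_pmf (\<kappa> s)" and k: "0 < x s k" for w k
    proof (cases k)
      case 0
      then show ?thesis using w sub by (auto simp: OmegaS_def)
    next
      case (Suc k')
      show ?thesis
      proof (rule ccontr)
        assume "w k \<noteq> \<infinity>"
        then obtain c where c: "w k = enat c" by auto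
        \<comment> \<open>The level just above the supposed finite value.\<close>
        have "measure_pmf.expectation (\<kappa> s) (?ind k' (Suc c)) = 0"
          using g[unfolded good_def, THEN conjunct1, rule_format, OF s, of k' "Suc c"] s k Suc by simp
        then have "AE v in measure_pmf (\<kappa> s). ?ind k' (Suc c) v = 0"
          using integral_nonneg_eq_0_iff_AE[of "measure_pmf (\<kappa> s)" "?ind k' (Suc c)"]
            inde(2)[of "\<kappa> s" k' "Suc c"] by simp
        then have "?ind k' (Suc c) w = 0" using w by (auto simp: AE_measure_pmf_iff)
        then show False using c Suc by simp
      qed
    qed
    have xs: "x (max 0 s) = x s" using s by simp
    interpret frozen_rates lam q "x s" by unfold_locales (use lam q Dsp_Uset[OF x] s in auto)
    have "stationaryO lam q (x s) (\<kappa> s)"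
    proof (rule stationaryO_if_cylinders[OF sub])
      show "w k = \<infinity>" if "w \<in> set_pmf (\<kappa> s)" "0 < x s k" for w k by (rule top[OF that])
      fix N a assume "a \<in> OmegaS"
      then obtain n where "enumO n = a" using enumO_ex by blast
      then show "measure_pmf.expectation (\<kappa> s) (genO lam q (x s) (cylO N a)) = 0"
        using g s unfolding good_def xs by blast
    qed
    moreover have "measure_pmf.prob (\<kappa> s) {w. w k = \<infinity>} = 1" if "0 < x s k" for k
      using top that by (simp add: measure_pmf.prob_eq_1 AE_measure_pmf_iff)
    ultimately show ?thesis unfolding \<pi>s using sub by blast
  qed
  have part2: "set_integrable lborel {0..t} (\<lambda>s. measure_pmf.prob (\<pi> s) A) \<and>
            measure \<mu> ({0..<t} \<times> A) = (LINT s:{0..t}|lborel. measure_pmf.prob (\<pi> s) A)" if t: "0 < t" and A: "A \<subseteq> OmegaS" for t A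
  proof -
    have Ab: "\<bar>indicator A w :: real\<bar> \<le> 1" for w by (simp add: indicator_def)
    note D = dp[unfolded disint_def, THEN conjunct2, rule_format, of "indicator A" 1, OF Ab]
    have m: "(\<lambda>s. measure_pmf.expectation (\<pi> s) (indicator A :: _ \<Rightarrow> real)) \<in> borel_measurable borel"
      using D by (rule conjunct1)
    have eq: "(LINT z:strip t|\<mu>. 1 * (indicator A (snd z) :: real)) = (LINT s:{0..t}|lborel. 1 * measure_pmf.expectation (\<pi> s) (indicator A))"
      using D[THEN conjunct2, rule_format, of "\<lambda>_. 1" 1 t] by simp
    have "measure \<mu> ({0..<t} \<times> A) = (LINT z:strip t|\<mu>. 1 * (indicator A (snd z) :: real))"
    proof -
      have "(LINT z:strip t|\<mu>. 1 * (indicator A (snd z) :: real)) = (\<integral>z. indicator ({0..<t} \<times> A) z \<partial>\<mu>)"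
        unfolding set_lebesgue_integral_def
        by (rule Bochner_Integration.integral_cong) (use A in \<open>auto simp: indicator_def\<close>)
      then show ?thesis by (simp add: Lset_space[OF \<mu>])
    qed
    moreover have "set_integrable lborel {0..t} (\<lambda>s. measure_pmf.prob (\<pi> s) A)"
      by (rule bounded_set_integrable[where B=1]) (use m in auto)
    ultimately show ?thesis using eq by simp
  qed
  have part3: "(\<forall>t\<ge>0. set_integrable lborel {0..t}
                  (\<lambda>s. lam * (x s (k - 1) - x s k)
                       - measure_pmf.expectation (\<pi> s) (\<lambda>w. pw q (w (Suc k)) - pw q (w k))) \<and>
                x t k = x 0 k + (LINT s:{0..t}|lborel. lam * (x s (k - 1) - x s k)
                       - measure_pmf.expectation (\<pi> s) (\<lambda>w. pw q (w (Suc k)) - pw q (w k)))) \<and>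
        (AE t in lborel. 0 < t \<longrightarrow>
           ((\<lambda>\<tau>. x \<tau> k) has_real_derivative
              (lam * (x t (k - 1) - x t k)
               - measure_pmf.expectation (\<pi> t) (\<lambda>w. pw q (w (Suc k)) - pw q (w k)))) (at t))" if "1 \<le> k" for k
  proof -
    obtain k' where k: "k = Suc k'" using \<open>1 \<le> k\<close> by (cases k) auto
    have cm: "drift lam q x \<pi> k' \<in> borel_measurable borel" and cb: "\<bar>drift lam q x \<pi> k' s\<bar> \<le> lam + 1" for s
      using drift_measurable_bounded[OF dp x q lam, of k'] by auto
    have eq: "lam * (x s (k - 1) - x s k) - measure_pmf.expectation (\<pi> s) (\<lambda>w. pw q (w (Suc k)) - pw q (w k)) = drift lam q x \<pi> k' s" if "0 \<le> s" for s
      using that unfolding drift_def k by simp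
    have fe: "x t k = x 0 k + (LINT s:{0..t}|lborel. drift lam q x \<pi> k' s)" if "0 \<le> t" for t
      unfolding k by (rule flow_equation[OF dp x q lam flow that])
    have S1: "set_integrable lborel {0..t} (\<lambda>s. lam * (x s (k - 1) - x s k) - measure_pmf.expectation (\<pi> s) (\<lambda>w. pw q (w (Suc k)) - pw q (w k)))" for t
    proof -
      have "set_integrable lborel {0..t} (drift lam q x \<pi> k')" by (rule bounded_set_integrable[OF cm cb])
      moreover have "set_integrable lborel {0..t} (\<lambda>s. lam * (x s (k - 1) - x s k) - measure_pmf.expectation (\<pi> s) (\<lambda>w. pw q (w (Suc k)) - pw q (w k))) \<longleftrightarrow> set_integrable lborel {0..t} (drift lam q x \<pi> k')"
        by (rule set_integrable_cong) (use eq in auto)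
      ultimately show ?thesis by blast
    qed
    have S2: "(LINT s:{0..t}|lborel. lam * (x s (k - 1) - x s k) - measure_pmf.expectation (\<pi> s) (\<lambda>w. pw q (w (Suc k)) - pw q (w k))) = (LINT s:{0..t}|lborel. drift lam q x \<pi> k' s)" for t
      by (rule set_lebesgue_integral_cong) (use eq in auto)
    have S3: "AE t in lborel. 0 < t \<longrightarrow>
           ((\<lambda>\<tau>. x \<tau> k) has_real_derivative
              (lam * (x t (k - 1) - x t k)
               - measure_pmf.expectation (\<pi> t) (\<lambda>w. pw q (w (Suc k)) - pw q (w k)))) (at t)"
      using lebesgue_differentiation[OF cm cb]
    proof (eventually_elim, intro impI)
      fix t :: real assume *: "0 < t \<longrightarrow> ((\<lambda>\<tau>. LINT s:{0..\<tau>}|lborel. drift lam q x \<pi> k' s) has_real_derivative drift lam q x \<pi> k' t) (at t)" and t: "0 < t"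
      have "((\<lambda>\<tau>. x 0 k + (LINT s:{0..\<tau>}|lborel. drift lam q x \<pi> k' s)) has_real_derivative (0 + drift lam q x \<pi> k' t)) (at t)"
        using * t by (intro DERIV_add DERIV_const) auto
      then have dv: "((\<lambda>\<tau>. x 0 k + (LINT s:{0..\<tau>}|lborel. drift lam q x \<pi> k' s)) has_real_derivative drift lam q x \<pi> k' t) (at t)"
        by simp
      \<comment> \<open>The integral equation holds for nonnegative times, hence the open half-line
        around \<open>t\<close>.\<close>
      have "((\<lambda>\<tau>. x \<tau> k) has_real_derivative drift lam q x \<pi> k' t) (at t)"
        by (rule has_field_derivative_transform_within_open[OF dv, of "{0<..}"]) (auto simp: t intro!: fe[symmetric])
      then show "((\<lambda>\<tau>. x \<tau> k) has_real_derivative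
              (lam * (x t (k - 1) - x t k)
               - measure_pmf.expectation (\<pi> t) (\<lambda>w. pw q (w (Suc k)) - pw q (w k)))) (at t)"
        using eq[of t] t by simp
    qed
    show ?thesis
    proof (intro conjI allI impI S1 S3)
      fix t :: real assume "0 \<le> t"
      from fe[OF this] show "x t k = x 0 k + (LINT s:{0..t}|lborel. lam * (x s (k - 1) - x s k)
            - measure_pmf.expectation (\<pi> s) (\<lambda>w. pw q (w (Suc k)) - pw q (w k)))"
        unfolding S2 .
    qed
  qed
  show ?thesis
    by (rule exI[of _ \<pi>]) (use part1 part2 part3 in blast)
qed

theorem theorem4p1:
  fixes lam q :: real
    and r :: "nat \<Rightarrow> nat"
    and M :: "nat \<Rightarrow> 'a measure"
    and X :: "nat \<Rightarrow> 'a \<Rightarrow> real \<Rightarrow> nat \<Rightarrow> nat"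
    and P :: "'b measure"
    and v :: "'b \<Rightarrow> real \<Rightarrow> nat \<Rightarrow> real"
    and chi :: "'b \<Rightarrow> (real \<times> (nat \<Rightarrow> enat)) measure"
  assumes "0 < lam" and "lam < 1" and "0 < q" and "q \<le> 1"
    and "strict_mono r" and "\<forall>j. 0 < r j"
    and "\<forall>j. lcq_chain lam q (r j) (M j) (X j)"
    and "prob_space P"
    and "\<forall>x. v x \<in> Dsp \<and> chi x \<in> Lset"
    and "conv_dist M (\<lambda>j x. (\<lambda>t. uOf (r j) (X j x t), occ (X j x))) P (\<lambda>x. (v x, chi x))"
  shows "AE x in P. \<exists>\<pi> :: real \<Rightarrow> (nat \<Rightarrow> enat) pmf.
     (\<forall>s>0. set_pmf (\<pi> s) \<subseteq> OmegaS \<and> stationaryO lam q (v x s) (\<pi> s) \<and>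
            (\<forall>k. 0 < v x s k \<longrightarrow> measure_pmf.prob (\<pi> s) {w. w k = \<infinity>} = 1)) \<and>
     (\<forall>t>0. \<forall>A \<subseteq> OmegaS.
            set_integrable lborel {0..t} (\<lambda>s. measure_pmf.prob (\<pi> s) A) \<and>
            measure (chi x) ({0..<t} \<times> A) = (LINT s:{0..t}|lborel. measure_pmf.prob (\<pi> s) A)) \<and>
     (\<forall>k\<ge>1.
        (\<forall>t\<ge>0. set_integrable lborel {0..t}
                  (\<lambda>s. lam * (v x s (k - 1) - v x s k)
                       - measure_pmf.expectation (\<pi> s) (\<lambda>w. pw q (w (Suc k)) - pw q (w k))) \<and>
                v x t k = v x 0 k + (LINT s:{0..t}|lborel. lam * (v x s (k - 1) - v x s k)
                       - measure_pmf.expectation (\<pi> s) (\<lambda>w. pw q (w (Suc k)) - pw q (w k)))) \<and>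
        (AE t in lborel. 0 < t \<longrightarrow>
           ((\<lambda>\<tau>. v x \<tau> k) has_real_derivative
              (lam * (v x t (k - 1) - v x t k)
               - measure_pmf.expectation (\<pi> t) (\<lambda>w. pw q (w (Suc k)) - pw q (w k)))) (at t)))"
proof -
  note lam = assms(1) and q = assms(3,4) and conv = assms(10)
  have V: "(v x, chi x) \<in> Dsp \<times> Lset" for x using assms(9) by blast
  have L: "lcq lam q (r j) (M j) (X j)" for j
    using assms(6,7) lam q by (auto simp: lcq_def)
  have l1: "(\<lambda>j. 1 / real (r j)) \<longlonglongrightarrow> 0"
    using LIMSEQ_subseq_LIMSEQ[OF lim_1_over_n assms(5)] by (simp add: comp_def)
  have "(\<lambda>j. sqrt (1 / real (r j))) \<longlonglongrightarrow> sqrt 0" by (intro tendsto_intros l1)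
  then have l2: "(\<lambda>j. 1 / sqrt (real (r j))) \<longlonglongrightarrow> 0" by (simp add: real_sqrt_divide)
  \<comment> \<open>The absolute value makes the functional nonnegative for arbitrary arguments, as
    the passage to the limit asks.\<close>
  have small: "AE x in P. \<bar>occF t (\<lambda>_. 1) (Suc k) (\<lambda>w. if w (Suc k) < enat N then 1 else 0) (v x, chi x)\<bar> = 0" if t: "0 < t" for t k N
  proof (rule conv_dist_AE_zero[OF conv Ftest_abs[OF Ftest_occ_small[OF t]] _ assms(8) V])
    have "(\<lambda>j. real N * t * (1 / real (r j))) \<longlonglongrightarrow> real N * t * 0" by (intro tendsto_intros l1)
    then show "(\<lambda>j. real N * t * (1 / real (r j))) \<longlonglongrightarrow> 0" by simp
    fix j
    interpret lcq lam q "r j" "M j" "X j" by (rule L)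
    have "(\<integral>x. \<bar>occF t (\<lambda>_. 1) (Suc k) (\<lambda>w. if w (Suc k) < enat N then 1 else 0) (Y x)\<bar> \<partial>M j) \<le> (\<integral>x. real N * t / real (r j) \<partial>M j)"
      by (rule integral_mono') (use occ_small_bound[OF t] t in auto)
    then show "(\<integral>x. \<bar>occF t (\<lambda>_. 1) (Suc k) (\<lambda>w. if w (Suc k) < enat N then 1 else 0) (\<lambda>t. uOf (r j) (X j x t), occ (X j x))\<bar> \<partial>M j) \<le> real N * t * (1 / real (r j))"
      by (simp add: Y_def prob_space)
  qed simp
  have gen: "AE x in P. \<bar>genF lam q t (cylO N a) N (v x, chi x)\<bar> = 0" if t: "0 < t" for t N a
  proof (rule conv_dist_AE_zero[OF conv Ftest_abs[OF Ftest_genF_cylO[OF q t]] _ assms(8) V])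
    have "(\<lambda>j. (1 + (lam + 1) * 4 * t) * (1 / sqrt (real (r j))) + 2 * (1 / real (r j))) \<longlonglongrightarrow> (1 + (lam + 1) * 4 * t) * 0 + 2 * 0"
      by (intro tendsto_intros l1 l2)
    then show "(\<lambda>j. (1 + (lam + 1) * 4 * t) * (1 / sqrt (real (r j))) + 2 * (1 / real (r j))) \<longlonglongrightarrow> 0" by simp
    fix j
    interpret lcq lam q "r j" "M j" "X j" by (rule L)
    show "(\<integral>x. \<bar>genF lam q t (cylO N a) N (\<lambda>t. uOf (r j) (X j x t), occ (X j x))\<bar> \<partial>M j) \<le> (1 + (lam + 1) * 4 * t) * (1 / sqrt (real (r j))) + 2 * (1 / real (r j))"
      using genF_expectation[OF dependsO_cylO[of N a] cylO_bound t] by (simp add: Y_def)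
  qed simp
  have flow: "AE x in P. \<bar>flowF lam q t k (v x, chi x)\<bar> = 0" if t: "0 < t" for t k
  proof (rule conv_dist_AE_zero[OF conv Ftest_abs[OF Ftest_flowF[OF q t]] _ assms(8) V])
    have "(\<lambda>j. t * (1 + (lam + 1) * t) * (1 / sqrt (real (r j)))) \<longlonglongrightarrow> t * (1 + (lam + 1) * t) * 0"
      by (intro tendsto_intros l2)
    then show "(\<lambda>j. t * (1 + (lam + 1) * t) * (1 / sqrt (real (r j)))) \<longlonglongrightarrow> 0" by simp
    fix j
    interpret lcq lam q "r j" "M j" "X j" by (rule L)
    show "(\<integral>x. \<bar>flowF lam q t k (\<lambda>t. uOf (r j) (X j x t), occ (X j x))\<bar> \<partial>M j) \<le> t * (1 + (lam + 1) * t) * (1 / sqrt (real (r j)))"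
      using flowF_expectation[OF t, of k] by (simp add: Y_def)
  qed simp
  \<comment> \<open>Rational times, integer levels and enumerated states are indexed by countable
    types, so the exceptional events unite to one null event.\<close>
  have "AE x in P. \<forall>a :: rat. \<forall>k N. 0 < real_of_rat a \<longrightarrow>
      occF (real_of_rat a) (\<lambda>_. 1) (Suc k) (\<lambda>w. if w (Suc k) < enat N then 1 else 0) (v x, chi x) = 0"
    unfolding AE_all_countable using small by (auto simp only: abs_eq_0_iff AE_impI)
  moreover have "AE x in P. \<forall>a :: rat. \<forall>N n. 0 < real_of_rat a \<longrightarrow> genF lam q (real_of_rat a) (cylO N (enumO n)) N (v x, chi x) = 0"
    unfolding AE_all_countable using gen by (auto simp only: abs_eq_0_iff AE_impI)
  moreover have "AE x in P. \<forall>a :: rat. \<forall>k. 0 < real_of_rat a \<longrightarrow> flowF lam q (real_of_rat a) k (v x, chi x) = 0"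
    unfolding AE_all_countable using flow by (auto simp only: abs_eq_0_iff AE_impI)
  ultimately show ?thesis
  proof eventually_elim
    case (elim x)
    show ?case
    proof (rule fluid_limit_characterisation[OF _ _ q lam])
      show "v x \<in> Dsp" "chi x \<in> Lset" using assms(9) by auto
      fix t :: real assume t: "t \<in> \<rat>" "0 < t"
      then obtain b where b: "t = real_of_rat b" by (auto elim: Rats_cases)
      show "occF t (\<lambda>_. 1) (Suc k) (\<lambda>w. if w (Suc k) < enat N then 1 else 0) (v x, chi x) = 0" for k N
        using elim(1) t(2) unfolding b by blast
      show "flowF lam q t k (v x, chi x) = 0" for k using elim(3) t(2) unfolding b by blast
      show "genF lam q t (cylO N a) N (v x, chi x) = 0" if "a \<in> OmegaS" for N a
        using elim(2) t(2) enumO_ex[OF that] unfolding b by blast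
    qed
  qed
qed

end
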